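(* Let $\lambda>1$ and $\mu>0$. There exists $\nu_0>\mu\varrho(\lambda)$ such that for every $\nu\ge\nu_0$ the following holds. Let $\{\omega_n\}_{n\ge1}$ be a sequence of functions on $\Pi$ with $\omega_n\ge0$, $\omega_n\in L^1(\Pi)\cap L^2(\Pi)$, $\int_\Pi\omega_n\,dx\le\nu$ and $\|\omega_n\|_2\le C$ for all $n$ (for some constant $C$), such that $\mu_n:=\int_\Pi x_2\omega_n\,dx\to\mu$ and $\mathcal E_\lambda(\omega_n)\to S_{\mu,\nu,\lambda}$ as $n\to\infty$. Then there exist $\omega\in\Sigma_{\mu,\nu,\lambda}$, a subsequence $\{\omega_{n_k}\}$ and real numbers $\{c_k\}$ such that, as $k\to\infty$, $$\omega_{n_k}(\cdot+c_k\mathrm e_1)\to\omega\ \text{in }L^2(\Pi)\qquad\text{and}\qquad x_2\,\omega_{n_k}(\cdot+c_k\mathrm e_1)\to x_2\,\omega\ \text{in }L^1(\Pi).$$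
   Context: Let $\Pi=\{x=(x_1,x_2)\in\mathbb R^2: x_2>0\}$, $\mathrm e_1=(1,0)$, and for $x=(x_1,x_2)$ write $\bar x=(x_1,-x_2)$. Let $G(x,y)=\frac{1}{2\pi}K_0(|x-y|)$ be the fundamental solution of $-\Delta+\mathrm{Id}$ on $\mathbb R^2$ ($K_0$ the modified Bessel function of the second kind of order zero). Set $G_\Pi(x,y)=G(x,y)-G(\bar x,y)$ for $x,y\in\Pi$, $\mathcal G\omega(x)=\int_\Pi G_\Pi(x,y)\omega(y)\,dy$, $E(\omega)=\frac12\int_\Pi\omega\,\mathcal G\omega\,dx$ and $I(\omega)=\int_\Pi x_2\omega\,dx$. $\|\cdot\|_p$ denotes the $L^p(\Pi)$ norm. Variational problem: for $\lambda>1,\mu>0,\nu>0$ let $\mathcal A_{\mu,\nu}=\{\omega\in L^2(\Pi):\omega\ge0,\ \int_\Pi x_2\omega\,dx=\mu,\ \int_\Pi\omega\,dx\le\nu\}$, $\mathcal E_\lambda(\omega)=E(\omega)-\frac1{2\lambda}\int_\Pi\omega^2\,dx$, $S_{\mu,\nu,\lambda}=\sup_{\omega\in\mathcal A_{\mu,\nu}}\mathcal E_\lambda(\omega)$, and $\Sigma_{\mu,\nu,\lambda}=\{\omega\in\mathcal A_{\mu,\nu}:\mathcal E_\lambda(\omega)=S_{\mu,\nu,\lambda}\}$. Lamb dipole: for $\lambda>1$ let $a=a(\lambda)$ be the smallest positive solution of $$a\Big(\frac{K_1'(a)}{K_1(a)}+\frac{1}{(\lambda-1)^{1/2}}\cdot\frac{J_1'((\lambda-1)^{1/2}a)}{J_1((\lambda-1)^{1/2}a)}\Big)=\frac{\lambda}{\lambda-1},$$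 where $J_1$ is the Bessel function of the first kind of order one and $K_1$ the modified Bessel function of the second kind of order one (such a smallest positive solution exists). For $W>0$, in polar coordinates $x=(r\cos\theta,r\sin\theta)$, define $$\Psi_L^{\lambda,W}(x)=\begin{cases}\big(A_LJ_1((\lambda-1)^{1/2}r)+\frac{W\lambda}{\lambda-1}r\big)\sin\theta,& r\le a,\\ \frac{Wa}{K_1(a)}K_1(r)\sin\theta,& r>a,\end{cases}\qquad A_L=-\frac{Wa}{(\lambda-1)J_1((\lambda-1)^{1/2}a)},$$ and $\omega_L^{\lambda,W}=\lambda(\Psi_L^{\lambda,W}-Wx_2)_+$ on $\Pi$. Finally $\varrho(\lambda)=\frac{1}{I(\omega_L^{\lambda,1})}\int_\Pi\omega_L^{\lambda,1}\,dx$. *)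

theory Defs
  imports "HOL-Analysis.Analysis"
begin

text \<open>Points of the plane are pairs (x1, x2) of reals; the product metric is Euclidean.\<close>

definition upper_half :: "(real \<times> real) set" where
  "upper_half = {x. snd x > 0}"

definition reflect :: "real \<times> real \<Rightarrow> real \<times> real" where
  "reflect x = (fst x, - snd x)"

definition besselK0 :: "real \<Rightarrow> real" where
  "besselK0 r = set_lebesgue_integral lborel {0..} (\<lambda>t. exp (- r * cosh t))"

definition besselK1 :: "real \<Rightarrow> real" where
  "besselK1 r = set_lebesgue_integral lborel {0..} (\<lambda>t. exp (- r * cosh t) * cosh t)"

definition besselJ1 :: "real \<Rightarrow> real" where
  "besselJ1 x = (\<Sum>m. (-1) ^ m / (fact m * fact (m + 1)) * (x / 2) ^ (2 * m + 1))"

definition GreenR2 :: "real \<times> real \<Rightarrow> real \<times> real \<Rightarrow> real" where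
  "GreenR2 x y = 1 / (2 * pi) * besselK0 (dist x y)"

definition GreenPi :: "real \<times> real \<Rightarrow> real \<times> real \<Rightarrow> real" where
  "GreenPi x y = GreenR2 x y - GreenR2 (reflect x) y"

definition Gop :: "(real \<times> real \<Rightarrow> real) \<Rightarrow> real \<times> real \<Rightarrow> real" where
  "Gop \<omega> x = set_lebesgue_integral lborel upper_half (\<lambda>y. GreenPi x y * \<omega> y)"

definition energy :: "(real \<times> real \<Rightarrow> real) \<Rightarrow> real" where
  "energy \<omega> = 1 / 2 * set_lebesgue_integral lborel upper_half (\<lambda>x. \<omega> x * Gop \<omega> x)"

definition impulse :: "(real \<times> real \<Rightarrow> real) \<Rightarrow> real" where
  "impulse \<omega> = set_lebesgue_integral lborel upper_half (\<lambda>x. snd x * \<omega> x)"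

definition mass :: "(real \<times> real \<Rightarrow> real) \<Rightarrow> real" where
  "mass \<omega> = set_lebesgue_integral lborel upper_half \<omega>"

definition sq_int :: "(real \<times> real \<Rightarrow> real) \<Rightarrow> real" where
  "sq_int \<omega> = set_lebesgue_integral lborel upper_half (\<lambda>x. (\<omega> x)\<^sup>2)"

definition in_L2 :: "(real \<times> real \<Rightarrow> real) \<Rightarrow> bool" where
  "in_L2 \<omega> \<longleftrightarrow> (\<lambda>x. indicator upper_half x * \<omega> x) \<in> borel_measurable lborel
      \<and> set_integrable lborel upper_half (\<lambda>x. (\<omega> x)\<^sup>2)"

definition in_L1 :: "(real \<times> real \<Rightarrow> real) \<Rightarrow> bool" where
  "in_L1 \<omega> \<longleftrightarrow> set_integrable lborel upper_half \<omega>"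

definition nonneg_ae :: "(real \<times> real \<Rightarrow> real) \<Rightarrow> bool" where
  "nonneg_ae \<omega> \<longleftrightarrow> (AE x in lborel. x \<in> upper_half \<longrightarrow> \<omega> x \<ge> 0)"

text \<open>Admissible class A_{mu,nu}; the integrals of nonnegative functions are taken
  as extended nonnegative integrals, so "int omega \<le> nu" includes finiteness.\<close>

definition admissible :: "real \<Rightarrow> real \<Rightarrow> (real \<times> real \<Rightarrow> real) set" where
  "admissible \<mu> \<nu> = {\<omega>. in_L2 \<omega> \<and> nonneg_ae \<omega>
      \<and> set_nn_integral lborel upper_half (\<lambda>x. ennreal (snd x * \<omega> x)) = ennreal \<mu>
      \<and> set_nn_integral lborel upper_half (\<lambda>x. ennreal (\<omega> x)) \<le> ennreal \<nu>}"

definition energy_lam :: "real \<Rightarrow> (real \<times> real \<Rightarrow> real) \<Rightarrow> real" where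
  "energy_lam lam \<omega> = energy \<omega> - 1 / (2 * lam) * sq_int \<omega>"

definition S_max :: "real \<Rightarrow> real \<Rightarrow> real \<Rightarrow> real" where
  "S_max \<mu> \<nu> lam = (SUP \<omega>\<in>admissible \<mu> \<nu>. energy_lam lam \<omega>)"

definition maximizers :: "real \<Rightarrow> real \<Rightarrow> real \<Rightarrow> (real \<times> real \<Rightarrow> real) set" where
  "maximizers \<mu> \<nu> lam = {\<omega> \<in> admissible \<mu> \<nu>. energy_lam lam \<omega> = S_max \<mu> \<nu> lam}"

definition lamb_a :: "real \<Rightarrow> real" where
  "lamb_a lam = Inf {a. a > 0 \<and> besselJ1 (sqrt (lam - 1) * a) \<noteq> 0 \<and> besselK1 a \<noteq> 0 \<and>
      a * (deriv besselK1 a / besselK1 a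
           + 1 / sqrt (lam - 1) * (deriv besselJ1 (sqrt (lam - 1) * a) / besselJ1 (sqrt (lam - 1) * a)))
      = lam / (lam - 1)}"

definition lamb_A :: "real \<Rightarrow> real \<Rightarrow> real" where
  "lamb_A lam W = - (W * lamb_a lam) / ((lam - 1) * besselJ1 (sqrt (lam - 1) * lamb_a lam))"

text \<open>In polar coordinates r = norm x, sin theta = x2 / r (the value at the origin is 0).\<close>

definition lamb_Psi :: "real \<Rightarrow> real \<Rightarrow> real \<times> real \<Rightarrow> real" where
  "lamb_Psi lam W x = (let r = norm x; a = lamb_a lam in
     if r \<le> a then (lamb_A lam W * besselJ1 (sqrt (lam - 1) * r) + W * lam / (lam - 1) * r) * (snd x / r)
     else W * a / besselK1 a * besselK1 r * (snd x / r))"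

definition lamb_omega :: "real \<Rightarrow> real \<Rightarrow> real \<times> real \<Rightarrow> real" where
  "lamb_omega lam W x = lam * max 0 (lamb_Psi lam W x - W * snd x)"

definition varrho :: "real \<Rightarrow> real" where
  "varrho lam = mass (lamb_omega lam 1) / impulse (lamb_omega lam 1)"

definition shift1 :: "(real \<times> real \<Rightarrow> real) \<Rightarrow> real \<Rightarrow> real \<times> real \<Rightarrow> real" where
  "shift1 \<omega> c x = \<omega> (fst x + c, snd x)"

end

theory Submission
  imports Defs "HOL-Library.Diagonal_Subsequence"
begin

text \<open>The energy is quadratic and the kernel of $G_\Pi$ is nonnegative and bounded by
  $C_\delta x_2 y_2$ away from the diagonal, so without any mass constraint
  $E_\lambda(\omega) \le \kappa I(\omega)^2$ with a finite sharp constant $\kappa$, positive because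
  $\lambda > 1$ and $G$ has integral one. Replacing $\omega$ by $\min(\omega, \lambda G\omega)$ does
  not decrease $E_\lambda$ and leaves a function of mass at most $2\lambda I(\omega)$; hence
  $S_{\mu,\nu,\lambda} = \kappa\mu^2$ as soon as $\nu \ge 4\lambda\mu$, and the Lamb dipole
  plays no role beyond fixing a lower bound for $\nu_0$.

  Along a maximizing sequence the potential cannot tend to zero uniformly, so suitable horizontal
  translates have a nonzero weak limit $\omega$ in $L^2$. Local compactness of the Green operator
  and the sharp inequality for the part near infinity give
  $\kappa\mu^2 \le \kappa m^2 + \kappa(\mu - m)^2$ for $m = I(\omega) > 0$, which excludes
  dichotomy and forces $m = \mu$. Then $E(\omega_n) \to E(\omega)$, so the $L^2$ norms
  converge and the convergence is strong.\<close>

section \<open>The Bessel kernel\<close>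

text \<open>The constant \<kappa> is finite because the kernel splits at a small distance \<delta>:
  the near part has row integrals at most 1/\<lambda>, so by Schur's test the enstrophy term absorbs
  it, and the far part factorises into impulses. The usual obstacle in concentration-compactness is
  that a splitting sequence distributes both impulse and mass among its pieces. As the sharp
  inequality mentions the impulse alone, every piece is compared with the same \<kappa>, and strict
  superadditivity of the square decides. Truncation reconciles this with a finite \<nu>: for d =
  \<omega> - min(\<omega>, \<lambda>G\<omega>) the energy gain is exactly E(d) plus the enstrophy of
  d divided by 2\<lambda>. A factor two between the mass bound 2\<lambda>I and the threshold
  4\<lambda>\<mu> pays for restoring the impulse lost in truncation. The facts on G (integral one,
  square integrability, integrals over lines) all come from writing K_0 as an integral of exp(-r
  cosh t) and exchanging integrals, without asymptotics of Bessel functions.\<close>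

lemma nn_integral_exp_half_line:
  assumes "c > 0"
  shows "(\<integral>\<^sup>+t. ennreal (exp (- c * t)) * indicator {a..} t \<partial>lborel) = ennreal (exp (- c * a) / c)"
proof -
  have lim: "((\<lambda>t. - exp (- c * t) / c) \<longlongrightarrow> 0) at_top"
  proof -
    have "filterlim (\<lambda>t. c * t) at_top at_top"
      using assms by (rule filterlim_tendsto_pos_mult_at_top[OF tendsto_const _ filterlim_ident])
    then have "((\<lambda>t. exp (- (c * t))) \<longlongrightarrow> 0) at_top"
      by (intro filterlim_compose[OF exp_at_bot]) (simp add: filterlim_uminus_at_bot)
    then show ?thesis using tendsto_divide[OF tendsto_minus tendsto_const[of c], of _ 0] assms by simp
  qed
  have "(\<integral>\<^sup>+t. ennreal (exp (- c * t)) * indicator {a..} t \<partial>lborel) = ennreal (0 - (- exp (- c * a) / c))"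
    using lim assms by (intro nn_integral_FTC_atLeast) (auto intro!: derivative_eq_intros)
  then show ?thesis by simp
qed

lemmas lebesgue_integral_cong = Bochner_Integration.integral_cong

section \<open>Translation invariance of Lebesgue integrals\<close>

lemma nn_integral_lborel_shift:
  fixes f :: "'a::euclidean_space \<Rightarrow> ennreal"
  assumes "f \<in> borel_measurable borel"
  shows "(\<integral>\<^sup>+x. f (x + a) \<partial>lborel) = (\<integral>\<^sup>+x. f x \<partial>lborel)"
proof -
  have "(\<integral>\<^sup>+x. f x \<partial>distr lborel borel ((+) a)) = (\<integral>\<^sup>+x. f (a + x) \<partial>lborel)"
    using assms by (subst nn_integral_distr) auto
  then show ?thesis by (simp add: lborel_distr_plus add.commute)
qed

lemma integral_lborel_shift:
  fixes f :: "'a::euclidean_space \<Rightarrow> real"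
  assumes "f \<in> borel_measurable borel"
  shows "(LBINT x. f (x + a)) = (LBINT x. f x)"
proof -
  have "(\<integral>x. f x \<partial>distr lborel borel ((+) a)) = (LBINT x. f (a + x))"
    using assms by (subst integral_distr) auto
  then show ?thesis by (simp add: lborel_distr_plus add.commute)
qed

lemma integrable_lborel_shift:
  fixes f :: "'a::euclidean_space \<Rightarrow> real"
  assumes "integrable lborel f"
  shows "integrable lborel (\<lambda>x. f (x + a))"
proof -
  have "integrable (distr lborel borel ((+) a)) f" using assms by (simp add: lborel_distr_plus)
  then show ?thesis using assms by (subst (asm) integrable_distr_eq) (auto simp: add.commute)
qed

section \<open>Elementary bounds for \<open>cosh\<close> and the exponential\<close>

lemma cosh_ge_exp: "cosh t \<ge> exp t / 2" for t :: real
  by (simp add: cosh_def)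

lemma inverse_cosh_le: "1 / cosh t \<le> 2 * exp (- t)" for t :: real
proof -
  have "1 / cosh t \<le> 1 / (exp t / 2)" using cosh_ge_exp[of t] by (intro divide_left_mono) auto
  then show ?thesis by (simp add: exp_minus field_simps)
qed

lemma exp_minus_le_inverse: "exp (- x) \<le> 1 / x" if "x > 0" for x :: real
proof -
  have "x \<le> exp x" using exp_ge_add_one_self[of x] by linarith
  then show ?thesis using that by (simp add: exp_minus field_simps)
qed

lemma exp_minus_le_inverse_sq: "exp (- x) \<le> 2 / x\<^sup>2" if "x > 0" for x :: real
proof -
  have "x\<^sup>2 / 2 \<le> exp x" using exp_lower_Taylor_quadratic[of x] that by linarith
  then show ?thesis using that by (simp add: exp_minus field_simps)
qed

lemma exp_cosh_le: "exp (- r * cosh t) \<le> 2 / r * exp (- t)" if "r > 0" for r t :: real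
proof -
  have "exp (- (r * cosh t)) \<le> 1 / (r * cosh t)"
    using that by (intro exp_minus_le_inverse) simp
  also have "\<dots> = 1 / r * (1 / cosh t)" by simp
  also have "\<dots> \<le> 1 / r * (2 * exp (- t))"
    using that by (intro mult_left_mono inverse_cosh_le) auto
  finally show ?thesis by simp
qed

lemma exp_integrable_half_line: "integrable lborel (\<lambda>t. indicator {0..} t * exp (- t) :: real)"
  and exp_integral_half_line: "(LBINT t. indicator {0..} t * exp (- t)) = (1 :: real)"
proof -
  have "(\<integral>\<^sup>+t. ennreal (indicator {0..} t * exp (- t)) \<partial>lborel)
    = (\<integral>\<^sup>+t. ennreal (exp (- 1 * t)) * indicator {0..} t \<partial>lborel)"
    by (intro nn_integral_cong) (auto simp: indicator_def)
  also have "\<dots> = ennreal 1" using nn_integral_exp_half_line[of 1 0] by simp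
  finally have "has_bochner_integral lborel (\<lambda>t. indicator {0..} t * exp (- t) :: real) 1"
    by (intro has_bochner_integral_nn_integral) auto
  then show "integrable lborel (\<lambda>t. indicator {0..} t * exp (- t) :: real)"
    "(LBINT t. indicator {0..} t * exp (- t)) = (1 :: real)"
    by (auto simp: has_bochner_integral_iff)
qed

section \<open>Decay and Lipschitz bounds for K_0\<close>

lemma cosh_measurable [measurable]: "(cosh :: real \<Rightarrow> real) \<in> borel_measurable borel"
  by (intro borel_measurable_continuous_onI continuous_intros)

lemma snd_borel_measurable [measurable]: "(snd :: real \<times> real \<Rightarrow> real) \<in> borel_measurable borel"
  by (intro borel_measurable_continuous_onI continuous_intros)

lemma besselK0_integrable:
  fixes r :: real
  assumes "r > 0"
  shows "integrable lborel (\<lambda>t. indicator {0..} t * exp (- r * cosh t))"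
proof (rule Bochner_Integration.integrable_bound)
  show "integrable lborel (\<lambda>t. 2 / r * (indicator {0..} t * exp (- t)))"
    using exp_integrable_half_line by (rule integrable_mult_right)
  show "AE t in lborel. norm (indicator {0..} t * exp (- r * cosh t)) \<le> norm (2 / r * (indicator {0..} t * exp (- t)))"
    using assms exp_cosh_le[OF assms] by (intro AE_I2) (auto simp: indicator_def)
  show "(\<lambda>t. indicator {0..} t * exp (- r * cosh t)) \<in> borel_measurable lborel"
    by measurable
qed

lemma besselK0_eq: "besselK0 r = (LBINT t. indicator {0..} t * exp (- r * cosh t))"
  by (simp add: besselK0_def set_lebesgue_integral_def)

lemma besselK0_measurable [measurable]: "besselK0 \<in> borel_measurable borel"
  unfolding besselK0_eq[abs_def] by measurable

lemma besselK0_nonneg: "0 \<le> besselK0 r"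
  unfolding besselK0_eq by (intro integral_nonneg_AE AE_I2) auto

lemma besselK0_antimono:
  assumes "0 < r" "r \<le> s"
  shows "besselK0 s \<le> besselK0 r"
  unfolding besselK0_eq
proof (rule integral_mono)
  show "indicator {0..} t * exp (- s * cosh t) \<le> indicator {0..} t * exp (- r * cosh t)" for t
    using assms by (intro mult_left_mono) (auto intro: mult_right_mono)
qed (use assms besselK0_integrable in auto)

lemma besselK0_le:
  assumes "r > 0"
  shows "besselK0 r \<le> 2 / r"
proof -
  have "besselK0 r \<le> (LBINT t. 2 / r * (indicator {0..} t * exp (- t)))"
    unfolding besselK0_eq using assms exp_cosh_le[OF assms] exp_integrable_half_line
    by (intro integral_mono besselK0_integrable) (auto simp: indicator_def)
  then show ?thesis using exp_integral_half_line by simp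
qed

text \<open>The difference of the exponentials costs at most a factor (s - r) cosh t, since 1 -
  exp(-u) \<le> u. Bounding the remaining exponential by 2/(r cosh t)^2 leaves 1/cosh t, which is
  integrable. This Lipschitz bound produces the factors x2 and y2 in \<open>ker_far\<close>.\<close>

lemma besselK0_diff_le:
  assumes "\<delta> > 0" "\<delta> \<le> r" "r \<le> s"
  shows "besselK0 r - besselK0 s \<le> 4 / \<delta>\<^sup>2 * (s - r)"
proof -
  have ptw: "exp (- r * cosh t) - exp (- s * cosh t) \<le> 4 / \<delta>\<^sup>2 * (s - r) * exp (- t)" for t
  proof -
    define c where "c = cosh t"
    have c: "c > 0" by (simp add: c_def)
    have d2: "\<delta>\<^sup>2 \<le> r\<^sup>2" using assms by (intro power_mono) auto
    have "exp (- r * c) - exp (- s * c) = exp (- r * c) * (1 - exp (- ((s - r) * c)))"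
      by (simp add: algebra_simps flip: exp_add)
    also have "\<dots> \<le> exp (- r * c) * ((s - r) * c)"
      using exp_ge_add_one_self[of "- ((s - r) * c)"] by (intro mult_left_mono) auto
    also have "\<dots> \<le> 2 / (r * c)\<^sup>2 * ((s - r) * c)"
      using exp_minus_le_inverse_sq[of "r * c"] assms c by (intro mult_right_mono) auto
    also have "\<dots> = 2 / r\<^sup>2 * (s - r) * (1 / c)"
      using c by (simp add: power2_eq_square)
    also have "\<dots> \<le> 2 / \<delta>\<^sup>2 * (s - r) * (2 * exp (- t))"
      using assms c d2 inverse_cosh_le[of t] unfolding c_def
      by (intro mult_mono divide_left_mono) auto
    finally show ?thesis by (simp add: c_def algebra_simps)
  qed
  have "besselK0 r - besselK0 s = (LBINT t. indicator {0..} t * exp (- r * cosh t) - indicator {0..} t * exp (- s * cosh t))"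
    unfolding besselK0_eq using assms
    by (intro Bochner_Integration.integral_diff[symmetric] besselK0_integrable) auto
  also have "\<dots> \<le> (LBINT t. 4 / \<delta>\<^sup>2 * (s - r) * (indicator {0..} t * exp (- t)))"
  proof (rule integral_mono)
    show "integrable lborel (\<lambda>t. indicator {0..} t * exp (- r * cosh t) - indicator {0..} t * exp (- s * cosh t))"
      using assms by (intro Bochner_Integration.integrable_diff besselK0_integrable) auto
    show "integrable lborel (\<lambda>t. 4 / \<delta>\<^sup>2 * (s - r) * (indicator {0..} t * exp (- t)))"
      using exp_integrable_half_line by (rule integrable_mult_right)
    show "indicator {0..} t * exp (- r * cosh t) - indicator {0..} t * exp (- s * cosh t)
        \<le> 4 / \<delta>\<^sup>2 * (s - r) * (indicator {0..} t * exp (- t))" for t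
      using ptw[of t] by (auto simp: indicator_def)
  qed
  also have "\<dots> = 4 / \<delta>\<^sup>2 * (s - r)" by (simp only: integral_mult_right_zero exp_integral_half_line)
  finally show ?thesis by simp
qed

section \<open>The fundamental solution and its integrals over the plane, lines and slabs\<close>

definition gam :: "real \<times> real \<Rightarrow> real" where
  "gam z = 1 / (2 * pi) * besselK0 (norm z)"

text \<open>K_0 as an extended nonnegative integral, so that integrals can be exchanged by Tonelli
  before finiteness is known. It agrees with \<open>besselK0\<close> for positive arguments; at 0 it
  is infinite, whereas the Bochner integral is 0.\<close>

definition k0 :: "real \<Rightarrow> ennreal" where
  "k0 r = (\<integral>\<^sup>+t. ennreal (exp (- r * cosh t)) * indicator {0..} t \<partial>lborel)"

lemma k0_measurable [measurable]: "k0 \<in> borel_measurable borel"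
  unfolding k0_def[abs_def] by measurable

lemma k0_eq: "r > 0 \<Longrightarrow> k0 r = ennreal (besselK0 r)"
proof -
  assume r: "r > 0"
  have "k0 r = (\<integral>\<^sup>+t. ennreal (indicator {0..} t * exp (- r * cosh t)) \<partial>lborel)"
    unfolding k0_def by (intro nn_integral_cong) (auto simp: indicator_def)
  also have "\<dots> = ennreal (besselK0 r)"
    unfolding besselK0_eq by (intro nn_integral_eq_integral besselK0_integrable r) auto
  finally show ?thesis .
qed

lemma gam_measurable [measurable]: "gam \<in> borel_measurable borel"
  unfolding gam_def[abs_def] by measurable

lemma gam_nonneg: "0 \<le> gam z"
  by (simp add: gam_def besselK0_nonneg)

lemma gam_antimono: "0 < norm z \<Longrightarrow> norm z \<le> norm w \<Longrightarrow> gam w \<le> gam z"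
  by (simp add: gam_def besselK0_antimono divide_right_mono)

lemma gam_eq: "z \<noteq> 0 \<Longrightarrow> ennreal (gam z) = ennreal (1 / (2 * pi)) * k0 (norm z)"
  by (simp add: gam_def k0_eq ennreal_mult[symmetric] besselK0_nonneg)

text \<open>A layer-cake argument in place of polar coordinates: exp(-c|z|) is the integral of c
  exp(-ct) over t \<ge> |z|, and exchanging the integrals leaves the areas of discs of radius
  t.\<close>

lemma nn_integral_exp_norm:
  assumes "c > 0"
  shows "(\<integral>\<^sup>+z. ennreal (exp (- c * norm (z :: real \<times> real))) \<partial>lborel) = ennreal (2 * pi / c\<^sup>2)"
proof -
  let ?g = "\<lambda>z t. ennreal (c * exp (- c * t)) * indicator {norm (z :: real \<times> real)..} t"
  have "(\<integral>\<^sup>+z. ennreal (exp (- c * norm (z :: real \<times> real))) \<partial>lborel)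
    = (\<integral>\<^sup>+z. (\<integral>\<^sup>+t. ?g z t \<partial>lborel) \<partial>lborel)"
  proof (rule nn_integral_cong)
    fix z :: "real \<times> real"
    have "(\<integral>\<^sup>+t. ?g z t \<partial>lborel)
      = ennreal c * (\<integral>\<^sup>+t. ennreal (exp (- c * t)) * indicator {norm z..} t \<partial>lborel)"
      using assms by (subst nn_integral_cmult[symmetric]) (auto simp: ennreal_mult mult.assoc)
    also have "\<dots> = ennreal (exp (- c * norm z))"
      using assms by (simp only: nn_integral_exp_half_line) (simp flip: ennreal_mult)
    finally show "ennreal (exp (- c * norm z)) = (\<integral>\<^sup>+t. ?g z t \<partial>lborel)" by simp
  qed
  also have "\<dots> = (\<integral>\<^sup>+t. (\<integral>\<^sup>+z. ?g z t \<partial>lborel) \<partial>lborel)"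
  proof (rule lborel_pair.Fubini'[symmetric])
    have "(\<lambda>p. ennreal (c * exp (- c * snd p)) * (if norm (fst p :: real \<times> real) \<le> snd p then 1 else 0)) \<in> borel_measurable (lborel \<Otimes>\<^sub>M lborel)"
      by measurable
    also have "(\<lambda>p. ennreal (c * exp (- c * snd p)) * (if norm (fst p :: real \<times> real) \<le> snd p then 1 else 0))
      = case_prod ?g"
      by (auto simp: fun_eq_iff indicator_def)
    finally show "case_prod ?g \<in> borel_measurable (lborel \<Otimes>\<^sub>M lborel)" .
  qed
  also have "\<dots> = (\<integral>\<^sup>+t. ennreal (pi * c * t\<^sup>2 * exp (- c * t)) * indicator {0..} t \<partial>lborel)"
  proof (rule nn_integral_cong)
    fix t :: real
    have "(\<integral>\<^sup>+z. ?g z t \<partial>lborel)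
      = (\<integral>\<^sup>+z. ennreal (c * exp (- c * t)) * indicator (cball (0 :: real \<times> real) t) z \<partial>lborel)"
      by (intro nn_integral_cong) (auto simp: indicator_def)
    also have "\<dots> = ennreal (c * exp (- c * t)) * emeasure lborel (cball (0 :: real \<times> real) t)"
      by (subst nn_integral_cmult_indicator) auto
    also have "\<dots> = ennreal (pi * c * t\<^sup>2 * exp (- c * t)) * indicator {0..} t"
    proof (cases "t \<ge> 0")
      case True
      then show ?thesis using assms
        by (simp add: emeasure_cball unit_ball_vol_2 flip: ennreal_mult) (simp add: mult_ac power2_eq_square)
    qed simp
    finally show "(\<integral>\<^sup>+z. ?g z t \<partial>lborel)
      = ennreal (pi * c * t\<^sup>2 * exp (- c * t)) * indicator {0..} t" .
  qed
  \<comment> \<open>The antiderivative comes from integrating by parts twice and is written in the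
    variable ct; it tends to 0 at infinity.\<close>
  also have "\<dots> = ennreal (0 - (- (pi / c\<^sup>2 * (((c * 0)\<^sup>2 + 2 * (c * 0) + 2) / exp (c * 0)))))"
  proof (rule nn_integral_FTC_atLeast)
    show "((\<lambda>t. - (pi / c\<^sup>2 * (((c * t)\<^sup>2 + 2 * (c * t) + 2) / exp (c * t)))) \<longlongrightarrow> 0) at_top"
    proof -
      have "((\<lambda>u::real. u ^ 2 / exp u + 2 * (u ^ 1 / exp u) + 2 * (u ^ 0 / exp u)) \<longlongrightarrow> 0 + 2 * 0 + 2 * 0) at_top"
        by (intro tendsto_intros tendsto_power_div_exp_0)
      then have "((\<lambda>u::real. (u\<^sup>2 + 2 * u + 2) / exp u) \<longlongrightarrow> 0) at_top"
        by (simp add: add_divide_distrib)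
      moreover have "filterlim (\<lambda>t. c * t) at_top at_top"
        using assms by (rule filterlim_tendsto_pos_mult_at_top[OF tendsto_const _ filterlim_ident])
      ultimately have "((\<lambda>t. ((c * t)\<^sup>2 + 2 * (c * t) + 2) / exp (c * t)) \<longlongrightarrow> 0) at_top"
        by (rule filterlim_compose)
      from tendsto_minus[OF tendsto_mult_left[OF this, of "pi / c\<^sup>2"]] show ?thesis by simp
    qed
    show "((\<lambda>t. - (pi / c\<^sup>2 * (((c * t)\<^sup>2 + 2 * (c * t) + 2) / exp (c * t)))) has_real_derivative pi * c * t\<^sup>2 * exp (- c * t)) (at t)" for t
      using assms
      by (auto intro!: derivative_eq_intros simp: exp_minus field_simps power2_eq_square)
  qed (use assms in auto)
  finally show ?thesis by simp
qed

text \<open>Exchanging integrals reduces the mass to the integral of 1/cosh^2 over the half-line,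
  with antiderivative tanh. That the mass is exactly one makes \<lambda> = 1 the threshold in
  \<open>kappa_pos\<close>.\<close>

lemma gam_nn_integral: "(\<integral>\<^sup>+z. ennreal (gam z) \<partial>lborel) = 1"
proof -
  have "(\<integral>\<^sup>+z. ennreal (gam z) \<partial>lborel) = (\<integral>\<^sup>+z. ennreal (1 / (2 * pi)) * k0 (norm (z :: real \<times> real)) \<partial>lborel)"
    by (intro nn_integral_cong_AE) (use AE_lborel_singleton[of 0] in eventually_elim, rule gam_eq)
  also have "\<dots> = ennreal (1 / (2 * pi)) * (\<integral>\<^sup>+z. k0 (norm (z :: real \<times> real)) \<partial>lborel)"
    by (rule nn_integral_cmult) measurable
  also have "(\<integral>\<^sup>+z. k0 (norm (z :: real \<times> real)) \<partial>lborel)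
     = (\<integral>\<^sup>+t. (\<integral>\<^sup>+z. ennreal (exp (- norm (z :: real \<times> real) * cosh t)) * indicator {0..} t \<partial>lborel) \<partial>lborel)"
    unfolding k0_def by (rule lborel_pair.Fubini'[symmetric]) measurable
  also have "\<dots> = (\<integral>\<^sup>+t. ennreal (2 * pi / (cosh t)\<^sup>2) * indicator {0..} t \<partial>lborel)"
  proof (rule nn_integral_cong)
    fix t :: real
    have "(\<integral>\<^sup>+z. ennreal (exp (- norm (z :: real \<times> real) * cosh t)) * indicator {0..} t \<partial>lborel)
      = (\<integral>\<^sup>+z. ennreal (exp (- cosh t * norm (z :: real \<times> real))) \<partial>lborel) * indicator {0..} t"
      by (subst nn_integral_multc[symmetric]) (auto simp: mult.commute)
    then show "(\<integral>\<^sup>+z. ennreal (exp (- norm (z :: real \<times> real) * cosh t)) * indicator {0..} t \<partial>lborel) = ennreal (2 * pi / (cosh t)\<^sup>2) * indicator {0..} t"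
      by (simp only: nn_integral_exp_norm[OF cosh_real_pos])
  qed
  also have "\<dots> = ennreal (2 * pi * 1 - 2 * pi * tanh 0)"
  proof (rule nn_integral_FTC_atLeast)
    show "((\<lambda>t. 2 * pi * tanh t) \<longlongrightarrow> 2 * pi * 1) at_top"
      by (intro tendsto_mult_left tanh_real_at_top)
    show "((\<lambda>t. 2 * pi * tanh t) has_real_derivative 2 * pi / (cosh t)\<^sup>2) (at t)" for t
    proof -
      have "(1 - (tanh t)\<^sup>2) = 1 / (cosh t)\<^sup>2"
      proof -
        have "1 - (tanh t)\<^sup>2 = ((cosh t)\<^sup>2 - (sinh t)\<^sup>2) / (cosh t)\<^sup>2"
          using cosh_real_pos[of t] by (simp only: tanh_def power_divide diff_divide_distrib) simp
        then show ?thesis by (simp only: hyperbolic_pythagoras)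
      qed
      then show ?thesis
        by (auto intro!: derivative_eq_intros)
    qed
  qed auto
  finally show ?thesis by (simp flip: ennreal_mult)
qed

lemma gam_integrable: "integrable lborel gam" and gam_integral: "(LBINT z. gam z) = 1"
proof -
  have "has_bochner_integral lborel gam 1"
    using gam_nn_integral by (intro has_bochner_integral_nn_integral) (auto simp: gam_nonneg)
  then show "integrable lborel gam" "(LBINT z. gam z) = 1"
    by (auto simp: has_bochner_integral_iff)
qed

lemma nn_integral_inverse_cosh_le: "(\<integral>\<^sup>+t. ennreal (1 / cosh t) * indicator {0..} t \<partial>lborel) \<le> 2"
proof -
  have "(\<integral>\<^sup>+t. ennreal (1 / cosh t) * indicator {0..} t \<partial>lborel)
     \<le> (\<integral>\<^sup>+t. 2 * (ennreal (exp (- 1 * t)) * indicator {0..} t) \<partial>lborel)"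
  proof (intro nn_integral_mono)
    fix t :: real
    have "ennreal (1 / cosh t) \<le> ennreal (2 * exp (- 1 * t))"
      using inverse_cosh_le[of t] by (intro ennreal_leI) simp
    also have "\<dots> = 2 * ennreal (exp (- 1 * t))" by (simp add: ennreal_mult)
    finally show "ennreal (1 / cosh t) * indicator {0..} t \<le> 2 * (ennreal (exp (- 1 * t)) * indicator {0..} t)"
      by (auto simp: indicator_def)
  qed
  also have "\<dots> = 2 * (\<integral>\<^sup>+t. ennreal (exp (- 1 * t)) * indicator {0..} t \<partial>lborel)"
    by (rule nn_integral_cmult) measurable
  also have "\<dots> = 2" using nn_integral_exp_half_line[of 1 0] by simp
  finally show ?thesis .
qed

text \<open>Cauchy-Schwarz after writing exp(-r cosh t) as (cosh t)^(-1/2) times (cosh t)^(1/2)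
  exp(-r cosh t). The first factor is square integrable on the half-line; the extra cosh t in the
  second is harmless, because integration over the plane yields a factor (2 cosh t)^(-2). This tames
  the logarithmic singularity of K_0 in L^2.\<close>

lemma k0_sq_le: "(k0 r)\<^sup>2 \<le> 2 * (\<integral>\<^sup>+t. ennreal (cosh t * exp (- (2 * cosh t) * r)) * indicator {0..} t \<partial>lborel)"
proof -
  have "k0 r = (\<integral>\<^sup>+t. (ennreal (sqrt (1 / cosh t)) * indicator {0..} t)
       * (ennreal (sqrt (cosh t) * exp (- r * cosh t)) * indicator {0..} t) \<partial>lborel)"
    unfolding k0_def
  proof (rule nn_integral_cong)
    fix t :: real
    have "sqrt (1 / cosh t) * (sqrt (cosh t) * exp (- r * cosh t)) = exp (- r * cosh t)"
      by (simp add: real_sqrt_divide)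
    then show "ennreal (exp (- r * cosh t)) * indicator {0..} t = (ennreal (sqrt (1 / cosh t)) * indicator {0..} t)
       * (ennreal (sqrt (cosh t) * exp (- r * cosh t)) * indicator {0..} t)"
      by (auto simp: indicator_def simp flip: ennreal_mult)
  qed
  then have "(k0 r)\<^sup>2 \<le> (\<integral>\<^sup>+t. (ennreal (sqrt (1 / cosh t)) * indicator {0..} t)\<^sup>2 \<partial>lborel)
      * (\<integral>\<^sup>+t. (ennreal (sqrt (cosh t) * exp (- r * cosh t)) * indicator {0..} t)\<^sup>2 \<partial>lborel)"
    by (simp only:) (rule Cauchy_Schwarz_nn_integral; measurable)
  also have "(\<integral>\<^sup>+t. (ennreal (sqrt (1 / cosh t)) * indicator {0..} t)\<^sup>2 \<partial>lborel) = (\<integral>\<^sup>+t. ennreal (1 / cosh t) * indicator {0..} t \<partial>lborel)"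
    by (intro nn_integral_cong) (auto simp: indicator_def ennreal_power real_sqrt_divide power_divide)
  also have "(\<integral>\<^sup>+t. (ennreal (sqrt (cosh t) * exp (- r * cosh t)) * indicator {0..} t)\<^sup>2 \<partial>lborel)
     = (\<integral>\<^sup>+t. ennreal (cosh t * exp (- (2 * cosh t) * r)) * indicator {0..} t \<partial>lborel)"
    by (intro nn_integral_cong) (auto simp: indicator_def ennreal_power power_mult_distrib mult_ac simp flip: exp_double exp_of_nat_mult)
  also have "(\<integral>\<^sup>+t. ennreal (1 / cosh t) * indicator {0..} t \<partial>lborel) * \<dots> \<le> 2 * \<dots>"
    by (intro mult_right_mono nn_integral_inverse_cosh_le) auto
  finally show ?thesis .
qed

lemma gam_sq_integrable: "integrable lborel (\<lambda>z. (gam z)\<^sup>2)"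
proof (rule integrableI_bounded)
  let ?h = "\<lambda>(z :: real \<times> real) t. ennreal (cosh t * exp (- (2 * cosh t) * norm z)) * indicator {0..} t"
  have "(\<integral>\<^sup>+z. ennreal (norm ((gam z)\<^sup>2)) \<partial>lborel) = (\<integral>\<^sup>+z. (ennreal (1 / (2 * pi)))\<^sup>2 * (k0 (norm (z :: real \<times> real)))\<^sup>2 \<partial>lborel)"
  proof (intro nn_integral_cong_AE, use AE_lborel_singleton[of 0] in eventually_elim)
    fix z :: "real \<times> real" assume "z \<noteq> 0"
    have "ennreal (norm ((gam z)\<^sup>2)) = (ennreal (gam z))\<^sup>2" by (simp add: ennreal_power gam_nonneg)
    also have "\<dots> = (ennreal (1 / (2 * pi)))\<^sup>2 * (k0 (norm z))\<^sup>2"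
      unfolding gam_eq[OF \<open>z \<noteq> 0\<close>] by (rule power_mult_distrib)
    finally show "ennreal (norm ((gam z)\<^sup>2)) = (ennreal (1 / (2 * pi)))\<^sup>2 * (k0 (norm z))\<^sup>2" .
  qed
  also have "\<dots> = (ennreal (1 / (2 * pi)))\<^sup>2 * (\<integral>\<^sup>+z. (k0 (norm (z :: real \<times> real)))\<^sup>2 \<partial>lborel)"
    by (rule nn_integral_cmult) measurable
  also have "(\<integral>\<^sup>+z. (k0 (norm (z :: real \<times> real)))\<^sup>2 \<partial>lborel)
    \<le> (\<integral>\<^sup>+z. 2 * (\<integral>\<^sup>+t. ?h z t \<partial>lborel) \<partial>lborel)"
    by (intro nn_integral_mono k0_sq_le)
  also have "\<dots> = 2 * (\<integral>\<^sup>+z. (\<integral>\<^sup>+t. ?h z t \<partial>lborel) \<partial>lborel)"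
    by (rule nn_integral_cmult) measurable
  also have "(\<integral>\<^sup>+z. (\<integral>\<^sup>+t. ?h z t \<partial>lborel) \<partial>lborel)
    = (\<integral>\<^sup>+t. (\<integral>\<^sup>+z. ?h z t \<partial>lborel) \<partial>lborel)"
    by (rule lborel_pair.Fubini'[symmetric]) measurable
  also have "\<dots> = (\<integral>\<^sup>+t. ennreal (pi / 2) * (ennreal (1 / cosh t) * indicator {0..} t) \<partial>lborel)"
  proof (rule nn_integral_cong)
    fix t :: real
    have "(\<integral>\<^sup>+z. ?h z t \<partial>lborel)
       = (\<integral>\<^sup>+z. (ennreal (cosh t) * indicator {0..} t) * ennreal (exp (- (2 * cosh t) * norm (z :: real \<times> real))) \<partial>lborel)"
      by (intro nn_integral_cong) (auto simp: ennreal_mult indicator_def)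
    also have "\<dots> = (ennreal (cosh t) * indicator {0..} t) * (\<integral>\<^sup>+z. ennreal (exp (- (2 * cosh t) * norm (z :: real \<times> real))) \<partial>lborel)"
      by (rule nn_integral_cmult) measurable
    also have "\<dots> = (ennreal (cosh t) * indicator {0..} t) * ennreal (2 * pi / (2 * cosh t)\<^sup>2)"
      by (subst nn_integral_exp_norm) auto
    also have "\<dots> = ennreal (pi / 2) * (ennreal (1 / cosh t) * indicator {0..} t)"
      by (auto simp: indicator_def power2_eq_square simp flip: ennreal_mult)
    finally show "(\<integral>\<^sup>+z. ?h z t \<partial>lborel) = \<dots>" .
  qed
  also have "\<dots> = ennreal (pi / 2) * (\<integral>\<^sup>+t. ennreal (1 / cosh t) * indicator {0..} t \<partial>lborel)"
    by (rule nn_integral_cmult) measurable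
  finally have "(\<integral>\<^sup>+z. ennreal (norm ((gam z)\<^sup>2)) \<partial>lborel) \<le> (ennreal (1 / (2 * pi)))\<^sup>2 * (2 * (ennreal (pi / 2) * 2))"
    using nn_integral_inverse_cosh_le by (smt (verit) mult_left_mono order_trans zero_le)
  also have "\<dots> < \<infinity>" by (simp add: ennreal_power ennreal_mult_less_top)
  finally show "(\<integral>\<^sup>+z. ennreal (norm ((gam z)\<^sup>2)) \<partial>lborel) < \<infinity>" .
qed measurable

lemma nn_integral_exp_abs:
  assumes "c > 0"
  shows "(\<integral>\<^sup>+s. ennreal (exp (- c * \<bar>s\<bar>)) \<partial>lborel) \<le> ennreal (2 / c)"
proof -
  let ?f = "\<lambda>s. ennreal (exp (- c * s)) * indicator {0..} s"
  have "(\<integral>\<^sup>+s. ennreal (exp (- c * \<bar>s\<bar>)) \<partial>lborel) \<le> (\<integral>\<^sup>+s. ?f s + ?f (- s) \<partial>lborel)"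
    by (intro nn_integral_mono) (auto simp: indicator_def)
  also have "\<dots> = (\<integral>\<^sup>+s. ?f s \<partial>lborel) + (\<integral>\<^sup>+s. ?f (- s) \<partial>lborel)"
    by (rule nn_integral_add) measurable
  also have "(\<integral>\<^sup>+s. ?f (- s) \<partial>lborel) = (\<integral>\<^sup>+s. ?f s \<partial>distr lborel borel uminus)"
    by (subst nn_integral_distr) auto
  also have "\<dots> = (\<integral>\<^sup>+s. ?f s \<partial>lborel)" by (simp only: lborel_distr_uminus)
  also have "(\<integral>\<^sup>+s. ?f s \<partial>lborel) = ennreal (1 / c)"
    using nn_integral_exp_half_line[OF assms, of 0] by simp
  finally show ?thesis using assms by (simp flip: ennreal_plus)
qed

text \<open>The kernel decreases with the norm, so on a horizontal line it is at most its trace on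
  the axis, where the integral of exp(-|s| cosh t) in s is at most 2/cosh t. The resulting constant
  2/\<pi> is below 1.\<close>

lemma gam_line_integral: "(\<integral>\<^sup>+s. ennreal (gam (s, t)) \<partial>lborel) \<le> 1"
proof -
  have "(\<integral>\<^sup>+s. ennreal (gam (s, t)) \<partial>lborel) \<le> (\<integral>\<^sup>+s. ennreal (1 / (2 * pi)) * k0 \<bar>s\<bar> \<partial>lborel)"
  proof (intro nn_integral_mono_AE, use AE_lborel_singleton[of 0] in eventually_elim)
    fix s :: real assume "s \<noteq> 0"
    then have "gam (s, t) \<le> gam (s, 0)"
      by (intro gam_antimono) (auto simp: norm_Pair real_le_rsqrt)
    then have "ennreal (gam (s, t)) \<le> ennreal (gam (s, 0))" by (rule ennreal_leI)
    also have "\<dots> = ennreal (1 / (2 * pi)) * k0 \<bar>s\<bar>"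
      using \<open>s \<noteq> 0\<close> by (subst gam_eq) (auto simp: norm_Pair zero_prod_def)
    finally show "ennreal (gam (s, t)) \<le> ennreal (1 / (2 * pi)) * k0 \<bar>s\<bar>" .
  qed
  also have "\<dots> = ennreal (1 / (2 * pi)) * (\<integral>\<^sup>+s. k0 \<bar>s\<bar> \<partial>lborel)"
    by (rule nn_integral_cmult) measurable
  also have "(\<integral>\<^sup>+s. k0 \<bar>s\<bar> \<partial>lborel) = (\<integral>\<^sup>+t. (\<integral>\<^sup>+s. ennreal (exp (- \<bar>s\<bar> * cosh t)) * indicator {0..} t \<partial>lborel) \<partial>lborel)"
    unfolding k0_def by (rule lborel_pair.Fubini'[symmetric]) measurable
  also have "\<dots> \<le> (\<integral>\<^sup>+t. 2 * (ennreal (1 / cosh t) * indicator {0..} t) \<partial>lborel)"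
  proof (rule nn_integral_mono)
    fix t :: real
    have "(\<integral>\<^sup>+s. ennreal (exp (- \<bar>s\<bar> * cosh t)) * indicator {0..} t \<partial>lborel)
      = (\<integral>\<^sup>+s. ennreal (exp (- cosh t * \<bar>s\<bar>)) \<partial>lborel) * indicator {0..} t"
      by (subst nn_integral_multc[symmetric]) (auto simp: mult.commute)
    also have "\<dots> \<le> ennreal (2 / cosh t) * indicator {0..} t"
      by (intro mult_right_mono nn_integral_exp_abs) auto
    also have "ennreal (2 / cosh t) = 2 * ennreal (1 / cosh t)"
      using ennreal_mult[of 2 "1 / cosh t"] by simp
    finally show "(\<integral>\<^sup>+s. ennreal (exp (- \<bar>s\<bar> * cosh t)) * indicator {0..} t \<partial>lborel) \<le> 2 * (ennreal (1 / cosh t) * indicator {0..} t)"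
      by (simp add: mult.assoc)
  qed
  also have "\<dots> = 2 * (\<integral>\<^sup>+t. ennreal (1 / cosh t) * indicator {0..} t \<partial>lborel)"
    by (rule nn_integral_cmult) measurable
  also have "\<dots> \<le> 2 * 2" by (intro mult_left_mono nn_integral_inverse_cosh_le) auto
  finally have "(\<integral>\<^sup>+s. ennreal (gam (s, t)) \<partial>lborel) \<le> ennreal (1 / (2 * pi)) * 4"
    by (simp add: mult_left_mono)
  also have "\<dots> = ennreal (2 / pi)" using ennreal_mult[of "1 / (2 * pi)" 4] by simp
  also have "\<dots> \<le> ennreal 1" using pi_gt3 by (intro ennreal_leI) (simp add: field_simps)
  finally show ?thesis by simp
qed

lemma gam_slab_integral:
  assumes "a \<le> b"
  shows "(LBINT z. indicator {a<..b} (snd z) * gam z) \<le> b - a"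
proof -
  have "(\<integral>\<^sup>+z. ennreal (indicator {a<..b} (snd z) * gam z) \<partial>lborel)
     = (\<integral>\<^sup>+z. (indicator {a<..b} (snd z) * ennreal (gam z)) \<partial>(lborel \<Otimes>\<^sub>M lborel))"
    unfolding lborel_prod by (intro nn_integral_cong) (auto simp: indicator_def)
  also have "\<dots> = (\<integral>\<^sup>+t. (\<integral>\<^sup>+s. indicator {a<..b} t * ennreal (gam (s, t)) \<partial>lborel) \<partial>lborel)"
  proof -
    have "(\<lambda>z. indicator {a<..b} (snd z) * ennreal (gam z)) \<in> borel_measurable (lborel \<Otimes>\<^sub>M lborel)"
      unfolding lborel_prod by measurable
    from lborel_pair.nn_integral_snd[OF this] show ?thesis by simp
  qed
  also have "\<dots> = (\<integral>\<^sup>+t. indicator {a<..b} t * (\<integral>\<^sup>+s. ennreal (gam (s, t)) \<partial>lborel) \<partial>lborel)"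
    by (intro nn_integral_cong nn_integral_cmult) measurable
  also have "\<dots> \<le> (\<integral>\<^sup>+t. indicator {a<..b} t * 1 \<partial>lborel)"
    by (intro nn_integral_mono mult_left_mono gam_line_integral) auto
  also have "\<dots> = ennreal (b - a)" using assms by simp
  finally have le: "(\<integral>\<^sup>+z. ennreal (indicator {a<..b} (snd z) * gam z) \<partial>lborel) \<le> ennreal (b - a)" .
  have "(LBINT z. indicator {a<..b} (snd z) * gam z) = enn2real (\<integral>\<^sup>+z. ennreal (indicator {a<..b} (snd z) * gam z) \<partial>lborel)"
    by (intro integral_eq_nn_integral) (auto simp: gam_nonneg)
  also have "\<dots> \<le> b - a" using enn2real_mono[OF le] assms by simp
  finally show ?thesis .
qed

section \<open>Weak compactness in $L^2$\<close>

definition square_integrable :: "'a measure \<Rightarrow> ('a \<Rightarrow> real) \<Rightarrow> bool" where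
  "square_integrable M f \<longleftrightarrow> f \<in> borel_measurable M \<and> integrable M (\<lambda>x. (f x)\<^sup>2)"

abbreviation lborel2 :: "('a::euclidean_space \<times> 'b::euclidean_space) measure" where
  "lborel2 \<equiv> lborel \<Otimes>\<^sub>M lborel"

abbreviation L2 :: "('a::euclidean_space \<Rightarrow> real) \<Rightarrow> bool" where
  "L2 \<equiv> square_integrable lborel"

lemma integrable_dominated:
  fixes f g :: "'a \<Rightarrow> real"
  assumes "integrable M g" "f \<in> borel_measurable M" "\<And>x. \<bar>f x\<bar> \<le> \<bar>g x\<bar>"
  shows "integrable M f"
  using assms(3) by (intro Bochner_Integration.integrable_bound[OF assms(1,2)] AE_I2) simp

lemma square_integrableD: "square_integrable M f \<Longrightarrow> f \<in> borel_measurable M"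
  by (simp add: square_integrable_def)

lemma square_integrable_sq: "square_integrable M f \<Longrightarrow> integrable M (\<lambda>x. (f x)\<^sup>2)"
  by (simp add: square_integrable_def)

lemma square_integrable_mono:
  assumes "square_integrable M f" "g \<in> borel_measurable M" "\<And>x. x \<in> space M \<Longrightarrow> \<bar>g x\<bar> \<le> \<bar>f x\<bar>"
  shows "square_integrable M g"
  unfolding square_integrable_def
proof
  show "integrable M (\<lambda>x. (g x)\<^sup>2)"
  proof (rule Bochner_Integration.integrable_bound)
    show "integrable M (\<lambda>x. (f x)\<^sup>2)" by (rule square_integrable_sq[OF assms(1)])
    show "AE x in M. norm ((g x)\<^sup>2) \<le> norm ((f x)\<^sup>2)"
      using assms(3) by (intro AE_I2) (simp add: abs_le_square_iff)
  qed (use assms(2) in measurable)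
qed (rule assms)

lemma square_integrable_mult:
  assumes "square_integrable M f" "square_integrable M g"
  shows "integrable M (\<lambda>x. f x * g x)"
proof (rule Bochner_Integration.integrable_bound)
  note [measurable] = square_integrableD[OF assms(1)] square_integrableD[OF assms(2)]
  show "integrable M (\<lambda>x. (f x)\<^sup>2 + (g x)\<^sup>2)"
    using assms by (simp add: square_integrable_def)
  show "(\<lambda>x. f x * g x) \<in> borel_measurable M" by measurable
  have "\<bar>f x * g x\<bar> \<le> (f x)\<^sup>2 + (g x)\<^sup>2" for x
  proof -
    have "0 \<le> \<bar>f x\<bar> * \<bar>g x\<bar>" by simp
    moreover have "2 * (\<bar>f x\<bar> * \<bar>g x\<bar>) \<le> (f x)\<^sup>2 + (g x)\<^sup>2"
      using sum_squares_bound[of "\<bar>f x\<bar>" "\<bar>g x\<bar>"] by (simp add: mult.assoc)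
    ultimately show ?thesis unfolding abs_mult by linarith
  qed
  then show "AE x in M. norm (f x * g x) \<le> norm ((f x)\<^sup>2 + (g x)\<^sup>2)"
    by auto
qed

lemma square_integrable_add:
  assumes "square_integrable M f" "square_integrable M g"
  shows "square_integrable M (\<lambda>x. f x + g x)"
  using assms square_integrable_mult[OF assms]
  by (auto simp: square_integrable_def power2_sum mult.assoc)

lemma square_integrable_cmult:
  assumes "square_integrable M f"
  shows "square_integrable M (\<lambda>x. c * f x)"
  using assms by (auto simp: square_integrable_def power_mult_distrib)

lemma square_integrable_diff:
  assumes "square_integrable M f" "square_integrable M g"
  shows "square_integrable M (\<lambda>x. f x - g x)"
  using square_integrable_add[OF assms(1) square_integrable_cmult[OF assms(2), of "-1"]] by simp

lemma square_integrable_restrict: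
  assumes "square_integrable M f" "A \<in> sets M"
  shows "square_integrable M (\<lambda>x. indicator A x * f x)"
  using assms(2) square_integrableD[OF assms(1)]
  by (intro square_integrable_mono[OF assms(1)]) (auto simp: indicator_def)

lemma square_integrable_indicator:
  assumes "A \<in> sets M" "emeasure M A < \<infinity>"
  shows "square_integrable M (indicator A)"
proof -
  have "(\<lambda>x. (indicator A x :: real)\<^sup>2) = indicator A" by (auto simp: indicator_def)
  then show ?thesis using assms by (simp add: square_integrable_def integrable_indicator_iff)
qed

lemma integral_sq_diff:
  assumes "square_integrable M f" "square_integrable M g"
  shows "(\<integral>x. (f x - g x)\<^sup>2 \<partial>M) = (\<integral>x. (f x)\<^sup>2 \<partial>M) - 2 * (\<integral>x. f x * g x \<partial>M) + (\<integral>x. (g x)\<^sup>2 \<partial>M)"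
  using square_integrable_mult[OF assms] square_integrable_sq[OF assms(1)] square_integrable_sq[OF assms(2)]
  by (simp add: power2_diff mult.assoc)

lemma Cauchy_Schwarz_integral:
  assumes "square_integrable M f" "square_integrable M g"
  shows "\<bar>\<integral>x. f x * g x \<partial>M\<bar> \<le> sqrt (\<integral>x. (f x)\<^sup>2 \<partial>M) * sqrt (\<integral>x. (g x)\<^sup>2 \<partial>M)"
proof -
  note [measurable] = square_integrableD[OF assms(1)] square_integrableD[OF assms(2)]
  define F where "F = (\<integral>x. (f x)\<^sup>2 \<partial>M)"
  define G where "G = (\<integral>x. (g x)\<^sup>2 \<partial>M)"
  define P where "P = (\<integral>x. \<bar>f x * g x\<bar> \<partial>M)"
  have nn: "F \<ge> 0" "G \<ge> 0" "P \<ge> 0" by (simp_all add: F_def G_def P_def)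
  have "(\<integral>\<^sup>+x. ennreal \<bar>f x\<bar> * ennreal \<bar>g x\<bar> \<partial>M)\<^sup>2
      \<le> (\<integral>\<^sup>+x. (ennreal \<bar>f x\<bar>)\<^sup>2 \<partial>M) * (\<integral>\<^sup>+x. (ennreal \<bar>g x\<bar>)\<^sup>2 \<partial>M)"
    by (rule Cauchy_Schwarz_nn_integral) auto
  moreover have "(\<integral>\<^sup>+x. ennreal \<bar>f x\<bar> * ennreal \<bar>g x\<bar> \<partial>M) = ennreal P"
    using integrable_abs[OF square_integrable_mult[OF assms]] unfolding P_def
    by (subst nn_integral_eq_integral[symmetric]) (auto simp: abs_mult ennreal_mult)
  moreover have "(\<integral>\<^sup>+x. (ennreal \<bar>f x\<bar>)\<^sup>2 \<partial>M) = ennreal F"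
    using square_integrable_sq[OF assms(1)] unfolding F_def
    by (subst nn_integral_eq_integral[symmetric]) (auto simp: ennreal_power)
  moreover have "(\<integral>\<^sup>+x. (ennreal \<bar>g x\<bar>)\<^sup>2 \<partial>M) = ennreal G"
    using square_integrable_sq[OF assms(2)] unfolding G_def
    by (subst nn_integral_eq_integral[symmetric]) (auto simp: ennreal_power)
  ultimately have "P\<^sup>2 \<le> F * G"
    using nn by (simp add: ennreal_power flip: ennreal_mult)
  then have "P \<le> sqrt F * sqrt G"
    using nn by (metis real_le_rsqrt real_sqrt_mult)
  moreover have "\<bar>\<integral>x. f x * g x \<partial>M\<bar> \<le> P"
    unfolding P_def by (rule integral_abs_bound)
  ultimately show ?thesis by (simp add: F_def G_def)
qed

section \<open>Weak convergence and weak sequential compactness\<close>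

definition weakly_converges :: "'a measure \<Rightarrow> (nat \<Rightarrow> 'a \<Rightarrow> real) \<Rightarrow> ('a \<Rightarrow> real) \<Rightarrow> bool" where
  "weakly_converges M f F \<longleftrightarrow>
    (\<forall>g. square_integrable M g \<longrightarrow> (\<lambda>n. \<integral>x. f n x * g x \<partial>M) \<longlonglongrightarrow> (\<integral>x. F x * g x \<partial>M))"

lemma diagonal_convergent_subsequence:
  fixes a :: "nat \<Rightarrow> nat \<Rightarrow> real"
  assumes "\<And>i. bounded (range (a i))"
  obtains r where "strict_mono r" "\<And>i. convergent (\<lambda>n. a i (r n))"
proof -
  interpret subseqs "\<lambda>i s. convergent (\<lambda>n. a i (s n))"
  proof
    fix i and s :: "nat \<Rightarrow> nat" assume "strict_mono s"
    have "bounded (range (\<lambda>n. a i (s n)))"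
      by (rule bounded_subset[OF assms[of i]]) auto
    then obtain l r where "strict_mono r" "((\<lambda>n. a i (s n)) \<circ> r) \<longlonglongrightarrow> l"
      using bounded_imp_convergent_subsequence by blast
    then show "\<exists>r'. strict_mono r' \<and> convergent (\<lambda>n. a i ((s \<circ> r') n))"
      by (auto simp: convergent_def o_def)
  qed
  have "convergent (\<lambda>n. a i (diagseq n))" for i
  proof -
    \<comment> \<open>The diagonal sequence refines the i-th subsequence only from index
      \<open>Suc i\<close> on; discarding finitely many terms does not affect convergence.\<close>
    have "convergent (\<lambda>n. a i ((diagseq \<circ> (+) (Suc i)) n))"
    proof (rule diagseq_holds)
      fix r s :: "nat \<Rightarrow> nat" and n
      assume "strict_mono r" "convergent (\<lambda>k. a n (s k))"
      then show "convergent (\<lambda>k. a n ((s \<circ> r) k))"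
        using convergent_subseq_convergent[of "\<lambda>k. a n (s k)" r] by (simp add: o_def)
    qed
    then obtain l where "(\<lambda>n. a i (diagseq (Suc i + n))) \<longlonglongrightarrow> l"
      by (auto simp: convergent_def)
    then have "(\<lambda>n. a i (diagseq (n + Suc i))) \<longlonglongrightarrow> l" by (simp add: add.commute)
    then have "(\<lambda>n. a i (diagseq n)) \<longlonglongrightarrow> l" by (rule LIMSEQ_offset)
    then show ?thesis by (rule convergentI)
  qed
  with subseq_diagseq show ?thesis by (rule that)
qed

text \<open>Convergence is to be tested on countably many sets and then extended to all Borel sets
  by Dynkin's argument, so the generator must be countable and closed under intersections: it
  consists of finite intersections from a countable basis. The empty intersection supplies
  \<open>UNIV\<close>, from which complements are formed.\<close>

lemma countable_Int_stable_generator: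
  obtains B :: "'a::second_countable_topology set set"
  where "countable B" "Int_stable B" "sets borel = sigma_sets UNIV B" "UNIV \<in> B"
proof -
  obtain C :: "'a set set" where C: "countable C" "topological_basis C"
    using ex_countable_basis by auto
  define B where "B = (\<lambda>F. \<Inter>F) ` {F. F \<subseteq> C \<and> finite F}"
  have cB: "countable B"
    unfolding B_def using countable_Collect_finite_subset[OF C(1)] by (simp add: conj_commute)
  have "Int_stable B"
    unfolding Int_stable_def B_def
  proof clarify
    fix F G assume "F \<subseteq> C" "finite F" "G \<subseteq> C" "finite G"
    then show "\<Inter>F \<inter> \<Inter>G \<in> Inter ` {F. F \<subseteq> C \<and> finite F}"
      by (intro image_eqI[where x = "F \<union> G"]) auto
  qed
  moreover have op: "open b" if "b \<in> B" for b
    using that topological_basis_open[OF C(2)] unfolding B_def by (auto intro!: open_Inter)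
  moreover have "topological_basis B"
    unfolding topological_basis_def
  proof (intro allI impI conjI ballI)
    fix O' :: "'a set" assume "open O'"
    then obtain B' where "B' \<subseteq> C" "\<Union>B' = O'" using C(2) unfolding topological_basis_def by meson
    moreover have "C \<subseteq> B"
    proof
      fix c assume "c \<in> C"
      then show "c \<in> B" unfolding B_def by (intro image_eqI[where x = "{c}"]) auto
    qed
    ultimately show "\<exists>B'\<subseteq>B. \<Union>B' = O'" by blast
  qed (simp_all add: op)
  then have "sets borel = sigma_sets UNIV B"
    using borel_eq_countable_basis[OF cB] by (metis sets_measure_of subset_UNIV top_greatest Pow_UNIV)
  moreover have "UNIV \<in> B" unfolding B_def by (intro image_eqI[where x = "{}"]) auto
  ultimately show ?thesis using cB that by blast
qed

text \<open>Approximation uniform in n makes the sequence Cauchy and exchanges the two limits. It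
  serves twice: for countable disjoint unions of sets and for monotone limits of test
  functions.\<close>

lemma uniform_approx_limit:
  fixes s :: "nat \<Rightarrow> real"
  assumes a: "\<And>k. a k \<longlonglongrightarrow> L k" and close: "\<And>k n. \<bar>s n - a k n\<bar> \<le> t k" and t: "t \<longlonglongrightarrow> 0"
  obtains S where "s \<longlonglongrightarrow> S" "L \<longlonglongrightarrow> S"
proof -
  have "Cauchy s"
  proof (rule metric_CauchyI)
    fix e :: real assume "e > 0"
    then obtain k where k: "\<bar>t k\<bar> < e / 3"
      using LIMSEQ_D[OF t, of "e / 3"] by auto
    obtain M where M: "\<And>m n. m \<ge> M \<Longrightarrow> n \<ge> M \<Longrightarrow> dist (a k m) (a k n) < e / 3"
      using LIMSEQ_imp_Cauchy[OF a[of k]] \<open>e > 0\<close> unfolding Cauchy_def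
      by (metis divide_pos_pos zero_less_numeral)
    show "\<exists>M. \<forall>m\<ge>M. \<forall>n\<ge>M. dist (s m) (s n) < e"
    proof (intro exI allI impI)
      fix m n assume "m \<ge> M" "n \<ge> M"
      then have "\<bar>a k m - a k n\<bar> < e / 3" using M by (simp add: dist_real_def)
      then show "dist (s m) (s n) < e"
        using close[of m k] close[of n k] k unfolding dist_real_def by linarith
    qed
  qed
  then obtain S where S: "s \<longlonglongrightarrow> S" by (auto simp: Cauchy_convergent_iff convergent_def)
  have le: "\<bar>S - L k\<bar> \<le> t k" for k
    using close by (intro LIMSEQ_le_const2[OF tendsto_rabs[OF tendsto_diff[OF S a]]]) auto
  have "(\<lambda>k. S - L k) \<longlonglongrightarrow> 0"
    by (rule Lim_null_comparison[OF _ t]) (use le in auto)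
  then have "L \<longlonglongrightarrow> S"
    using tendsto_diff[OF tendsto_const[of S] \<open>(\<lambda>k. S - L k) \<longlonglongrightarrow> 0\<close>] by simp
  with S show ?thesis by (rule that)
qed

lemma integrable_monotone_bounded:
  fixes f :: "nat \<Rightarrow> 'a \<Rightarrow> real"
  assumes "\<And>i. integrable M (f i)" "\<And>x. incseq (\<lambda>i. f i x)" "\<And>x. (\<lambda>i. f i x) \<longlonglongrightarrow> u x"
    and le: "\<And>i. (\<integral>x. f i x \<partial>M) \<le> K"
  shows "integrable M u" "(\<lambda>i. \<integral>x. f i x \<partial>M) \<longlonglongrightarrow> (\<integral>x. u x \<partial>M)" "(\<integral>x. u x \<partial>M) \<le> K"
proof -
  have "incseq (\<lambda>i. \<integral>x. f i x \<partial>M)"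
    using assms(1) incseq_SucD[OF assms(2)] by (intro incseq_SucI integral_mono) auto
  then obtain y where y: "(\<lambda>i. \<integral>x. f i x \<partial>M) \<longlonglongrightarrow> y"
    by (rule incseq_convergent) (use le in auto)
  have u: "u \<in> borel_measurable M"
    using assms(1) by (intro borel_measurable_LIMSEQ_real[OF assms(3)]) auto
  show "integrable M u"
    by (rule integrable_monotone_convergence[OF assms(1) AE_I2[OF assms(2)] AE_I2[OF assms(3)] y u])
  have "(\<integral>x. u x \<partial>M) = y"
    by (rule integral_monotone_convergence[OF assms(1) AE_I2[OF assms(2)] AE_I2[OF assms(3)] y u])
  then show "(\<lambda>i. \<integral>x. f i x \<partial>M) \<longlonglongrightarrow> (\<integral>x. u x \<partial>M)" "(\<integral>x. u x \<partial>M) \<le> K"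
    using y LIMSEQ_le_const2[OF y] le by auto
qed

lemma integral_tendsto_zero:
  fixes g :: "nat \<Rightarrow> 'a \<Rightarrow> real"
  assumes "\<And>k. g k \<in> borel_measurable M" "integrable M w" "\<And>k x. \<bar>g k x\<bar> \<le> w x"
    "\<And>x. (\<lambda>k. g k x) \<longlonglongrightarrow> 0"
  shows "(\<lambda>k. \<integral>x. g k x \<partial>M) \<longlonglongrightarrow> 0"
proof -
  have "(\<lambda>k. \<integral>x. g k x \<partial>M) \<longlonglongrightarrow> (\<integral>x. 0 \<partial>M)"
    using assms by (intro integral_dominated_convergence[where w = w]) auto
  then show ?thesis by simp
qed

text \<open>The weak limit is built as a Radon-Nikodym density. For a fixed positive weight h in L^2
  the measures f_n h dx have total mass at most C times the norm of h. A diagonal subsequence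
  converges on a countable generator, hence on all Borel sets, to a measure with a density D, and
  D/h is the limit. Nonnegativity of the f_n makes these set functions measures.\<close>

theorem weakly_compact_nonneg:
  fixes f :: "nat \<Rightarrow> 'a::euclidean_space \<Rightarrow> real"
  assumes f: "\<And>n. L2 (f n)" and nn: "\<And>n x. 0 \<le> f n x"
    and C: "0 \<le> C" "\<And>n. (LBINT x. (f n x)\<^sup>2) \<le> C\<^sup>2"
  obtains F r where "strict_mono r" "L2 F" "\<And>x. 0 \<le> F x"
    "weakly_converges lborel (\<lambda>n. f (r n)) F"
proof -
  note [measurable] = square_integrableD[OF f]
  obtain h0 :: "'a \<Rightarrow> real" where h0: "h0 \<in> borel_measurable lborel" "\<And>x. h0 x > 0" "integrable lborel h0"
    using sigma_finite_measure.obtain_positive_integrable_function[OF sigma_finite_lborel] by metis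
  define h where "h x = sqrt (h0 x)" for x
  have hm [measurable]: "h \<in> borel_measurable lborel" unfolding h_def using h0(1) by measurable
  have hp: "h x > 0" for x using h0(2) by (simp add: h_def)
  have h: "L2 h"
    using h0(2,3) by (simp add: square_integrable_def hm h_def less_imp_le)
  have bd: "\<bar>LBINT x. f n x * g x\<bar> \<le> C * sqrt (LBINT x. (g x)\<^sup>2)"
    if "L2 g" for n g
  proof -
    have "sqrt (LBINT x. (f n x)\<^sup>2) \<le> C" using C by (intro real_le_lsqrt) auto
    then have "sqrt (LBINT x. (f n x)\<^sup>2) * sqrt (LBINT x. (g x)\<^sup>2) \<le> C * sqrt (LBINT x. (g x)\<^sup>2)"
      by (intro mult_right_mono) auto
    with Cauchy_Schwarz_integral[OF f[of n] that] show ?thesis by linarith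
  qed
  define N where "N n A = (LBINT x. f n x * (indicator A x * h x))" for n A
  \<comment> \<open>A finite measure that controls all \<open>N n\<close> at once through
    Cauchy-Schwarz. This uniform absolute continuity lets the limit in n pass through countable
    unions.\<close>
  define \<rho> where "\<rho> A = (LBINT x. (indicator A x * h x)\<^sup>2)" for A
  have hA: "L2 (\<lambda>x. indicator A x * h x)" if "A \<in> sets borel" for A
    using square_integrable_restrict[OF h] that by simp
  have Nb: "\<bar>N n A\<bar> \<le> C * sqrt (\<rho> A)" if "A \<in> sets borel" for n A
    unfolding N_def \<rho>_def by (rule bd[OF hA[OF that]])
  have N0: "0 \<le> N n A" for n A
    unfolding N_def using nn hp by (intro integral_nonneg_AE AE_I2) (simp add: less_imp_le indicator_def)
  have NUn: "N n (A \<union> A') = N n A + N n A'" if "A \<in> sets borel" "A' \<in> sets borel" "A \<inter> A' = {}" for n A A'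
  proof -
    have "f n x * (indicator (A \<union> A') x * h x) = f n x * (indicator A x * h x) + f n x * (indicator A' x * h x)" for x
      using that(3) by (auto simp: indicator_def)
    then show ?thesis unfolding N_def
      using square_integrable_mult[OF f hA[OF that(1)], of n] square_integrable_mult[OF f hA[OF that(2)], of n]
      by simp
  qed
  obtain B :: "'a set set" where B: "countable B" "Int_stable B" "sets borel = sigma_sets UNIV B" "UNIV \<in> B"
    by (rule countable_Int_stable_generator)
  have Bs: "b \<in> sets borel" if "b \<in> B" for b using that B(3) by auto
  have "bounded (range (\<lambda>n. N n (from_nat_into B i)))" for i
  proof -
    have "from_nat_into B i \<in> sets borel" using B(4) by (intro Bs from_nat_into) auto
    then show ?thesis using Nb by (intro boundedI) auto
  qed
  then obtain r where r: "strict_mono r" "\<And>i. convergent (\<lambda>n. N (r n) (from_nat_into B i))"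
    using diagonal_convergent_subsequence[of "\<lambda>i n. N n (from_nat_into B i)"] by blast
  \<comment> \<open>The tails U k decrease to the empty set because the A i are disjoint, so the
    remainders \<open>N (r n) (U k)\<close> are small uniformly in n and the limits may be
    exchanged.\<close>
  have tail: "\<exists>S. (\<lambda>n. N (r n) (\<Union>i. A i)) \<longlonglongrightarrow> S \<and> l sums S"
    if A: "\<And>i. A i \<in> sets borel" "disjoint_family A" and l: "\<And>i. (\<lambda>n. N (r n) (A i)) \<longlonglongrightarrow> l i"
    for A :: "nat \<Rightarrow> 'a set" and l
  proof -
    define U where "U k = (\<Union>i\<in>{k..}. A i)" for k
    have U: "U k \<in> sets borel" for k unfolding U_def using A(1) by auto
    have split: "N n (\<Union>i. A i) = (\<Sum>i<k. N n (A i)) + N n (U k)" for n k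
    proof (induction k)
      case 0 then show ?case by (simp add: U_def)
    next
      case (Suc k)
      have "U k = A k \<union> U (Suc k)"
        unfolding U_def atLeast_Suc_greaterThan using le_eq_less_or_eq by (auto simp: le_less)
      moreover have "A k \<inter> A j = {}" if "j \<ge> Suc k" for j
        using disjoint_family_onD[OF A(2), of k j] that by auto
      then have "A k \<inter> U (Suc k) = {}"
        unfolding U_def by blast
      ultimately have "N n (U k) = N n (A k) + N n (U (Suc k))" using NUn A(1) U by metis
      then show ?case using Suc by simp
    qed
    have "(\<lambda>k. \<rho> (U k)) \<longlonglongrightarrow> 0"
      unfolding \<rho>_def
    proof (rule integral_tendsto_zero)
      show "(\<lambda>k. (indicator (U k) x * h x)\<^sup>2) \<longlonglongrightarrow> 0" for x
      proof -
        have "eventually (\<lambda>k. x \<notin> U k) sequentially"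
        proof (cases "\<exists>i. x \<in> A i")
          case True
          then obtain i where i: "x \<in> A i" by blast
          have "x \<notin> U k" if "k > i" for k
          proof
            assume "x \<in> U k"
            then obtain j where "x \<in> A j" "j \<ge> k" by (auto simp: U_def)
            with A(2) i that show False unfolding disjoint_family_on_def by (metis IntI UNIV_I empty_iff not_le)
          qed
          then show ?thesis using eventually_mono[OF eventually_gt_at_top[of i], of "\<lambda>k. x \<notin> U k"] by blast
        qed (auto simp: U_def)
        then have "eventually (\<lambda>k. (indicator (U k) x * h x)\<^sup>2 = 0) sequentially"
          by (rule eventually_mono) simp
        then show ?thesis by (rule tendsto_eventually)
      qed
      show "integrable lborel (\<lambda>x. (h x)\<^sup>2)" by (rule square_integrable_sq[OF h])
      show "\<bar>(indicator (U k) x * h x)\<^sup>2\<bar> \<le> (h x)\<^sup>2" for k x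
        by (auto simp: indicator_def)
      show "(\<lambda>x. (indicator (U k) x * h x)\<^sup>2) \<in> borel_measurable lborel" for k
        by (intro borel_measurable_power square_integrableD[OF hA[OF U]])
    qed
    then have \<rho>0: "(\<lambda>k. C * sqrt (\<rho> (U k))) \<longlonglongrightarrow> 0"
      using tendsto_mult_left[OF tendsto_real_sqrt, of "\<lambda>k. \<rho> (U k)" 0 _ C] by simp
    have lim: "(\<lambda>n. \<Sum>i<k. N (r n) (A i)) \<longlonglongrightarrow> (\<Sum>i<k. l i)" for k
      by (intro tendsto_sum l)
    have close: "\<bar>N (r n) (\<Union>i. A i) - (\<Sum>i<k. N (r n) (A i))\<bar> \<le> C * sqrt (\<rho> (U k))" for k n
      using split[of "r n" k] Nb[OF U[of k], of "r n"] by simp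
    show ?thesis
      using uniform_approx_limit[OF lim close \<rho>0] unfolding sums_def by blast
  qed
  have conv: "convergent (\<lambda>n. N (r n) A)" if "A \<in> sets borel" for A
  proof -
    have gen: "convergent (\<lambda>n. N (r n) b)" if "b \<in> B" for b
      using r(2) from_nat_into_surj[OF B(1) that] by metis
    have "B \<subseteq> Pow UNIV" by simp
    have "A \<in> sigma_sets UNIV B" using that B(3) by simp
    then show ?thesis
    proof (induction rule: sigma_sets_induct_disjoint[OF B(2) \<open>B \<subseteq> Pow UNIV\<close>, consumes 1, case_names basic empty compl union])
      case (basic A) then show ?case by (rule gen)
    next
      case empty then show ?case by (simp add: N_def convergent_const)
    next
      case (compl A)
      then have A: "A \<in> sets borel" using B(3) by blast
      have "N n (UNIV - A) = N n UNIV - N n A" for n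
        using NUn[of A "UNIV - A" n] A by (simp add: Un_absorb1)
      then show ?case using convergent_diff[OF gen[OF B(4)] compl.IH] by simp
    next
      case (union A)
      have "(\<lambda>n. N (r n) (A i)) \<longlonglongrightarrow> lim (\<lambda>n. N (r n) (A i))" for i
        using union.IH[of i] by (simp add: convergent_LIMSEQ_iff)
      with tail[of A "\<lambda>i. lim (\<lambda>n. N (r n) (A i))"] union.hyps B(3)
      show ?case by (auto simp: convergent_def)
    qed
  qed
  define L where "L A = lim (\<lambda>n. N (r n) A)" for A
  have NL: "(\<lambda>n. N (r n) A) \<longlonglongrightarrow> L A" if "A \<in> sets borel" for A
    using conv[OF that] by (simp add: convergent_LIMSEQ_iff L_def)
  have L0: "0 \<le> L A" if "A \<in> sets borel" for A
    by (rule LIMSEQ_le_const[OF NL[OF that]]) (use N0 in auto)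
  define \<mu> where "\<mu> = measure_of UNIV (sets borel) (\<lambda>A. ennreal (L A))"
  have \<mu>s: "sets \<mu> = sets borel"
    unfolding \<mu>_def by (simp add: sigma_algebra.sigma_sets_eq[OF sets.sigma_algebra_axioms, of borel, simplified])
  have ca: "countably_additive (sets \<mu>) (\<lambda>A. ennreal (L A))"
  proof (rule countably_additiveI)
    fix A :: "nat \<Rightarrow> 'a set" assume "range A \<subseteq> sets \<mu>" "disjoint_family A"
    then have A: "\<And>i. A i \<in> sets borel" and d: "disjoint_family A" by (auto simp: \<mu>s)
    obtain S where S: "(\<lambda>n. N (r n) (\<Union>i. A i)) \<longlonglongrightarrow> S" "(\<lambda>i. L (A i)) sums S"
      using tail[OF A d NL[OF A]] by blast
    have "S = L (\<Union>i. A i)" using A by (intro LIMSEQ_unique[OF S(1) NL]) auto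
    with suminf_ennreal_eq[OF L0[OF A] S(2)]
    show "(\<Sum>i. ennreal (L (A i))) = ennreal (L (\<Union>i. A i))" by (simp only:)
  qed
  have emu: "emeasure \<mu> A = ennreal (L A)" if "A \<in> sets borel" for A
  proof (rule emeasure_measure_of[OF \<mu>_def])
    show "positive (sets \<mu>) (\<lambda>A. ennreal (L A))"
      by (simp add: positive_def L_def N_def lim_const)
  qed (use ca that \<mu>s in auto)
  have "absolutely_continuous lborel \<mu>"
    unfolding absolutely_continuous_def
  proof
    fix A assume A: "A \<in> null_sets (lborel :: 'a measure)"
    have "N n A = 0" for n
      unfolding N_def by (rule integral_eq_zero_AE) (use AE_not_in[OF A] in \<open>auto elim: eventually_mono\<close>)
    then have "L A = 0" by (simp add: L_def lim_const)
    then show "A \<in> null_sets \<mu>" using A emu by (auto simp: null_sets_def \<mu>s)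
  qed
  then obtain D where D: "D \<in> borel_measurable lborel" "density lborel D = \<mu>"
    using sigma_finite_measure.Radon_Nikodym[OF sigma_finite_lborel, of \<mu>] \<mu>s by auto
  note [measurable] = D(1)
  have Dint: "(\<integral>\<^sup>+x. D x * indicator A x \<partial>lborel) = ennreal (L A)" if "A \<in> sets borel" for A
    using emeasure_density[OF D(1), of A] that emu[OF that] D(2) by simp
  have fin: "AE x in lborel. D x < \<infinity>"
  proof -
    have "integral\<^sup>N lborel D \<noteq> \<infinity>" using Dint[of UNIV] by simp
    from nn_integral_PInf_AE[OF D(1) this] show ?thesis
      by (rule AE_mp) (simp add: less_top)
  qed
  define F where "F x = enn2real (D x) / h x" for x
  have Fm [measurable]: "F \<in> borel_measurable lborel" unfolding F_def by measurable
  have F0: "0 \<le> F x" for x using hp[of x] by (simp add: F_def)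
  have FA: "integrable lborel (\<lambda>x. F x * (h x * indicator A x)) \<and> (LBINT x. F x * (h x * indicator A x)) = L A"
    if "A \<in> sets borel" for A
  proof -
    have eq: "F x * (h x * indicator A x) = enn2real (D x) * indicator A x" for x
      using hp[of x] by (simp add: F_def)
    have "(\<integral>\<^sup>+x. ennreal (enn2real (D x) * indicator A x) \<partial>lborel) = (\<integral>\<^sup>+x. D x * indicator A x \<partial>lborel)"
      using fin by (intro nn_integral_cong_AE) (auto elim!: eventually_mono simp: indicator_def)
    then have nn: "(\<integral>\<^sup>+x. ennreal (enn2real (D x) * indicator A x) \<partial>lborel) = ennreal (L A)"
      using Dint[OF that] by simp
    have "has_bochner_integral lborel (\<lambda>x. enn2real (D x) * indicator A x) (L A)"
      using that by (intro has_bochner_integral_nn_integral nn L0) auto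
    then show ?thesis unfolding eq by (auto simp: has_bochner_integral_iff)
  qed
  \<comment> \<open>Test functions are written h u, so that for an indicator u the claim is the
    convergence of \<open>N\<close>. Square integrability stays inside the implication because the
    induction has to hand it down to summands and to monotone approximants.\<close>
  have key: "L2 (\<lambda>x. h x * u x) \<longrightarrow>
      integrable lborel (\<lambda>x. F x * (h x * u x)) \<and>
      (\<lambda>n. LBINT x. f (r n) x * (h x * u x)) \<longlonglongrightarrow> (LBINT x. F x * (h x * u x))"
    (is "?S u \<longrightarrow> ?I u \<and> ?T u")
    if "u \<in> borel_measurable lborel" "\<And>x. 0 \<le> u x" for u
    using that
  proof (induction rule: borel_measurable_induct_real)
    case (set A)
    then show ?case using FA[of A] NL[of A] by (simp add: N_def mult.commute mult.left_commute)
  next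
    case (mult u c)
    show ?case
    proof (cases "c = 0")
      case False
      show ?thesis
      proof
        assume "L2 (\<lambda>x. h x * (c * u x))"
        from square_integrable_cmult[OF this, of "1 / c"] False
        have "L2 (\<lambda>x. h x * u x)" by simp
        with mult have int: "?I u"
          and lim: "?T u" by auto
        have eq: "G x * (h x * (c * u x)) = c * (G x * (h x * u x))" for G :: "'a \<Rightarrow> real" and x by simp
        show "?I (\<lambda>x. c * u x) \<and> ?T (\<lambda>x. c * u x)"
          unfolding eq integral_mult_right_zero using tendsto_mult_left[OF lim, of c] int by auto
      qed
    qed simp
  next
    case (add u v)
    show ?case
    proof
      assume sq: "L2 (\<lambda>x. h x * (v x + u x))"
      note [measurable] = add.hyps(1,3)
      have hu: "L2 (\<lambda>x. h x * u x)"
        using hp add.hyps(2,4) by (intro square_integrable_mono[OF sq]) (auto simp: abs_mult less_imp_le intro!: mult_left_mono)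
      have hv: "L2 (\<lambda>x. h x * v x)"
        using hp add.hyps(2,4) by (intro square_integrable_mono[OF sq]) (auto simp: abs_mult less_imp_le intro!: mult_left_mono)
      have eq: "G x * (h x * (v x + u x)) = G x * (h x * v x) + G x * (h x * u x)" for G :: "'a \<Rightarrow> real" and x
        by (simp add: algebra_simps)
      have "(LBINT x. f n x * (h x * v x) + f n x * (h x * u x)) = (LBINT x. f n x * (h x * v x)) + (LBINT x. f n x * (h x * u x))" for n
        by (intro Bochner_Integration.integral_add square_integrable_mult f hu hv)
      then show "?I (\<lambda>x. v x + u x) \<and> ?T (\<lambda>x. v x + u x)"
        unfolding eq using add.IH hu hv by (auto intro!: tendsto_add)
    qed
  next
    case (seq U)
    note [measurable] = seq.hyps(1) that(1)
    note U0 = seq.hyps(2) and Uinc = seq.hyps(3)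
    have Ulim: "(\<lambda>i. U i x) \<longlonglongrightarrow> u x" for x using seq.hyps(4) by simp
    have Ule: "U i x \<le> u x" for i x
      using incseq_le[OF _ Ulim[of x]] Uinc by (auto simp: incseq_def le_fun_def)
    show ?case
    proof
      assume sq: "L2 (\<lambda>x. h x * u x)"
      have hU: "L2 (\<lambda>x. h x * U i x)" for i
        using hp U0 Ule that(2)
        by (intro square_integrable_mono[OF sq]) (auto simp: abs_mult less_imp_le intro!: mult_left_mono)
      have lim: "?T (U k)"
        and int: "?I (U k)" for k
        using seq.IH[of k] hU[of k] by auto
      have close: "\<bar>(LBINT x. f (r n) x * (h x * u x)) - (LBINT x. f (r n) x * (h x * U k x))\<bar>
          \<le> C * sqrt (LBINT x. (h x * u x - h x * U k x)\<^sup>2)" for k n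
      proof -
        have "(LBINT x. f (r n) x * (h x * u x)) - (LBINT x. f (r n) x * (h x * U k x))
          = (LBINT x. f (r n) x * (h x * u x - h x * U k x))"
          using square_integrable_mult[OF f sq, of "r n"] square_integrable_mult[OF f hU, of "r n" k]
          by (simp add: right_diff_distrib)
        then show ?thesis using bd[OF square_integrable_diff[OF sq hU[of k]], of "r n"] by simp
      qed
      have "(\<lambda>k. LBINT x. (h x * u x - h x * U k x)\<^sup>2) \<longlonglongrightarrow> 0"
      proof (rule integral_tendsto_zero)
        show "integrable lborel (\<lambda>x. (h x * u x)\<^sup>2)" by (rule square_integrable_sq[OF sq])
        show "(\<lambda>k. (h x * u x - h x * U k x)\<^sup>2) \<longlonglongrightarrow> 0" for x
        proof -
          have "(\<lambda>k. (h x * u x - h x * U k x)\<^sup>2) \<longlonglongrightarrow> (h x * u x - h x * u x)\<^sup>2"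
            using Ulim[of x] by (intro tendsto_intros) auto
          then show ?thesis by simp
        qed
        show "\<bar>(h x * u x - h x * U k x)\<^sup>2\<bar> \<le> (h x * u x)\<^sup>2" for k x
        proof -
          have "0 \<le> h x * U k x" "h x * U k x \<le> h x * u x" using hp[of x] Ule[of k x] U0[of k x] by auto
          then show ?thesis by (simp add: power_mono)
        qed
        show "(\<lambda>x. (h x * u x - h x * U k x)\<^sup>2) \<in> borel_measurable lborel" for k
          by measurable
      qed
      then have t0: "(\<lambda>k. C * sqrt (LBINT x. (h x * u x - h x * U k x)\<^sup>2)) \<longlonglongrightarrow> 0"
        using tendsto_mult_left[OF tendsto_real_sqrt, of "\<lambda>k. LBINT x. (h x * u x - h x * U k x)\<^sup>2" 0 _ C] by simp
      obtain S where S: "(\<lambda>n. LBINT x. f (r n) x * (h x * u x)) \<longlonglongrightarrow> S"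
          "(\<lambda>k. LBINT x. F x * (h x * U k x)) \<longlonglongrightarrow> S"
        by (rule uniform_approx_limit[OF lim close t0])
      have m: "AE x in lborel. mono (\<lambda>k. F x * (h x * U k x))"
        using Uinc F0 hp by (intro AE_I2 monoI mult_left_mono) (auto simp: incseq_def le_fun_def less_imp_le)
      have p: "AE x in lborel. (\<lambda>k. F x * (h x * U k x)) \<longlonglongrightarrow> F x * (h x * u x)"
        using Ulim by (intro AE_I2 tendsto_mult_left) auto
      have um: "(\<lambda>x. F x * (h x * u x)) \<in> borel_measurable lborel" by measurable
      show "?I u \<and> ?T u"
        using integrable_monotone_convergence[OF int m p S(2) um] integral_monotone_convergence[OF int m p S(2) um] S(1)
        by simp
    qed
  qed
  have pos: "integrable lborel (\<lambda>x. F x * g x) \<and>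
      (\<lambda>n. LBINT x. f (r n) x * g x) \<longlonglongrightarrow> (LBINT x. F x * g x)"
    if "L2 g" "\<And>x. 0 \<le> g x" for g
  proof -
    have "h x * (g x / h x) = g x" for x using hp[of x] by simp
    moreover have "(\<lambda>x. g x / h x) \<in> borel_measurable lborel"
      using square_integrableD[OF that(1)] by measurable
    ultimately show ?thesis
      using key[of "\<lambda>x. g x / h x"] that hp by (simp add: less_imp_le)
  qed
  have "L2 F"
  proof -
    \<comment> \<open>F is not yet known to be square integrable, so it is tested against its
      restriction to the set where F \<le> K h, which is dominated by K h. In the limit the squared
      norm q of this restriction satisfies q \<le> C sqrt q, and then K tends to infinity.\<close>
    define T where "T K = {x. F x \<le> real K * h x}" for K :: nat
    define G where "G K x = indicator (T K) x * F x" for K x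
    have [measurable]: "T K \<in> sets lborel" for K
    proof -
      have "{x \<in> space lborel. F x \<le> real K * h x} \<in> sets lborel" by measurable
      then show ?thesis by (simp add: T_def)
    qed
    have G: "L2 (G K)" for K
    proof (rule square_integrable_mono[OF square_integrable_cmult[OF h, of "real K"]])
      show "G K \<in> borel_measurable lborel" unfolding G_def by measurable
      show "\<bar>G K x\<bar> \<le> \<bar>real K * h x\<bar>" for x
        using F0[of x] hp[of x] by (auto simp: G_def T_def indicator_def abs_mult)
    qed
    have FG: "F x * G K x = (G K x)\<^sup>2" for K x
      by (auto simp: G_def indicator_def power2_eq_square)
    have GC: "(LBINT x. (G K x)\<^sup>2) \<le> C\<^sup>2" for K
    proof -
      define q where "q = (LBINT x. (G K x)\<^sup>2)"
      have q0: "q \<ge> 0" by (simp add: q_def)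
      have "(\<lambda>n. LBINT x. f (r n) x * G K x) \<longlonglongrightarrow> q"
        using pos[OF G[of K]] F0 by (simp add: FG q_def) (simp add: G_def)
      then have "q \<le> C * sqrt q"
        by (rule LIMSEQ_le_const2) (use bd[OF G[of K]] in \<open>auto simp: q_def abs_le_iff\<close>)
      then have "sqrt q * sqrt q \<le> C * sqrt q" using q0 by simp
      then have "sqrt q \<le> C"
        using q0 C(1) mult_right_le_imp_le[of "sqrt q" "sqrt q" C] by (cases "q = 0") auto
      then have "(sqrt q)\<^sup>2 \<le> C\<^sup>2" using q0 by (intro power_mono) auto
      then show ?thesis using q0 by (simp add: q_def)
    qed
    have "integrable lborel (\<lambda>x. (F x)\<^sup>2)"
    proof (rule integrable_monotone_bounded(1)[where f = "\<lambda>K x. (G K x)\<^sup>2", OF square_integrable_sq[OF G] _ _ GC])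
      fix x
      have mT: "indicator (T K) x \<le> (indicator (T K') x :: real)" if "K \<le> K'" for K K'
      proof -
        have "real K * h x \<le> real K' * h x" using that hp[of x] by (intro mult_right_mono) auto
        then show ?thesis by (auto simp: T_def indicator_def)
      qed
      show "incseq (\<lambda>K. (G K x)\<^sup>2)"
        unfolding G_def using mT F0[of x] by (intro monoI power_mono mult_right_mono) auto
      obtain K0 :: nat where K0: "F x / h x \<le> real K0" using real_arch_simple by blast
      have "G K x = F x" if "K \<ge> K0" for K
      proof -
        have "F x / h x \<le> real K" using K0 that by linarith
        then have "F x \<le> real K * h x" using hp[of x] by (simp add: pos_divide_le_eq)
        then show ?thesis by (simp add: G_def T_def)
      qed
      then have "eventually (\<lambda>K. (G K x)\<^sup>2 = (F x)\<^sup>2) sequentially"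
        unfolding eventually_sequentially by (intro exI[of _ K0]) simp
      then show "(\<lambda>K. (G K x)\<^sup>2) \<longlonglongrightarrow> (F x)\<^sup>2" by (rule tendsto_eventually)
    qed
    then show ?thesis by (simp add: square_integrable_def Fm)
  qed
  moreover have "weakly_converges lborel (\<lambda>n. f (r n)) F"
    unfolding weakly_converges_def
  proof (intro allI impI)
    fix g :: "'a \<Rightarrow> real" assume g: "L2 g"
    note [measurable] = square_integrableD[OF g]
    have p: "L2 (\<lambda>x. max 0 (g x))"
      by (rule square_integrable_mono[OF g]) auto
    have m: "L2 (\<lambda>x. max 0 (- g x))"
      by (rule square_integrable_mono[OF g]) auto
    have eq: "G x * g x = G x * max 0 (g x) - G x * max 0 (- g x)" for G :: "'a \<Rightarrow> real" and x
      by (auto simp: max_def)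
    have "(LBINT x. f n x * max 0 (g x) - f n x * max 0 (- g x)) = (LBINT x. f n x * max 0 (g x)) - (LBINT x. f n x * max 0 (- g x))" for n
      by (intro Bochner_Integration.integral_diff square_integrable_mult f p m)
    moreover have "(LBINT x. F x * max 0 (g x) - F x * max 0 (- g x)) = (LBINT x. F x * max 0 (g x)) - (LBINT x. F x * max 0 (- g x))"
      using pos[OF p] pos[OF m] by (intro Bochner_Integration.integral_diff) auto
    ultimately show "(\<lambda>n. LBINT x. f (r n) x * g x) \<longlonglongrightarrow> (LBINT x. F x * g x)"
      unfolding eq using pos[OF p] pos[OF m] by (auto intro!: tendsto_diff)
  qed
  ultimately show ?thesis using that[of r F] r(1) F0 by blast
qed

section \<open>The Green function of the half-plane\<close>

lemma integrable_row_bound: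
  fixes k :: "'a::euclidean_space \<times> 'b::euclidean_space \<Rightarrow> real"
  assumes [measurable]: "k \<in> borel_measurable lborel2" and nn: "\<And>z. 0 \<le> k z"
    and row: "\<And>x. integrable lborel (\<lambda>y. k (x, y))" "\<And>x. (LBINT y. k (x, y)) \<le> a x"
    and a: "integrable lborel a"
  shows "integrable lborel2 k" "(\<integral>z. k z \<partial>lborel2) \<le> (LBINT x. a x)"
proof -
  have r0: "0 \<le> (LBINT y. k (x, y))" for x using nn by (intro integral_nonneg_AE AE_I2)
  have ir: "integrable lborel (\<lambda>x. LBINT y. k (x, y))"
    using r0 row(2) by (intro integrable_dominated[OF a]) (auto intro: order_trans[OF _ abs_ge_self])
  show i: "integrable lborel2 k"
    using ir nn row(1) by (intro lborel_pair.Fubini_integrable) auto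
  have "(\<integral>z. k z \<partial>lborel2) = (LBINT x. LBINT y. k (x, y))"
    using lborel_pair.integral_fst'[OF i] by simp
  also have "\<dots> \<le> (LBINT x. a x)" using ir a row(2) by (intro integral_mono) auto
  finally show "(\<integral>z. k z \<partial>lborel2) \<le> (LBINT x. a x)" .
qed

text \<open>Schur's test: k u v is at most k (u^2 + v^2)/2. The term with u^2 is bounded by row
  integrals, and symmetry of k turns the columns of the other term into rows.\<close>

lemma symmetric_kernel_form:
  fixes k :: "'a::euclidean_space \<Rightarrow> 'a \<Rightarrow> real"
  assumes km [measurable]: "(\<lambda>z. k (fst z) (snd z)) \<in> borel_measurable lborel2"
    and nn: "\<And>x y. 0 \<le> k x y" and sym: "\<And>x y. k x y = k y x"
    and row: "\<And>x. integrable lborel (k x)" "\<And>x. (LBINT y. k x y) \<le> c"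
    and u: "L2 u" and v: "L2 v"
  shows "integrable lborel2 (\<lambda>z. k (fst z) (snd z) * (u (fst z) * v (snd z)))"
    "(\<integral>z. k (fst z) (snd z) * (u (fst z) * v (snd z)) \<partial>lborel2)
      \<le> c * ((LBINT x. (u x)\<^sup>2) + (LBINT x. (v x)\<^sup>2)) / 2"
proof -
  note [measurable] = square_integrableD[OF u] square_integrableD[OF v]
  have A: "integrable lborel2 (\<lambda>z. k (fst z) (snd z) * (w (fst z))\<^sup>2)"
    "(\<integral>z. k (fst z) (snd z) * (w (fst z))\<^sup>2 \<partial>lborel2) \<le> c * (LBINT x. (w x)\<^sup>2)"
    if w: "L2 w" for w
  proof -
    note [measurable] = square_integrableD[OF w]
    have r: "(LBINT y. k x y * (w x)\<^sup>2) \<le> c * (w x)\<^sup>2" for x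
      using row(2)[of x] by (simp add: mult_right_mono)
    show "integrable lborel2 (\<lambda>z. k (fst z) (snd z) * (w (fst z))\<^sup>2)"
      using nn row(1) r square_integrable_sq[OF w]
      by (intro integrable_row_bound(1)[where a = "\<lambda>x. c * (w x)\<^sup>2"]) auto
    have "(\<integral>z. k (fst z) (snd z) * (w (fst z))\<^sup>2 \<partial>lborel2) \<le> (LBINT x. c * (w x)\<^sup>2)"
      using nn row(1) r square_integrable_sq[OF w]
      by (intro integrable_row_bound(2)) auto
    then show "(\<integral>z. k (fst z) (snd z) * (w (fst z))\<^sup>2 \<partial>lborel2) \<le> c * (LBINT x. (w x)\<^sup>2)"
      by simp
  qed
  have B: "integrable lborel2 (\<lambda>z. k (fst z) (snd z) * (v (snd z))\<^sup>2)"
    using lborel_pair.integrable_product_swap[OF A(1)[OF v]] sym by (simp add: case_prod_unfold)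
  have "(\<integral>z. k (fst z) (snd z) * (v (snd z))\<^sup>2 \<partial>lborel2)
      = (\<integral>z. k (fst z) (snd z) * (v (fst z))\<^sup>2 \<partial>lborel2)"
    using lborel_pair.integral_product_swap[of "\<lambda>z. k (fst z) (snd z) * (v (fst z))\<^sup>2"] sym by (simp add: case_prod_unfold)
  then have B2: "(\<integral>z. k (fst z) (snd z) * (v (snd z))\<^sup>2 \<partial>lborel2) \<le> c * (LBINT x. (v x)\<^sup>2)"
    using A(2)[OF v] by simp
  let ?b = "\<lambda>z. (k (fst z) (snd z) * (u (fst z))\<^sup>2 + k (fst z) (snd z) * (v (snd z))\<^sup>2) / 2"
  have bi: "integrable lborel2 ?b" using A(1)[OF u] B by simp
  have amgm: "k x y * (u x * v y) \<le> (k x y * (u x)\<^sup>2 + k x y * (v y)\<^sup>2) / 2"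
    "\<bar>k x y * (u x * v y)\<bar> \<le> (k x y * (u x)\<^sup>2 + k x y * (v y)\<^sup>2) / 2" for x y
  proof -
    have "\<bar>u x * v y\<bar> \<le> ((u x)\<^sup>2 + (v y)\<^sup>2) / 2"
      using sum_squares_bound[of "\<bar>u x\<bar>" "\<bar>v y\<bar>"] by (simp add: abs_mult)
    then have "k x y * \<bar>u x * v y\<bar> \<le> k x y * (((u x)\<^sup>2 + (v y)\<^sup>2) / 2)"
      using nn by (intro mult_left_mono)
    then show *: "\<bar>k x y * (u x * v y)\<bar> \<le> (k x y * (u x)\<^sup>2 + k x y * (v y)\<^sup>2) / 2"
      using nn[of x y] by (simp add: abs_mult distrib_left)
    then show "k x y * (u x * v y) \<le> (k x y * (u x)\<^sup>2 + k x y * (v y)\<^sup>2) / 2" by linarith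
  qed
  show i: "integrable lborel2 (\<lambda>z. k (fst z) (snd z) * (u (fst z) * v (snd z)))"
    using amgm(2) by (intro integrable_dominated[OF bi]) (auto intro: order_trans[OF _ abs_ge_self])
  have "(\<integral>z. k (fst z) (snd z) * (u (fst z) * v (snd z)) \<partial>lborel2) \<le> (\<integral>z. ?b z \<partial>lborel2)"
    using amgm(1) by (intro integral_mono i bi) auto
  also have "\<dots> \<le> c * ((LBINT x. (u x)\<^sup>2) + (LBINT x. (v x)\<^sup>2)) / 2"
    using A(2)[OF u] B2 A(1)[OF u] B by (simp add: distrib_left)
  finally show "(\<integral>z. k (fst z) (snd z) * (u (fst z) * v (snd z)) \<partial>lborel2)
      \<le> c * ((LBINT x. (u x)\<^sup>2) + (LBINT x. (v x)\<^sup>2)) / 2" .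
qed

text \<open>K_0 diverges at 0, but a divergent integral takes the value 0 here. Hence
  \<open>gam\<close> vanishes at the origin, which fixes the pointwise limit there in
  \<open>gam_ball_small\<close>.\<close>

lemma besselK0_0: "besselK0 0 = 0"
proof -
  have "besselK0 0 = (LBINT t. indicator {0..} (t :: real))" by (simp add: besselK0_eq)
  also have "\<dots> = enn2real (emeasure lborel {0 :: real..})" by (simp add: measure_def)
  also have "emeasure lborel {0 :: real..} = \<infinity>"
  proof -
    have "ennreal (real n) \<le> emeasure lborel {0 :: real..}" for n
      using emeasure_mono[of "{0..real n}" "{0 :: real..}" lborel] by simp
    then show ?thesis by (metis ennreal_Ex_less_of_nat ennreal_of_nat_eq_real_of_nat infinity_ennreal_def less_top linorder_not_le)
  qed
  finally show ?thesis by simp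
qed

lemma gam_0: "gam 0 = 0"
  by (simp add: gam_def besselK0_0)

section \<open>The kernel of the half-plane, its symmetry and its bounds\<close>

lemma upper_half_borel [measurable]: "upper_half \<in> sets borel"
  unfolding upper_half_def by (intro borel_open open_Collect_less continuous_intros)

lemma reflect_measurable [measurable]: "reflect \<in> borel_measurable borel"
  unfolding reflect_def[abs_def] by (intro borel_measurable_continuous_onI continuous_intros)

lemma gam_uminus: "gam (- z) = gam z"
  by (simp add: gam_def)

lemma gam_reflect: "gam (reflect x - y) = gam (x - reflect y)"
proof -
  have "norm (reflect x - y) = norm (x - reflect y)"
    by (cases x; cases y) (simp add: reflect_def norm_Pair power2_eq_square algebra_simps)
  then show ?thesis by (simp add: gam_def)
qed

lemma GreenPi_gam: "GreenPi x y = gam (x - y) - gam (x - reflect y)"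
  unfolding gam_reflect[symmetric] by (simp add: GreenPi_def GreenR2_def gam_def dist_norm)

text \<open>Extension by zero lets all integrals run over the plane. Inside the half-plane the
  clipping acts only on the diagonal: there \<open>gam 0 = 0\<close> leaves
  \<open>GreenPi x x\<close> equal to \<open>- gam (x - reflect x)\<close>, and \<open>max 0\<close>
  restores nonnegativity.\<close>

definition ker :: "real \<times> real \<Rightarrow> real \<times> real \<Rightarrow> real" where
  "ker x y = indicator upper_half x * indicator upper_half y * max 0 (GreenPi x y)"

lemma ker_nonneg: "0 \<le> ker x y"
  by (simp add: ker_def)

lemma ker_le_gam: "ker x y \<le> gam (x - y)"
  using gam_nonneg[of "x - y"] gam_nonneg[of "x - reflect y"]
  by (auto simp: ker_def GreenPi_gam indicator_def)

lemma ker_outside: "x \<notin> upper_half \<or> y \<notin> upper_half \<Longrightarrow> ker x y = 0"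
  by (auto simp: ker_def)

lemma ker_sym: "ker x y = ker y x"
proof -
  have "gam (y - reflect x) = gam (x - reflect y)"
    using gam_reflect[of x y] gam_uminus[of "reflect x - y"] by simp
  then show ?thesis using gam_uminus[of "x - y"] by (simp add: ker_def GreenPi_gam)
qed

lemma norm_reflect_sq:
  "(norm (x - reflect y))\<^sup>2 = (norm (x - y))\<^sup>2 + 4 * snd x * snd y"
  by (simp add: power2_norm_eq_inner inner_prod_def reflect_def algebra_simps)

lemma norm_reflect_ge:
  assumes "x \<in> upper_half" "y \<in> upper_half"
  shows "norm (x - y) \<le> norm (x - reflect y)"
proof (rule power2_le_imp_le)
  show "(norm (x - y))\<^sup>2 \<le> (norm (x - reflect y))\<^sup>2"
    using assms unfolding norm_reflect_sq by (simp add: upper_half_def)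
qed simp

lemma ker_eq_GreenPi:
  assumes "x \<in> upper_half" "y \<in> upper_half" "x \<noteq> y"
  shows "ker x y = GreenPi x y"
  using assms gam_antimono[OF _ norm_reflect_ge[OF assms(1,2)]]
  by (simp add: ker_def GreenPi_gam)

lemma ker_measurable [measurable]: "(\<lambda>z. ker (fst z) (snd z)) \<in> borel_measurable lborel2"
  unfolding ker_def GreenPi_gam by measurable

lemma ker_measurable_row [measurable]: "ker x \<in> borel_measurable borel"
  unfolding ker_def[abs_def] GreenPi_gam by measurable

lemma ker_measurable_compose [measurable (raw)]:
  assumes [measurable]: "f \<in> borel_measurable M" "g \<in> borel_measurable M"
  shows "(\<lambda>z. ker (f z) (g z)) \<in> borel_measurable M"
  unfolding ker_def GreenPi_gam by measurable

text \<open>The squared distances from x to y and to its reflection differ by 4 x2 y2, so the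
  distances differ by at most 2 x2 y2/\<delta>, and K_0 is Lipschitz with constant 4/\<delta>^2
  beyond \<delta>. The prefactor 1/(2\<pi>) is bounded by 1.\<close>

lemma ker_far:
  assumes "\<delta> > 0" "x \<in> upper_half" "y \<in> upper_half" "dist x y \<ge> \<delta>"
  shows "ker x y \<le> 8 / \<delta> ^ 3 * (snd x * snd y)"
proof -
  define r where "r = norm (x - y)"
  define s where "s = norm (x - reflect y)"
  have rs: "\<delta> \<le> r" "r \<le> s" using assms norm_reflect_ge[of x y] by (auto simp: r_def s_def dist_norm)
  have p: "0 \<le> snd x * snd y" using assms by (simp add: upper_half_def)
  have eq: "(s - r) * (s + r) = 4 * (snd x * snd y)"
    using norm_reflect_sq[of x y] by (simp add: r_def s_def power2_eq_square algebra_simps)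
  have "(s - r) * (2 * \<delta>) \<le> (s - r) * (s + r)" using rs by (intro mult_left_mono) auto
  then have sr: "s - r \<le> 2 * (snd x * snd y) / \<delta>" unfolding eq using assms(1) by (simp add: field_simps)
  have "x \<noteq> y" using assms by auto
  then have "ker x y = 1 / (2 * pi) * (besselK0 r - besselK0 s)"
    using assms by (simp add: ker_eq_GreenPi GreenPi_gam gam_def r_def s_def right_diff_distrib diff_divide_distrib)
  also have "\<dots> \<le> 1 * (besselK0 r - besselK0 s)"
    using rs assms(1) pi_gt3 besselK0_antimono[of r s] by (intro mult_right_mono) (auto simp: field_simps)
  also have "\<dots> \<le> 4 / \<delta>\<^sup>2 * (s - r)" using besselK0_diff_le[OF assms(1) rs] by simp
  also have "\<dots> \<le> 4 / \<delta>\<^sup>2 * (2 * (snd x * snd y) / \<delta>)" using sr by (intro mult_left_mono) auto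
  also have "\<dots> = 8 / \<delta> ^ 3 * (snd x * snd y)"
    using assms(1) by (simp add: power2_eq_square power3_eq_cube)
  finally show ?thesis .
qed

lemma gam_translate_integrable: "integrable lborel (\<lambda>y. gam (x - y))"
  and gam_translate_sq: "L2 (\<lambda>y. gam (x - y))"
proof -
  have eq: "gam (x - y) = gam (y + - x)" for y using gam_uminus[of "x - y"] by simp
  show "integrable lborel (\<lambda>y. gam (x - y))" unfolding eq by (rule integrable_lborel_shift[OF gam_integrable])
  show "L2 (\<lambda>y. gam (x - y))"
    unfolding square_integrable_def using integrable_lborel_shift[OF gam_sq_integrable, of "- x"] by (auto simp: eq)
qed

lemma gam_translate_integral: "(LBINT y. gam (x - y)) = 1"
proof -
  have "(LBINT y. gam (x - y)) = (LBINT y. gam (y + - x))"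
    using gam_uminus[of "x - _"] by (intro lebesgue_integral_cong) auto
  then show ?thesis by (simp only: integral_lborel_shift[OF gam_measurable] gam_integral)
qed

lemma gam_ball_integral_translate:
  assumes [measurable]: "\<phi> \<in> borel_measurable borel"
  shows "(LBINT y. \<phi> (gam (x - y)) * indicator (ball x r) y) = (LBINT z. \<phi> (gam z) * indicator (ball 0 r) z :: real)"
proof -
  have "(LBINT y. \<phi> (gam (x - y)) * indicator (ball x r) y)
      = (LBINT y. (\<lambda>z. \<phi> (gam z) * indicator (ball 0 r) z) (y + - x))"
    by (intro lebesgue_integral_cong) (auto simp: indicator_def dist_norm norm_minus_commute gam_uminus[of "x - _", simplified])
  also have "\<dots> = (LBINT z. \<phi> (gam z) * indicator (ball 0 r) z)"
    by (rule integral_lborel_shift) (intro borel_measurable_times borel_measurable_indicator; measurable)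
  finally show ?thesis .
qed

lemma ker_row: "integrable lborel (ker x)" "(LBINT y. ker x y) \<le> 1" "L2 (ker x)"
proof -
  show i: "integrable lborel (ker x)"
    using ker_nonneg ker_le_gam gam_nonneg
    by (intro integrable_dominated[OF gam_translate_integrable[of x]]) auto
  have "(LBINT y. ker x y) \<le> (LBINT y. gam (x - y))"
    by (intro integral_mono i gam_translate_integrable ker_le_gam)
  also have "\<dots> = 1" by (rule gam_translate_integral)
  finally show "(LBINT y. ker x y) \<le> 1" .
  show "L2 (ker x)"
    using ker_nonneg ker_le_gam gam_nonneg
    by (intro square_integrable_mono[OF gam_translate_sq[of x]]) auto
qed

text \<open>Reflecting the second term turns the difference of two half-plane integrals into the
  integral of the fundamental solution over the slab of width twice the height of the pole.\<close>

lemma ker_row_height: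
  assumes "y \<in> upper_half"
  shows "(LBINT x. ker x y) \<le> 2 * snd y"
proof -
  have y2: "snd y > 0" using assms by (simp add: upper_half_def)
  have i: "integrable lborel (\<lambda>x. indicator A x * gam (x + a))" if "A \<in> sets borel" for A :: "(real \<times> real) set" and a
    using that gam_nonneg
    by (intro integrable_dominated[OF integrable_lborel_shift[OF gam_integrable, of a]]) (auto simp: indicator_def)
  have half: "(LBINT x. indicator upper_half x * gam (x + a)) = (LBINT z. indicator {snd a<..} (snd z) * gam z)" for a
  proof -
    have "(LBINT x. indicator upper_half x * gam (x + a)) = (LBINT x. (\<lambda>z. indicator {snd a<..} (snd z) * gam z) (x + a))"
      by (intro lebesgue_integral_cong) (auto simp: indicator_def upper_half_def)
    also have "\<dots> = (LBINT z. indicator {snd a<..} (snd z) * gam z)"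
      by (rule integral_lborel_shift) measurable
    finally show ?thesis .
  qed
  have iz: "integrable lborel (\<lambda>z. indicator {t<..} (snd z) * gam z)" for t
    using gam_nonneg by (intro integrable_dominated[OF gam_integrable]) (auto simp: indicator_def)
  have "(LBINT x. ker x y) = (LBINT x. indicator upper_half x * gam (x + - y) - indicator upper_half x * gam (x + - reflect y))"
  proof (rule integral_cong_AE)
    show "AE x in lborel. ker x y = indicator upper_half x * gam (x + - y) - indicator upper_half x * gam (x + - reflect y)"
      using AE_lborel_singleton[of y]
    proof eventually_elim
      fix x assume "x \<noteq> y"
      then show "ker x y = indicator upper_half x * gam (x + - y) - indicator upper_half x * gam (x + - reflect y)"
        using ker_eq_GreenPi[OF _ assms, of x] by (cases "x \<in> upper_half") (auto simp: GreenPi_gam ker_outside)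
    qed
  qed measurable
  also have "\<dots> = (LBINT z. indicator {- snd y<..} (snd z) * gam z) - (LBINT z. indicator {snd y<..} (snd z) * gam z)"
    using half[of "- y"] half[of "- reflect y"]
    by (subst Bochner_Integration.integral_diff[OF i i]) (auto simp: reflect_def)
  also have "\<dots> = (LBINT z. indicator {- snd y<..} (snd z) * gam z - indicator {snd y<..} (snd z) * gam z)"
    by (rule Bochner_Integration.integral_diff[OF iz iz, symmetric])
  also have "\<dots> = (LBINT z. indicator {- snd y<..snd y} (snd z) * gam z)"
    using y2 by (intro lebesgue_integral_cong) (auto simp: indicator_def)
  also have "\<dots> \<le> snd y - - snd y" using y2 by (intro gam_slab_integral) auto
  finally show ?thesis by simp
qed

text \<open>Taken with \<phi> the identity in \<open>form_small\<close> and with the square in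
  \<open>nonvanishing\<close>. The balls shrink to the origin, where \<phi>(gam 0) = 0, so dominated
  convergence works at every point.\<close>

lemma gam_ball_small:
  assumes "integrable lborel (\<lambda>z. \<phi> (gam z))" "\<phi> 0 = (0 :: real)" "\<epsilon> > 0" "\<phi> \<in> borel_measurable borel"
  obtains \<delta> where "\<delta> > 0" "(LBINT z. \<phi> (gam z) * indicator (ball 0 \<delta>) z) < \<epsilon>"
proof -
  note [measurable] = assms(4)
  have "(\<lambda>n. LBINT z. \<phi> (gam z) * indicator (ball 0 (1 / real (Suc n))) z) \<longlonglongrightarrow> 0"
  proof (rule integral_tendsto_zero)
    show "integrable lborel (\<lambda>z. \<bar>\<phi> (gam z)\<bar>)" using assms(1) by simp
    fix z :: "real \<times> real"
    show "(\<lambda>n. \<phi> (gam z) * indicator (ball 0 (1 / real (Suc n))) z) \<longlonglongrightarrow> 0"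
    proof (cases "z = 0")
      case False
      then have "eventually (\<lambda>n. 1 / real (Suc n) < norm z) sequentially"
        using LIMSEQ_D[OF LIMSEQ_inverse_real_of_nat, of "norm z"] by (auto simp: eventually_sequentially inverse_eq_divide)
      then have "eventually (\<lambda>n. \<phi> (gam z) * indicator (ball 0 (1 / real (Suc n))) z = 0) sequentially"
        by (rule eventually_mono) (auto simp: indicator_def)
      then show ?thesis by (rule tendsto_eventually)
    qed (simp add: gam_0 assms(2))
  qed (auto simp: indicator_def)
  then have "eventually (\<lambda>n. (LBINT z. \<phi> (gam z) * indicator (ball 0 (1 / real (Suc n))) z) < \<epsilon>) sequentially"
    using assms(3) by (rule order_tendstoD)
  then obtain n where "(LBINT z. \<phi> (gam z) * indicator (ball 0 (1 / real (Suc n))) z) < \<epsilon>"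
    by (auto simp: eventually_sequentially)
  then show ?thesis using that[of "1 / real (Suc n)"] by simp
qed

section \<open>The sharp constant\<close>

definition form :: "(real \<times> real \<Rightarrow> real) \<Rightarrow> (real \<times> real \<Rightarrow> real) \<Rightarrow> real" where
  "form u v = (\<integral>z. ker (fst z) (snd z) * (u (fst z) * v (snd z)) \<partial>lborel2)"

definition pot :: "(real \<times> real \<Rightarrow> real) \<Rightarrow> real \<times> real \<Rightarrow> real" where
  "pot v x = (LBINT y. ker x y * v y)"

definition imp :: "(real \<times> real \<Rightarrow> real) \<Rightarrow> real" where
  "imp w = (LBINT x. snd x * w x)"

text \<open>The sign and support conditions hold at every point, so that cut-offs and truncations
  involve no exceptional sets. Impulse is required to be finite while mass is left free, so the
  sharp inequality applies to any cut-off piece.\<close>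

definition vort :: "(real \<times> real \<Rightarrow> real) \<Rightarrow> bool" where
  "vort w \<longleftrightarrow> L2 w \<and> (\<forall>x. 0 \<le> w x) \<and> (\<forall>x. x \<notin> upper_half \<longrightarrow> w x = 0)
    \<and> integrable lborel (\<lambda>x. snd x * w x)"

definition Elam :: "real \<Rightarrow> (real \<times> real \<Rightarrow> real) \<Rightarrow> real" where
  "Elam lam w = form w w / 2 - 1 / (2 * lam) * (LBINT x. (w x)\<^sup>2)"

lemma vortD:
  assumes "vort w"
  shows "L2 w" "\<And>x. 0 \<le> w x" "\<And>x. x \<notin> upper_half \<Longrightarrow> w x = 0"
    "integrable lborel (\<lambda>x. snd x * w x)" "w \<in> borel_measurable borel" "\<And>x. 0 \<le> snd x * w x"
proof -
  show w0: "0 \<le> w x" and wo: "x \<notin> upper_half \<Longrightarrow> w x = 0" for x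
    using assms unfolding vort_def by blast+
  show sq: "L2 w" and "integrable lborel (\<lambda>x. snd x * w x)"
    using assms unfolding vort_def by blast+
  show "w \<in> borel_measurable borel" using square_integrableD[OF sq] by simp
  show "0 \<le> snd x * w x" for x
    using w0[of x] wo[of x] by (cases "x \<in> upper_half") (simp_all add: upper_half_def)
qed

lemma abs_fst_le_norm: "\<bar>fst z\<bar> \<le> norm z" and abs_snd_le_norm: "\<bar>snd z\<bar> \<le> norm z" for z :: "real \<times> real"
  using norm_fst_le[of "fst z" "snd z"] norm_snd_le[of "snd z" "fst z"] by simp_all

lemma imp_nonneg: "vort w \<Longrightarrow> 0 \<le> imp w"
  unfolding imp_def by (intro integral_nonneg_AE AE_I2 vortD)

lemma form_integrable:
  assumes "L2 u" "L2 v"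
  shows "integrable lborel2 (\<lambda>z. ker (fst z) (snd z) * (u (fst z) * v (snd z)))"
  by (rule symmetric_kernel_form(1)[OF ker_measurable ker_nonneg ker_sym ker_row(1,2) assms])

lemma form_commute: "form u v = form v u"
proof -
  have sw: "integrable lborel2 (\<lambda>z. ker (fst z) (snd z) * (u (fst z) * v (snd z)))
     \<longleftrightarrow> integrable lborel2 (\<lambda>z. ker (fst z) (snd z) * (v (fst z) * u (snd z)))"
    using lborel_pair.integrable_product_swap_iff[of "\<lambda>z. ker (fst z) (snd z) * (u (fst z) * v (snd z))"]
    by (simp add: case_prod_unfold ker_sym mult.commute)
  show ?thesis
  proof (cases "integrable lborel2 (\<lambda>z. ker (fst z) (snd z) * (u (fst z) * v (snd z)))")
    case True
    then show ?thesis
      using lborel_pair.integral_product_swap[of "\<lambda>z. ker (fst z) (snd z) * (u (fst z) * v (snd z))"]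
      by (simp add: form_def case_prod_unfold ker_sym mult.commute borel_measurable_integrable)
  next
    \<comment> \<open>Integrability fails for both orders at once, and both integrals take the
      default value 0.\<close>
    case False
    with sw show ?thesis by (simp add: form_def not_integrable_integral_eq)
  qed
qed

lemma form_add_left:
  assumes "L2 u" "L2 u'" "L2 v"
  shows "form (\<lambda>x. u x + u' x) v = form u v + form u' v"
  unfolding form_def distrib_left distrib_right
  using form_integrable[OF assms(1,3)] form_integrable[OF assms(2,3)] by simp

lemma form_add_right:
  assumes "L2 u" "L2 u'" "L2 v"
  shows "form v (\<lambda>x. u x + u' x) = form v u + form v u'"
  using form_add_left[OF assms] by (simp add: form_commute)

lemma form_nonneg:
  assumes "\<And>x. 0 \<le> u x" "\<And>x. 0 \<le> v x"
  shows "0 \<le> form u v"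
  unfolding form_def using assms ker_nonneg by (intro integral_nonneg_AE AE_I2) simp

lemma form_scale: "form (\<lambda>x. c * u x) (\<lambda>x. c * u x) = c\<^sup>2 * form u u"
proof -
  have eq: "ker x y * (c * u x * (c * u y)) = c\<^sup>2 * (ker x y * (u x * u y))" for x y
    by (simp add: power2_eq_square)
  show ?thesis by (simp only: form_def eq integral_mult_right_zero)
qed

lemma form_pot:
  assumes "L2 u" "L2 v"
  shows "form u v = (LBINT x. u x * pot v x)" "integrable lborel (\<lambda>x. u x * pot v x)"
proof -
  have eq: "(LBINT y. ker x y * (u x * v y)) = u x * pot v x" for x
    unfolding pot_def by (subst integral_mult_right_zero[symmetric]) (simp add: mult_ac)
  show "form u v = (LBINT x. u x * pot v x)"
    using lborel_pair.integral_fst'[OF form_integrable[OF assms]] by (simp add: form_def eq)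
  show "integrable lborel (\<lambda>x. u x * pot v x)"
    using lborel_pair.integrable_fst'[OF form_integrable[OF assms]] by (simp add: eq)
qed

lemma pot_measurable:
  assumes [measurable]: "v \<in> borel_measurable borel"
  shows "pot v \<in> borel_measurable borel"
proof -
  have "(\<lambda>z. ker (fst z) (snd z) * v (snd z)) \<in> borel_measurable (borel \<Otimes>\<^sub>M lborel)"
    by measurable
  then have "(\<lambda>x. LBINT y. ker x y * v y) \<in> borel_measurable borel"
    by (intro lborel.borel_measurable_lebesgue_integral) (simp add: case_prod_unfold)
  then show ?thesis by (simp add: pot_def[abs_def])
qed

lemma pot_nonneg: "(\<And>x. 0 \<le> v x) \<Longrightarrow> 0 \<le> pot v x"
  unfolding pot_def using ker_nonneg by (intro integral_nonneg_AE AE_I2) simp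

text \<open>The kernel is split at a distance \<delta> so small that the near part has row integrals
  at most \<epsilon>, where Schur's test applies. The far part is at most C x2 y2, whose double
  integral is C times the squared impulse. Besides the finiteness of \<open>kappa\<close>, this
  controls the outer part of the form in \<open>strong_L2\<close>.\<close>

lemma form_small:
  assumes "\<epsilon> > 0"
  obtains C where "C \<ge> 0" "\<And>w. vort w \<Longrightarrow> form w w \<le> \<epsilon> * (LBINT x. (w x)\<^sup>2) + C * (imp w)\<^sup>2"
proof -
  obtain \<delta> where \<delta>: "\<delta> > 0" "(LBINT z. gam z * indicator (ball 0 \<delta>) z) < \<epsilon>"
    using gam_ball_small[of "\<lambda>t. t" \<epsilon>] gam_integrable assms by auto
  define near where "near x y = (if dist x y < \<delta> then ker x y else 0)" for x y
  define C where "C = 8 / \<delta> ^ 3"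
  have C: "C \<ge> 0" using \<delta> by (simp add: C_def)
  have nm [measurable]: "(\<lambda>z. near (fst z) (snd z)) \<in> borel_measurable lborel2"
    unfolding near_def by measurable
  have n0: "0 \<le> near x y" and nsym: "near x y = near y x" for x y
    by (auto simp: near_def ker_nonneg ker_sym dist_commute)
  have row: "integrable lborel (near x)" for x
    using ker_nonneg by (intro integrable_dominated[OF ker_row(1)[of x]]) (auto simp: near_def[abs_def])
  have rowb: "(LBINT y. near x y) \<le> \<epsilon>" for x
  proof -
    have i: "integrable lborel (\<lambda>y. gam (x - y) * indicator (ball x \<delta>) y)"
      using gam_nonneg by (intro integrable_dominated[OF gam_translate_integrable[of x]]) (auto simp: indicator_def)
    have "(LBINT y. near x y) \<le> (LBINT y. gam (x - y) * indicator (ball x \<delta>) y)"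
      by (intro integral_mono row i) (auto simp: near_def indicator_def ker_le_gam gam_nonneg)
    also have "\<dots> \<le> \<epsilon>" using gam_ball_integral_translate[of "\<lambda>t. t" x \<delta>] \<delta> by simp
    finally show ?thesis .
  qed
  have "form w w \<le> \<epsilon> * (LBINT x. (w x)\<^sup>2) + C * (imp w)\<^sup>2" if w: "vort w" for w
  proof -
    note v = vortD[OF w]
    note [measurable] = v(5)
    define a where "a x = snd x * w x" for x
    have a0: "0 \<le> a x" for x using v(6) by (simp add: a_def)
    have ai: "integrable lborel a" using v(4) by (simp add: a_def[abs_def])
    have am [measurable]: "a \<in> borel_measurable borel" unfolding a_def[abs_def] by measurable
    have ia: "imp w = integral\<^sup>L lborel a" by (simp add: imp_def a_def[abs_def])
    have [measurable]: "(\<lambda>z. a (fst z) * a (snd z)) \<in> borel_measurable lborel2" by measurable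
    have P: "integrable lborel2 (\<lambda>z. a (fst z) * a (snd z))"
      using a0 ai by (intro integrable_row_bound(1)[where a = "\<lambda>x. a x * imp w"]) (auto simp: ia)
    have P2: "(\<integral>z. a (fst z) * a (snd z) \<partial>lborel2) \<le> (imp w)\<^sup>2"
    proof -
      have "(\<integral>z. a (fst z) * a (snd z) \<partial>lborel2) \<le> (LBINT x. a x * imp w)"
        using a0 ai by (intro integrable_row_bound(2)) (auto simp: ia)
      then show ?thesis by (simp add: ia power2_eq_square)
    qed
    note N = symmetric_kernel_form[OF nm n0 nsym row rowb v(1) v(1)]
    have le: "ker x y * (w x * w y) \<le> near x y * (w x * w y) + C * (a x * a y)" for x y
    proof (cases "dist x y < \<delta> \<or> x \<notin> upper_half \<or> y \<notin> upper_half")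
      case True
      then show ?thesis using a0[of x] a0[of y] C v(3)[of x] v(3)[of y] by (auto simp: near_def)
    next
      case False
      then have "ker x y \<le> C * (snd x * snd y)" using ker_far[OF \<delta>(1), of x y] by (simp add: C_def)
      then have "ker x y * (w x * w y) \<le> C * (snd x * snd y) * (w x * w y)"
        using v(2)[of x] v(2)[of y] by (intro mult_right_mono) auto
      with False show ?thesis by (simp add: near_def a_def mult_ac)
    qed
    have "form w w \<le> (\<integral>z. near (fst z) (snd z) * (w (fst z) * w (snd z)) + C * (a (fst z) * a (snd z)) \<partial>lborel2)"
      unfolding form_def using le N(1) P by (intro integral_mono form_integrable v) auto
    also have "\<dots> = (\<integral>z. near (fst z) (snd z) * (w (fst z) * w (snd z)) \<partial>lborel2) + C * (\<integral>z. a (fst z) * a (snd z) \<partial>lborel2)"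
      using N(1) P by simp
    also have "\<dots> \<le> \<epsilon> * (LBINT x. (w x)\<^sup>2) + C * (imp w)\<^sup>2"
      using N(2) mult_left_mono[OF P2 C] by simp
    finally show ?thesis .
  qed
  with C show ?thesis by (rule that)
qed

lemma vort_scale:
  assumes "vort w" "c \<ge> 0"
  shows "vort (\<lambda>x. c * w x)" "imp (\<lambda>x. c * w x) = c * imp w" "Elam lam (\<lambda>x. c * w x) = c\<^sup>2 * Elam lam w"
proof -
  have eq: "snd x * (c * w x) = c * (snd x * w x)" for x :: "real \<times> real" by simp
  show "vort (\<lambda>x. c * w x)" using assms vortD[OF assms(1)] square_integrable_cmult[of lborel w c]
    unfolding vort_def eq by auto
  show "imp (\<lambda>x. c * w x) = c * imp w" unfolding imp_def eq by simp
  show "Elam lam (\<lambda>x. c * w x) = c\<^sup>2 * Elam lam w"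
    by (simp add: Elam_def form_scale power_mult_distrib right_diff_distrib)
qed

section \<open>The best constant: finiteness, positivity, near-optimizers of bounded mass\<close>

definition kappa :: "real \<Rightarrow> real" where
  "kappa lam = (SUP w\<in>{w. vort w \<and> imp w = 1}. Elam lam w)"

lemma Elam_bound:
  assumes "lam > 0"
  obtains C where "C \<ge> 0" "\<And>w. vort w \<Longrightarrow> Elam lam w \<le> C * (imp w)\<^sup>2"
proof -
  \<comment> \<open>With \<epsilon> = 1/\<lambda> the two enstrophy terms cancel exactly.\<close>
  obtain C where C: "C \<ge> 0" "\<And>w. vort w \<Longrightarrow> form w w \<le> 1 / lam * (LBINT x. (w x)\<^sup>2) + C * (imp w)\<^sup>2"
    using form_small[of "1 / lam"] assms by auto
  have "Elam lam w \<le> C / 2 * (imp w)\<^sup>2" if "vort w" for w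
    using C(2)[OF that] by (simp add: Elam_def field_simps)
  then show ?thesis using that[of "C / 2"] C(1) by simp
qed

lemma Elam_le_kappa:
  assumes "lam > 0" "vort w"
  shows "Elam lam w \<le> kappa lam * (imp w)\<^sup>2"
proof -
  obtain C where C: "C \<ge> 0" "\<And>w. vort w \<Longrightarrow> Elam lam w \<le> C * (imp w)\<^sup>2"
    using Elam_bound[OF assms(1)] by blast
  show ?thesis
  proof (cases "imp w = 0")
    \<comment> \<open>Scaling to impulse one is impossible here, but the bound with the constant C
      already makes the energy nonpositive.\<close>
    case True
    then show ?thesis using C(2)[OF assms(2)] by simp
  next
    case False
    then have p: "imp w > 0" using imp_nonneg[OF assms(2)] by simp
    note s = vort_scale[OF assms(2), of "1 / imp w"]
    have "Elam lam (\<lambda>x. 1 / imp w * w x) \<le> kappa lam"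
      unfolding kappa_def
    proof (rule cSUP_upper)
      show "(\<lambda>x. 1 / imp w * w x) \<in> {w. vort w \<and> imp w = 1}" using s p by simp
      show "bdd_above (Elam lam ` {w. vort w \<and> imp w = 1})"
        using C(2) by (intro bdd_aboveI[of _ C]) fastforce
    qed
    then have "(1 / imp w)\<^sup>2 * Elam lam w \<le> kappa lam" using s(3) p by simp
    then show ?thesis using p by (simp add: power_divide field_simps)
  qed
qed

lemma pot_row: "L2 v \<Longrightarrow> integrable lborel (\<lambda>y. ker x y * v y)"
  using square_integrable_mult[OF ker_row(3)] by blast

lemma emeasure_Times_lborel:
  assumes "A \<in> sets borel" "B \<in> sets borel"
  shows "emeasure lborel (A \<times> B :: (real \<times> real) set) = emeasure lborel A * emeasure lborel B"
  using lborel.emeasure_pair_measure_Times[of A lborel B] assms by (simp add: lborel_prod)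

lemma vort_indicator:
  assumes "Q \<in> sets borel" "Q \<subseteq> upper_half" "emeasure lborel Q < \<infinity>" "\<And>x. x \<in> Q \<Longrightarrow> snd x \<le> K"
  shows "vort (indicator Q)"
  unfolding vort_def
proof (intro conjI allI impI)
  show "L2 (indicator Q :: _ \<Rightarrow> real)" using assms by (intro square_integrable_indicator) auto
  have iQ: "integrable lborel (\<lambda>x. K * indicator Q x)" using assms by (simp add: integrable_indicator_iff)
  show "integrable lborel (\<lambda>x. snd x * indicator Q x)"
  proof (rule Bochner_Integration.integrable_bound[OF iQ])
    show "(\<lambda>x. snd x * indicator Q x) \<in> borel_measurable lborel"
      using assms(1) snd_borel_measurable by (intro borel_measurable_times borel_measurable_indicator) auto
    show "AE x in lborel. norm (snd x * indicator Q x) \<le> norm (K * indicator Q x)"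
    proof (rule AE_I2)
      fix x
      show "norm (snd x * indicator Q x) \<le> norm (K * indicator Q x)"
      proof (cases "x \<in> Q")
        case True
        then have "0 < snd x" "snd x \<le> K" using assms(2,4) unfolding upper_half_def by blast+
        with True show ?thesis by simp
      qed simp
    qed
  qed
qed (use assms in \<open>auto simp: indicator_def\<close>)

text \<open>Tested on the indicator of a square Q of side L raised to height R. Around a point of Q'
  the ball of radius R lies in Q and carries kernel mass m, whereas the mirror image of any point of
  Q is at distance at least R from Q and costs at most 1 - m. For large L the form is therefore at
  least about (2m - 1) L^2, against an enstrophy L^2 weighted by 1/\<lambda>.\<close>

lemma kappa_pos:
  assumes "lam > 1"
  shows "kappa lam > 0"
proof -
  have "(\<lambda>n. LBINT z. gam z * (1 - indicator (ball 0 (real n)) z)) \<longlonglongrightarrow> 0"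
  proof (rule integral_tendsto_zero[OF _ gam_integrable])
    fix z :: "real \<times> real"
    obtain n0 :: nat where "norm z < real n0" using reals_Archimedean2 by blast
    then have "eventually (\<lambda>n. gam z * (1 - indicator (ball 0 (real n)) z) = 0) sequentially"
      unfolding eventually_sequentially by (intro exI[of _ n0]) (auto simp: indicator_def)
    then show "(\<lambda>n. gam z * (1 - indicator (ball 0 (real n)) z)) \<longlonglongrightarrow> 0" by (rule tendsto_eventually)
  qed (auto simp: indicator_def gam_nonneg)
  moreover have l1: "(1 - 1 / lam) / 2 > 0" using assms by simp
  ultimately have "eventually (\<lambda>n. (LBINT z. gam z * (1 - indicator (ball 0 (real n)) z)) < (1 - 1 / lam) / 2) sequentially"
    by (rule order_tendstoD)
  then obtain n where "\<forall>k\<ge>n. (LBINT z. gam z * (1 - indicator (ball 0 (real k)) z)) < (1 - 1 / lam) / 2"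
    unfolding eventually_sequentially by blast
  then have n: "(LBINT z. gam z * (1 - indicator (ball 0 (real (Suc n))) z)) < (1 - 1 / lam) / 2"
    by (metis le_Suc_eq order_refl)
  \<comment> \<open>The mass of \<open>gam\<close> beyond R is below (1 - 1/\<lambda>)/2, which is
    the same as 2m - 1 > 1/\<lambda>; \<open>Suc n\<close> keeps R positive.\<close>
  define R where "R = real (Suc n)"
  have R: "R > 0" by (simp add: R_def)
  define m where "m = (LBINT z. gam z * indicator (ball 0 R) z)"
  have ib: "integrable lborel (\<lambda>y. gam (x - y) * indicator (ball x R) y)" for x
    using gam_nonneg by (intro integrable_dominated[OF gam_translate_integrable[of x]]) (auto simp: indicator_def)
  have mb: "(LBINT y. gam (x - y) * indicator (ball x R) y) = m" for x
    using gam_ball_integral_translate[of "\<lambda>t. t" x R] by (simp add: m_def)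
  have "(LBINT z. gam z * (1 - indicator (ball 0 R) z)) = 1 - m"
  proof -
    have "integrable lborel (\<lambda>z. gam z * indicator (ball 0 R) z)"
      using gam_nonneg by (intro integrable_dominated[OF gam_integrable]) (auto simp: indicator_def)
    then show ?thesis using gam_integrable gam_integral by (simp add: m_def right_diff_distrib)
  qed
  then have m: "2 * m - 1 > 1 / lam" using n by (simp add: R_def)
  have m0: "m \<ge> 0" unfolding m_def by (intro integral_nonneg_AE AE_I2) (simp add: gam_nonneg)
  have m1: "m \<le> 1" using gam_translate_integral[of 0] mb[of 0] integral_mono[OF ib[of 0] gam_translate_integrable[of 0]]
    by (auto simp: indicator_def gam_nonneg)
  \<comment> \<open>L is taken so large that the boundary strip Q - Q' of width R uses up less than
    the margin in 2m - 1 > 1/\<lambda>.\<close>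
  have "((\<lambda>L. (1 - 2 * R / L)\<^sup>2 * m - (1 - m)) \<longlongrightarrow> (1 - 0)\<^sup>2 * m - (1 - m)) at_top"
    by (intro tendsto_intros tendsto_divide_0[OF tendsto_const] filterlim_at_top_imp_at_infinity filterlim_ident)
  then have "eventually (\<lambda>L. (1 - 2 * R / L)\<^sup>2 * m - (1 - m) > 1 / lam) at_top"
    using m by (intro order_tendstoD(1)) auto
  then obtain L where L: "L > 2 * R" "(1 - 2 * R / L)\<^sup>2 * m - (1 - m) > 1 / lam"
    using eventually_happens[OF eventually_conj[OF eventually_gt_at_top[of "2 * R"]]] by auto
  define Q where "Q = {0..L} \<times> {R..R + L}"
  define Q' where "Q' = {R..L - R} \<times> {2 * R..L}"
  have Qs [measurable]: "Q \<in> sets borel" "Q' \<in> sets borel"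
    unfolding Q_def Q'_def by (auto intro!: borel_closed closed_Times)
  have eQ: "emeasure lborel Q = ennreal (L\<^sup>2)"
    unfolding Q_def using L R by (subst emeasure_Times_lborel) (auto simp: power2_eq_square simp flip: ennreal_mult)
  have eQ': "emeasure lborel Q' = ennreal ((L - 2 * R)\<^sup>2)"
    unfolding Q'_def using L R by (subst emeasure_Times_lborel) (auto simp: power2_eq_square simp flip: ennreal_mult)
  have QP: "Q \<subseteq> upper_half" using R by (auto simp: Q_def upper_half_def)
  have Q'Q: "Q' \<subseteq> Q" using R L by (auto simp: Q_def Q'_def)
  have vQ: "vort (indicator Q)"
  proof (rule vort_indicator[OF Qs(1) QP])
    show "emeasure lborel Q < \<infinity>" by (simp add: eQ)
    show "snd x \<le> R + L" if "x \<in> Q" for x using that by (auto simp: Q_def)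
  qed
  note v = vortD[OF vQ]
  have pt: "pot (indicator Q) x \<ge> m * indicator Q' x - (1 - m)" if x: "x \<in> Q" for x
  proof -
    have i1: "integrable lborel (\<lambda>y. gam (z - y) * indicator Q y)" for z
      using gam_nonneg by (intro integrable_dominated[OF gam_translate_integrable[of z]]) (auto simp: indicator_def)
    have a: "(LBINT y. gam (x - y) * indicator Q y) \<ge> m * indicator Q' x"
    proof (cases "x \<in> Q'")
      case True
      have "ball x R \<subseteq> Q"
      proof
        fix y assume "y \<in> ball x R"
        then have "norm (x - y) < R" by (simp add: dist_norm)
        then have "\<bar>fst x - fst y\<bar> < R" "\<bar>snd x - snd y\<bar> < R"
          using abs_fst_le_norm[of "x - y"] abs_snd_le_norm[of "x - y"] by auto
        then show "y \<in> Q" using True by (cases x; cases y) (auto simp: Q_def Q'_def)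
      qed
      then have "m \<le> (LBINT y. gam (x - y) * indicator Q y)"
        unfolding mb[of x, symmetric] by (intro integral_mono ib i1) (auto simp: indicator_def gam_nonneg)
      then show ?thesis using True by simp
    qed (auto intro!: integral_nonneg_AE simp: gam_nonneg)
    have b: "(LBINT y. gam (reflect x - y) * indicator Q y) \<le> 1 - m"
    proof -
      have "(LBINT y. gam (reflect x - y) * indicator Q y) \<le> (LBINT y. gam (reflect x - y) - gam (reflect x - y) * indicator (ball (reflect x) R) y)"
      proof (intro integral_mono i1 Bochner_Integration.integrable_diff gam_translate_integrable ib)
        fix y
        have "y \<notin> ball (reflect x) R" if "y \<in> Q"
        proof -
          have "R \<le> \<bar>snd (reflect x - y)\<bar>" using that x R by (cases x; cases y) (auto simp: Q_def reflect_def)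
          also have "\<dots> \<le> norm (reflect x - y)" by (rule abs_snd_le_norm)
          finally show ?thesis by (simp add: dist_norm)
        qed
        then show "gam (reflect x - y) * indicator Q y \<le> gam (reflect x - y) - gam (reflect x - y) * indicator (ball (reflect x) R) y"
          using gam_nonneg by (auto simp: indicator_def)
      qed
      also have "\<dots> = 1 - m" using gam_translate_integrable ib by (simp add: gam_translate_integral mb)
      finally show ?thesis .
    qed
    have "(LBINT y. gam (x - y) * indicator Q y - gam (reflect x - y) * indicator Q y) \<le> pot (indicator Q) x"
      unfolding pot_def using x QP
      by (intro integral_mono Bochner_Integration.integrable_diff i1 pot_row v)
         (auto simp: indicator_def ker_def GreenPi_gam gam_reflect)
    then show ?thesis using a b i1 by simp
  qed
  have "(L - 2 * R)\<^sup>2 * m - (1 - m) * L\<^sup>2 = (LBINT x. m * indicator Q' x - (1 - m) * indicator Q x)"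
    using eQ eQ' L by (simp add: integrable_indicator_iff measure_def)
  also have "\<dots> \<le> form (indicator Q) (indicator Q)"
    unfolding form_pot(1)[OF v(1) v(1)]
  proof (intro integral_mono form_pot v)
    show "integrable lborel (\<lambda>x. m * indicator Q' x - (1 - m) * indicator Q x)"
      using eQ eQ' by (simp add: integrable_indicator_iff)
    show "m * indicator Q' x - (1 - m) * indicator Q x \<le> indicator Q x * pot (indicator Q) x" for x
      using pt[of x] Q'Q by (auto simp: indicator_def)
  qed
  finally have f: "(L - 2 * R)\<^sup>2 * m - (1 - m) * L\<^sup>2 \<le> form (indicator Q) (indicator Q)" .
  have Lp: "L > 0" using L R by simp
  have "1 / lam * L\<^sup>2 < ((1 - 2 * R / L)\<^sup>2 * m - (1 - m)) * L\<^sup>2"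
    using L(2) Lp by (intro mult_strict_right_mono) auto
  also have "\<dots> = ((1 - 2 * R / L) * L)\<^sup>2 * m - (1 - m) * L\<^sup>2" by (simp only: power_mult_distrib) (simp add: algebra_simps)
  also have "(1 - 2 * R / L) * L = L - 2 * R" using Lp by (simp add: field_simps)
  finally have "1 / lam * L\<^sup>2 < form (indicator Q) (indicator Q)" using f by simp
  moreover have "(LBINT x. (indicator Q x :: real)\<^sup>2) = L\<^sup>2"
  proof -
    have "(LBINT x. (indicator Q x :: real)\<^sup>2) = (LBINT x. indicator Q x)"
      by (intro lebesgue_integral_cong) (auto simp: indicator_def)
    then show ?thesis using eQ by (simp add: measure_def)
  qed
  ultimately have "Elam lam (indicator Q) > 0" by (simp add: Elam_def)
  also have "Elam lam (indicator Q) \<le> kappa lam * (imp (indicator Q))\<^sup>2"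
    using assms vQ by (intro Elam_le_kappa) auto
  finally show ?thesis by (auto simp: zero_less_mult_iff)
qed

text \<open>Cutting $w$ off at $\lambda$ times its potential increases the energy, and the mass of the
  potential is at most twice the impulse; so the mass constraint is not binding for large $\nu$.\<close>

lemma truncation:
  assumes "lam > 0" "vort w"
  defines "w' \<equiv> \<lambda>x. min (w x) (lam * pot w x)"
  shows "vort w'" "Elam lam w \<le> Elam lam w'" "imp w' \<le> imp w" "integrable lborel w'"
    "(LBINT x. w' x) \<le> 2 * lam * imp w"
proof -
  note v = vortD[OF assms(2)]
  note [measurable] = v(5) pot_measurable[OF v(5)]
  have p0: "0 \<le> pot w x" for x by (rule pot_nonneg[OF v(2)])
  have w'm [measurable]: "w' \<in> borel_measurable borel" unfolding w'_def by measurable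
  have w'b: "0 \<le> w' x" "w' x \<le> w x" "w' x \<le> lam * pot w x" for x
    using v(2)[of x] p0[of x] assms(1) by (auto simp: w'_def)
  have s': "L2 w'"
  proof (rule square_integrable_mono[OF v(1)])
    show "\<bar>w' x\<bar> \<le> \<bar>w x\<bar>" for x using w'b(1,2)[of x] by simp
  qed simp
  have sw: "\<bar>snd x * w' x\<bar> \<le> snd x * w x" "snd x * w' x \<le> snd x * w x" for x
  proof -
    have "0 \<le> snd x * w' x \<and> snd x * w' x \<le> snd x * w x"
    proof (cases "x \<in> upper_half")
      case True
      then show ?thesis using w'b(1,2)[of x] by (auto simp: upper_half_def intro: mult_left_mono)
    next
      case False
      then show ?thesis using w'b(1,2)[of x] v(3)[of x] by simp
    qed
    then show "\<bar>snd x * w' x\<bar> \<le> snd x * w x" "snd x * w' x \<le> snd x * w x" by auto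
  qed
  have i': "integrable lborel (\<lambda>x. snd x * w' x)"
    using sw(1) by (intro integrable_dominated[OF v(4)]) (auto intro: order_trans[OF _ abs_ge_self])
  show "vort w'" unfolding vort_def
  proof (intro conjI allI impI s' i' w'b(1))
    show "w' x = 0" if "x \<notin> upper_half" for x
      using w'b(1,2)[of x] v(3)[OF that] by simp
  qed
  show "imp w' \<le> imp w" unfolding imp_def using sw(2) by (intro integral_mono i' v(4))
  define d where "d x = w x - w' x" for x
  have sd: "L2 d" unfolding d_def[abs_def] by (rule square_integrable_diff[OF v(1) s'])
  have wd: "w x = w' x + d x" for x by (simp add: d_def)
  have f1: "form w' w' = form w w - 2 * form w d + form d d"
  proof -
    have ww: "form w g = form w' g + form d g" if "L2 g" for g
      using form_add_left[OF s' sd that] by (simp add: d_def)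
    have "form w w = form w' w + form d w" by (rule ww[OF v(1)])
    moreover have "form w' w = form w w'" by (rule form_commute)
    moreover have "form w w' = form w' w' + form d w'" by (rule ww[OF s'])
    moreover have "form w d = form w' d + form d d" by (rule ww[OF sd])
    moreover have "form d w' = form w' d" "form d w = form w d" by (rule form_commute)+
    ultimately show ?thesis by simp
  qed
  have f2: "(LBINT x. (w' x)\<^sup>2) = (LBINT x. (w x)\<^sup>2) - 2 * (LBINT x. w x * d x) + (LBINT x. (d x)\<^sup>2)"
  proof -
    have eq: "w' x = w x - d x" for x by (simp add: d_def)
    show ?thesis unfolding eq by (rule integral_sq_diff[OF v(1) sd])
  qed
  have f3: "form w d = (LBINT x. d x * pot w x)"
    using form_pot(1)[OF sd v(1)] by (simp add: form_commute)
  \<comment> \<open>Where d is nonzero, w' is \<lambda> times the potential of w, so (w - \<lambda>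
    \<open>pot w\<close>) d = d^2 at every point. This makes the first-order terms of the energy
    difference outweigh the enstrophy of d.\<close>
  have f4: "(LBINT x. w x * d x) - lam * form w d = (LBINT x. (d x)\<^sup>2)"
  proof -
    have "(LBINT x. w x * d x) - lam * form w d = (LBINT x. w x * d x - lam * (d x * pot w x))"
      unfolding f3 using square_integrable_mult[OF v(1) sd] form_pot(2)[OF sd v(1)] by simp
    also have "\<dots> = (LBINT x. (d x)\<^sup>2)"
      by (intro lebesgue_integral_cong) (auto simp: d_def w'_def min_def power2_eq_square algebra_simps)
    finally show ?thesis .
  qed
  have d0: "0 \<le> d x" for x using w'b by (simp add: d_def)
  have "2 * (Elam lam w' - Elam lam w) = form d d + 1 / lam * (2 * ((LBINT x. w x * d x) - lam * form w d) - (LBINT x. (d x)\<^sup>2))"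
    unfolding Elam_def f2 f1 using assms(1) by (simp add: field_simps)
  also have "\<dots> = form d d + 1 / lam * (LBINT x. (d x)\<^sup>2)" unfolding f4 by simp
  also have "\<dots> \<ge> 0" using form_nonneg[of d d] d0 assms(1) by simp
  finally show "Elam lam w \<le> Elam lam w'" by simp
  \<comment> \<open>A row integral at height x2 is at most 2 x2, so weighting by w gives twice the
    impulse. Symmetry then moves w to the other variable, where the same double integral is the mass
    of the potential.\<close>
  have k: "integrable lborel2 (\<lambda>z. ker (fst z) (snd z) * w (fst z))"
    "(\<integral>z. ker (fst z) (snd z) * w (fst z) \<partial>lborel2) \<le> (LBINT x. 2 * (snd x * w x))"
  proof -
    have r: "(LBINT y. ker x y * w x) \<le> 2 * (snd x * w x)" for x
    proof (cases "x \<in> upper_half")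
      case True
      then have "(LBINT y. ker x y) \<le> 2 * snd x"
        using ker_row_height[of x] by (simp add: ker_sym[of _ x])
      then have "(LBINT y. ker x y) * w x \<le> 2 * snd x * w x" using v(2)[of x] by (rule mult_right_mono)
      then show ?thesis by simp
    qed (simp add: v(3))
    show "integrable lborel2 (\<lambda>z. ker (fst z) (snd z) * w (fst z))"
      using ker_nonneg v(2,4) ker_row(1) r by (intro integrable_row_bound(1)[where a = "\<lambda>x. 2 * (snd x * w x)"]) auto
    show "(\<integral>z. ker (fst z) (snd z) * w (fst z) \<partial>lborel2) \<le> (LBINT x. 2 * (snd x * w x))"
      using ker_nonneg v(2,4) ker_row(1) r by (intro integrable_row_bound(2)) auto
  qed
  have sw1: "integrable lborel2 (\<lambda>z. ker (fst z) (snd z) * w (snd z))"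
    using lborel_pair.integrable_product_swap[OF k(1)] by (simp add: case_prod_unfold ker_sym)
  have sw2: "(\<integral>z. ker (fst z) (snd z) * w (snd z) \<partial>lborel2) = (\<integral>z. ker (fst z) (snd z) * w (fst z) \<partial>lborel2)"
    using lborel_pair.integral_product_swap[OF borel_measurable_integrable[OF k(1)]] by (simp add: case_prod_unfold ker_sym)
  have pi: "integrable lborel (pot w)"
    using lborel_pair.integrable_fst'[OF sw1] by (simp add: pot_def[abs_def])
  have "(LBINT x. pot w x) = (\<integral>z. ker (fst z) (snd z) * w (snd z) \<partial>lborel2)"
    using lborel_pair.integral_fst'[OF sw1] by (simp add: pot_def)
  then have pm: "(LBINT x. pot w x) \<le> 2 * imp w"
    using k(2) sw2 by (simp add: imp_def)
  show i: "integrable lborel w'"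
    using w'b by (intro integrable_dominated[OF integrable_mult_right[OF pi, of lam]]) (auto intro: order_trans[OF _ abs_ge_self])
  have "(LBINT x. w' x) \<le> (LBINT x. lam * pot w x)"
    using w'b(3) pi by (intro integral_mono i) auto
  also have "\<dots> \<le> lam * (2 * imp w)" using pm assms(1) by simp
  finally show "(LBINT x. w' x) \<le> 2 * lam * imp w" by simp
qed

text \<open>Truncating a near-optimizer of impulse one does not lower its energy but may lose
  impulse. Since \<theta> \<ge> 1/4, the sharp inequality forces more than half of the impulse to
  remain, so the rescaling factor lies between \<mu> and 2\<mu>: the mass is at most 2\<mu> times
  2\<lambda>, and the energy is multiplied by at least \<mu>^2.\<close>

lemma near_optimal_of_small_mass:
  assumes "lam > 1" "\<mu> > 0" "1 / 4 \<le> \<theta>" "\<theta> < 1"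
  obtains w where "vort w" "imp w = \<mu>" "integrable lborel w" "(LBINT x. w x) \<le> 4 * lam * \<mu>"
    "\<theta> * kappa lam * \<mu>\<^sup>2 \<le> Elam lam w"
proof -
  have \<kappa>: "kappa lam > 0" by (rule kappa_pos[OF assms(1)])
  have "\<theta> * kappa lam < kappa lam" using assms \<kappa> by simp
  moreover have "{w. vort w \<and> imp w = 1} \<noteq> {}"
  proof -
    let ?Q = "indicator ({0..1} \<times> {1..2}) :: real \<times> real \<Rightarrow> real"
    have v: "vort ?Q"
    proof (rule vort_indicator[where K = 2])
      show "emeasure lborel ({0..1} \<times> {1..2} :: (real \<times> real) set) < \<infinity>"
        by (subst emeasure_Times_lborel) auto
    qed (auto simp: upper_half_def intro!: borel_closed closed_Times)
    have "imp ?Q \<ge> (LBINT x. ?Q x)"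
      unfolding imp_def
    proof (rule integral_mono[OF _ vortD(4)[OF v]])
      show "integrable lborel ?Q"
        by (subst integrable_indicator_iff) (auto simp: emeasure_Times_lborel intro!: borel_closed closed_Times)
    qed (auto simp: indicator_def)
    also have "(LBINT x. ?Q x) = (1 :: real)"
      by (simp add: measure_def emeasure_Times_lborel)
    finally have "imp ?Q > 0" by simp
    then show ?thesis
      using vort_scale(1,2)[OF v, of "1 / imp ?Q"] by auto
  qed
  ultimately obtain w where w: "vort w" "imp w = 1" "\<theta> * kappa lam < Elam lam w"
    using less_cSupD[of "Elam lam ` {w. vort w \<and> imp w = 1}" "\<theta> * kappa lam"] unfolding kappa_def by auto
  define w' where "w' = (\<lambda>x. min (w x) (lam * pot w x))"
  have "lam > 0" using assms by simp
  note t = truncation[OF this w(1), folded w'_def]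
  have "\<theta> * kappa lam < kappa lam * (imp w')\<^sup>2"
    using w(3) t(2) Elam_le_kappa[OF \<open>lam > 0\<close> t(1)] by linarith
  then have "\<theta> < (imp w')\<^sup>2" using \<kappa> by (simp add: mult.commute)
  then have "(1 / 2)\<^sup>2 < (imp w')\<^sup>2" using assms(3) by (simp add: power2_eq_square)
  then have h: "imp w' > 1 / 2" by (rule power_less_imp_less_base) (rule imp_nonneg[OF t(1)])
  have h1: "imp w' \<le> 1" using t(3) w(2) by simp
  define c where "c = \<mu> / imp w'"
  have c: "c \<ge> \<mu>" "c \<le> 2 * \<mu>" "c \<ge> 0" using h h1 assms(2) by (auto simp: c_def field_simps)
  note s = vort_scale[OF t(1) c(3)]
  show ?thesis
  proof (rule that[OF s(1)])
    show "imp (\<lambda>x. c * w' x) = \<mu>" using s(2) h by (simp add: c_def)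
    show "integrable lborel (\<lambda>x. c * w' x)" using t(4) by simp
    have "0 \<le> (LBINT x. w' x)" using vortD(2)[OF t(1)] by (intro integral_nonneg_AE AE_I2)
    moreover have "(LBINT x. w' x) \<le> 2 * lam" using t(5) w(2) by simp
    moreover have "0 \<le> 2 * \<mu>" using assms(2) by simp
    ultimately have "c * (LBINT x. w' x) \<le> 2 * \<mu> * (2 * lam)"
      using mult_mono[OF c(2)] by blast
    then show "(LBINT x. c * w' x) \<le> 4 * lam * \<mu>" by (simp add: mult_ac)
    have e: "\<theta> * kappa lam \<le> Elam lam w'" using w(3) t(2) by linarith
    have "0 \<le> \<theta> * kappa lam" using assms(3) \<kappa> by simp
    with e have e0: "0 \<le> Elam lam w'" by linarith
    have "\<mu>\<^sup>2 \<le> c\<^sup>2" using c(1) assms(2) by (intro power_mono) auto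
    from mult_mono[OF e this e0 zero_le_power2]
    have "\<theta> * kappa lam * \<mu>\<^sup>2 \<le> Elam lam w' * c\<^sup>2" .
    then show "\<theta> * kappa lam * \<mu>\<^sup>2 \<le> Elam lam (\<lambda>x. c * w' x)" using s(3) by (simp add: mult.commute)
  qed
qed

section \<open>Concentration\<close>

lemma gam_row_sq: "(LBINT y. (gam (x - y))\<^sup>2) = (LBINT z. (gam z)\<^sup>2)"
proof -
  have "(LBINT y. (gam (x - y))\<^sup>2) = (LBINT y. (\<lambda>z. (gam z)\<^sup>2) (y + - x))"
    using gam_uminus[of "x - _"] by (intro lebesgue_integral_cong) auto
  also have "\<dots> = (LBINT z. (gam z)\<^sup>2)"
    by (rule integral_lborel_shift) measurable
  finally show ?thesis .
qed

text \<open>The rows of the kernel are bounded in L^2 uniformly in x. For sequences bounded in L^2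
  this supplies the domination in \<open>form_local_convergence\<close>.\<close>

lemma pot_bound:
  assumes "L2 v"
  shows "\<bar>pot v x\<bar> \<le> sqrt (LBINT z. (gam z)\<^sup>2) * sqrt (LBINT x. (v x)\<^sup>2)"
proof -
  have "(LBINT y. (ker x y)\<^sup>2) \<le> (LBINT y. (gam (x - y))\<^sup>2)"
    using ker_nonneg ker_le_gam
    by (intro integral_mono square_integrable_sq ker_row(3) gam_translate_sq power_mono)
  then have "sqrt (LBINT y. (ker x y)\<^sup>2) * sqrt (LBINT x. (v x)\<^sup>2)
     \<le> sqrt (LBINT z. (gam z)\<^sup>2) * sqrt (LBINT x. (v x)\<^sup>2)"
    unfolding gam_row_sq by (intro mult_right_mono) auto
  with Cauchy_Schwarz_integral[OF ker_row(3) assms, of x] show ?thesis by (simp add: pot_def)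
qed

text \<open>\<open>gam\<close> is radial, and \<open>gam (r, 0)\<close> stands for its value at
  radius r.\<close>

lemma gam_le_axis: "0 < r \<Longrightarrow> r \<le> norm z \<Longrightarrow> gam z \<le> gam (r, 0)"
  by (intro gam_antimono) (simp_all add: norm_Pair)

lemma gam_axis_le: "0 < r \<Longrightarrow> gam (r, 0) \<le> 1 / r"
proof -
  assume r: "0 < r"
  have "gam (r, 0) = 1 / (2 * pi) * besselK0 r" using r by (simp add: gam_def norm_Pair)
  also have "\<dots> \<le> 1 / (2 * pi) * (2 / r)" using besselK0_le[OF r] by (intro mult_left_mono) auto
  also have "\<dots> = 1 / pi * (1 / r)" by simp
  also have "\<dots> \<le> 1 * (1 / r)" using pi_gt3 r by (intro mult_right_mono) auto
  finally show ?thesis by simp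
qed

text \<open>By contradiction: if every box has mass below \<epsilon>, the potential is at most 5a
  everywhere, and integrating it against w gives at most 5a\<nu> = \<eta>/2. The five shares of a
  are the squared kernel and the enstrophy near x, the box, the points above height R (paid for by
  the impulse), and the points far to the side (paid for by the decay of the kernel and the
  mass).\<close>

lemma nonvanishing:
  assumes "\<eta> > 0" "\<nu> > 0" "M \<ge> 0"
  obtains R \<epsilon> where "R > 0" "\<epsilon> > 0"
    "\<And>w. vort w \<Longrightarrow> integrable lborel w \<Longrightarrow> (LBINT x. w x) \<le> \<nu> \<Longrightarrow> (LBINT x. (w x)\<^sup>2) \<le> C\<^sup>2
      \<Longrightarrow> imp w \<le> M \<Longrightarrow> \<eta> \<le> form w w
      \<Longrightarrow> \<exists>c. \<epsilon> \<le> (LBINT x. indicator ({c - R..c + R} \<times> {0..R}) x * w x)"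
proof -
  define a where "a = \<eta> / (10 * \<nu>)"
  have a: "a > 0" using assms by (simp add: a_def)
  \<comment> \<open>Adding 1 keeps the divisor positive when C = 0. The number s is the weight in
    Young's inequality, where the product of \<open>gam\<close> and w is at most
    \<open>gam\<close>^2/(2s) + s w^2/2, and makes the enstrophy share at most a.\<close>
  define q where "q = C\<^sup>2 + 1"
  define s where "s = 2 * a / q"
  have q: "q > 0" "C\<^sup>2 \<le> q" by (simp_all add: q_def add_nonneg_pos)
  have s: "s > 0" using a q by (simp add: s_def)
  have "a * C\<^sup>2 \<le> a * q" using a q by (intro mult_left_mono) auto
  then have "a * C\<^sup>2 / q \<le> a" by (simp only: pos_divide_le_eq[OF q(1)])
  then have sC: "s / 2 * C\<^sup>2 \<le> a" by (simp add: s_def)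
  obtain \<delta> where \<delta>: "\<delta> > 0" "(LBINT z. (gam z)\<^sup>2 * indicator (ball 0 \<delta>) z) < 2 * s * a"
    using gam_ball_small[of "\<lambda>t. t\<^sup>2" "2 * s * a"] gam_sq_integrable s a by auto
  define g where "g = gam (\<delta>, 0)"
  have g: "g \<ge> 0" by (simp add: g_def gam_nonneg)
  \<comment> \<open>The quotient makes both g M/R, the share of the high points, and \<nu>/R at most
    a; the latter suffices for the far points because \<open>gam\<close> at radius R is at most
    1/R.\<close>
  define R where "R = \<delta> + (g * M + \<nu>) / a"
  have R: "R > 0" using \<delta> g assms a by (simp add: R_def add_pos_nonneg)
  have "a * ((g * M + \<nu>) / a) = g * M + \<nu>" "0 \<le> a * \<delta>" using a \<delta> by simp_all
  then have aR: "g * M + \<nu> \<le> a * R" unfolding R_def distrib_left by linarith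
  have gM: "g / R * M \<le> a" using aR R assms(2) by (simp add: pos_divide_le_eq)
  have gN: "gam (R, 0) * \<nu> \<le> a"
  proof -
    have "gam (R, 0) * \<nu> \<le> 1 / R * \<nu>" using gam_axis_le[OF R] assms by (intro mult_right_mono) auto
    also have "0 \<le> g * M" using g assms by simp
    then have "1 / R * \<nu> \<le> a" using aR R by (simp add: pos_divide_le_eq)
    finally show ?thesis .
  qed
  \<comment> \<open>Dividing by g + 1 is safe although g is only known to be nonnegative.\<close>
  define \<epsilon> where "\<epsilon> = a / (g + 1)"
  have \<epsilon>: "\<epsilon> > 0" using a g by (simp add: \<epsilon>_def)
  have "a * g \<le> a * (g + 1)" using a by (intro mult_left_mono) auto
  then have ge: "g * \<epsilon> \<le> a" using g by (simp add: \<epsilon>_def pos_divide_le_eq mult.commute)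
  show ?thesis
  proof (rule that[OF R \<epsilon>])
    fix w assume w: "vort w" "integrable lborel w" "(LBINT x. w x) \<le> \<nu>" "(LBINT x. (w x)\<^sup>2) \<le> C\<^sup>2"
      "imp w \<le> M" "\<eta> \<le> form w w"
    note v = vortD[OF w(1)]
    note [measurable] = v(5)
    show "\<exists>c. \<epsilon> \<le> (LBINT x. indicator ({c - R..c + R} \<times> {0..R}) x * w x)"
    proof (rule ccontr)
      define S where "S c = {c - R..c + R} \<times> {0..R}" for c
      assume "\<nexists>c. \<epsilon> \<le> (LBINT x. indicator ({c - R..c + R} \<times> {0..R}) x * w x)"
      then have small: "(LBINT x. indicator (S c) x * w x) < \<epsilon>" for c by (auto simp: S_def not_le)
      have [measurable]: "S c \<in> sets borel" for c unfolding S_def by (intro borel_closed closed_Times closed_atLeastAtMost)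
      have pb: "pot w x \<le> 5 * a" for x
      proof -
        let ?n = "\<lambda>y. (gam (x - y))\<^sup>2 * indicator (ball x \<delta>) y"
        let ?h = "\<lambda>y. 1 / (2 * s) * (?n y) + s / 2 * (w y)\<^sup>2
          + g * (indicator (S (fst x)) y * w y) + g / R * (snd y * w y) + gam (R, 0) * w y"
        have i1: "integrable lborel (?n)"
          by (intro integrable_dominated[OF square_integrable_sq[OF gam_translate_sq[of x]]]) (auto simp: indicator_def)
        have i2: "integrable lborel (\<lambda>y. indicator (S (fst x)) y * w y)"
          by (intro integrable_dominated[OF w(2)]) (auto simp: indicator_def)
        have ptw: "ker x y * w y \<le> ?h y" for y
        proof -
          have n1: "0 \<le> 1 / (2 * s) * (?n y)" using s by simp
          have n2: "0 \<le> s / 2 * (w y)\<^sup>2" using s by simp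
          have n3: "0 \<le> g * (indicator (S (fst x)) y * w y)" using g v(2) by simp
          have n4: "0 \<le> g / R * (snd y * w y)" using g R v(6)[of y] by simp
          have n5: "0 \<le> gam (R, 0) * w y" using gam_nonneg v(2) by simp
          have kg: "ker x y * w y \<le> gam (x - y) * w y" using ker_le_gam v(2) by (intro mult_right_mono)
          show ?thesis
          proof (cases "dist x y < \<delta>")
            case True
            have "0 \<le> (gam (x - y) - s * w y)\<^sup>2 / (2 * s)" using s by simp
            also have "\<dots> = 1 / (2 * s) * (gam (x - y))\<^sup>2 + s / 2 * (w y)\<^sup>2 - gam (x - y) * w y"
              using s by (simp add: power2_eq_square field_simps)
            finally show ?thesis using kg n3 n4 n5 True by simp
          next
            case False
            then have far: "gam (x - y) \<le> g" unfolding g_def using \<delta> by (intro gam_le_axis) (auto simp: dist_norm)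
            \<comment> \<open>Points below the axis fall under the first case, since w vanishes off
              the half-plane.\<close>
            consider "w y = 0" | "y \<in> S (fst x)" | "snd y > R" | "\<bar>fst x - fst y\<bar> > R"
              using v(3)[of y] by (cases y) (fastforce simp: S_def upper_half_def)
            then show ?thesis
            proof cases
              case 1 then show ?thesis using n1 by simp
            next
              case 2
              then have "gam (x - y) * w y \<le> g * (indicator (S (fst x)) y * w y)"
                using far v(2)[of y] by (simp add: mult_right_mono)
              then show ?thesis using kg n1 n2 n4 n5 by linarith
            next
              case 3
              have "gam (x - y) * w y \<le> g * w y" using far v(2) by (intro mult_right_mono)
              also have "\<dots> = g / R * (R * w y)" using R by simp
              also have "\<dots> \<le> g / R * (snd y * w y)" using 3 g R v(2) by (intro mult_left_mono mult_right_mono) auto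
              finally show ?thesis using kg n1 n2 n3 n5 by linarith
            next
              case 4
              then have "gam (x - y) \<le> gam (R, 0)"
                using R abs_fst_le_norm[of "x - y"] by (intro gam_le_axis) auto
              then have "gam (x - y) * w y \<le> gam (R, 0) * w y" using v(2) by (intro mult_right_mono)
              then show ?thesis using kg n1 n2 n3 n4 by linarith
            qed
          qed
        qed
        have "pot w x \<le> (LBINT y. ?h y)"
          unfolding pot_def using i1 i2 square_integrable_sq[OF v(1)] v(4) w(2) ptw
          by (intro integral_mono pot_row v(1) Bochner_Integration.integrable_add integrable_mult_right)
        also have "\<dots> = 1 / (2 * s) * (LBINT y. ?n y) + s / 2 * (LBINT y. (w y)\<^sup>2)
          + g * (LBINT y. indicator (S (fst x)) y * w y) + g / R * imp w + gam (R, 0) * (LBINT y. w y)"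
          using i1 i2 square_integrable_sq[OF v(1)] v(4) w(2) by (simp add: imp_def)
        also have "\<dots> \<le> a + a + a + a + a"
        proof (intro add_mono)
          have "1 / (2 * s) * (LBINT y. ?n y) \<le> 1 / (2 * s) * (2 * s * a)"
            using gam_ball_integral_translate[of "\<lambda>t. t\<^sup>2" x \<delta>] \<delta> s by (intro mult_left_mono) auto
          then show "1 / (2 * s) * (LBINT y. ?n y) \<le> a" using s by simp
          have "s / 2 * (LBINT y. (w y)\<^sup>2) \<le> s / 2 * C\<^sup>2" using w(4) s by (intro mult_left_mono) auto
          then show "s / 2 * (LBINT y. (w y)\<^sup>2) \<le> a" using sC by linarith
          have "g * (LBINT y. indicator (S (fst x)) y * w y) \<le> g * \<epsilon>"
            using small[of "fst x"] g by (intro mult_left_mono) auto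
          then show "g * (LBINT y. indicator (S (fst x)) y * w y) \<le> a" using ge by linarith
          have "g / R * imp w \<le> g / R * M" using w(5) g R by (intro mult_left_mono) auto
          then show "g / R * imp w \<le> a" using gM by linarith
          have "gam (R, 0) * (LBINT y. w y) \<le> gam (R, 0) * \<nu>" using w(3) gam_nonneg by (intro mult_left_mono)
          then show "gam (R, 0) * (LBINT y. w y) \<le> a" using gN by linarith
        qed
        finally show ?thesis by simp
      qed
      have "form w w = (LBINT x. w x * pot w x)" by (rule form_pot(1)[OF v(1) v(1)])
      also have "\<dots> \<le> (LBINT x. w x * (5 * a))"
        using w(2) pb v(2) by (intro integral_mono form_pot(2) v(1) mult_left_mono) auto
      also have "\<dots> = (LBINT x. w x) * (5 * a)" by simp
      also have "\<dots> \<le> \<nu> * (5 * a)" using w(3) a by (intro mult_right_mono) auto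
      also have "\<dots> = \<eta> / 2" using assms by (simp add: a_def)
      finally show False using w(6) assms(1) by simp
    qed
  qed
qed

section \<open>Invariance under horizontal translations\<close>

lemma shift1_eq: "shift1 w c = (\<lambda>x. w (x + (c, 0)))"
  by (simp add: shift1_def fun_eq_iff)

lemma ker_shift: "ker (x + (c, 0)) (y + (c, 0)) = ker x y"
proof -
  have 1: "x + (c, 0) - (y + (c, 0)) = x - y" by simp
  have 2: "x + (c, 0) - reflect (y + (c, 0)) = x - reflect y"
    by (simp add: reflect_def prod_eq_iff)
  show ?thesis unfolding ker_def GreenPi_gam 1 2 by (simp add: indicator_def upper_half_def)
qed

lemma shift1_invariant:
  assumes "vort w"
  shows "vort (shift1 w c)" "imp (shift1 w c) = imp w" "Elam lam (shift1 w c) = Elam lam w"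
    "(LBINT x. (shift1 w c x)\<^sup>2) = (LBINT x. (w x)\<^sup>2)"
proof -
  note v = vortD[OF assms]
  note [measurable] = v(5) pot_measurable[OF v(5)]
  have sh: "(\<lambda>x. x + (c, 0)) \<in> borel \<rightarrow>\<^sub>M (borel :: (real \<times> real) measure)"
    by (intro borel_measurable_continuous_onI continuous_intros)
  have i: "integrable lborel (\<lambda>x. snd x * shift1 w c x)"
    using integrable_lborel_shift[OF v(4), of "(c, 0)"] by (simp add: shift1_eq)
  have sq: "L2 (shift1 w c)"
    unfolding square_integrable_def shift1_eq
    using measurable_compose[OF sh v(5)] integrable_lborel_shift[OF square_integrable_sq[OF v(1)], of "(c, 0)"] by simp
  show "vort (shift1 w c)"
    unfolding vort_def
  proof (intro conjI allI impI sq i)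
    show "0 \<le> shift1 w c x" for x using v(2) by (simp add: shift1_def)
    show "shift1 w c x = 0" if "x \<notin> upper_half" for x
      using v(3)[of "(fst x + c, snd x)"] that by (simp add: shift1_def upper_half_def)
  qed
  have "(\<lambda>x. snd x * w x) \<in> borel_measurable borel" by measurable
  from integral_lborel_shift[OF this, of "(c, 0)"]
  show "imp (shift1 w c) = imp w" by (simp add: imp_def shift1_eq)
  have "(\<lambda>x. (w x)\<^sup>2) \<in> borel_measurable borel" by measurable
  from integral_lborel_shift[OF this, of "(c, 0)"]
  show e: "(LBINT x. (shift1 w c x)\<^sup>2) = (LBINT x. (w x)\<^sup>2)" by (simp add: shift1_eq)
  have p: "pot (shift1 w c) x = pot w (x + (c, 0))" for x
  proof -
    have "pot (shift1 w c) x = (LBINT y. (\<lambda>y. ker (x + (c, 0)) y * w y) (y + (c, 0)))"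
      by (simp add: pot_def shift1_eq ker_shift)
    also have "\<dots> = pot w (x + (c, 0))"
      unfolding pot_def by (rule integral_lborel_shift) measurable
    finally show ?thesis .
  qed
  have "form (shift1 w c) (shift1 w c) = (LBINT x. (\<lambda>x. w x * pot w x) (x + (c, 0)))"
    unfolding form_pot(1)[OF sq sq] p by (simp add: shift1_eq)
  also have "\<dots> = (LBINT x. w x * pot w x)"
    by (rule integral_lborel_shift) measurable
  also have "\<dots> = form w w" by (rule form_pot(1)[OF v(1) v(1), symmetric])
  finally show "Elam lam (shift1 w c) = Elam lam w" by (simp add: Elam_def e)
qed

text \<open>The rows of the kernel are L^2 test functions, so the potentials of the z n converge at
  every point, and they are uniformly bounded. On a set of finite measure dominated convergence
  turns this into strong L^2 convergence, which pairs with the weak convergence of the u n. Two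
  sequences are allowed because z is also taken to be the outer part of u.\<close>

lemma form_local_convergence:
  assumes u: "\<And>n. L2 (u n)" "\<And>n. (LBINT x. (u n x)\<^sup>2) \<le> C\<^sup>2"
    and z: "\<And>n. L2 (z n)" "\<And>n. (LBINT x. (z n x)\<^sup>2) \<le> C\<^sup>2"
    and U: "L2 U" "weakly_converges lborel u U"
    and Z: "L2 Z" "weakly_converges lborel z Z"
    and C: "C \<ge> 0" and B: "B \<in> sets borel" "emeasure lborel B < \<infinity>"
  shows "(\<lambda>n. form (\<lambda>x. indicator B x * u n x) (z n)) \<longlonglongrightarrow> form (\<lambda>x. indicator B x * U x) Z"
proof -
  let ?d = "\<lambda>n x. indicator B x * (pot (z n) x - pot Z x)"
  define G where "G = sqrt (LBINT z. (gam z)\<^sup>2)"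
  define K where "K = G * C + G * sqrt (LBINT x. (Z x)\<^sup>2)"
  have G: "G \<ge> 0" by (simp add: G_def)
  have [measurable]: "B \<in> sets lborel" using B by simp
  have [measurable]: "pot (z n) \<in> borel_measurable borel" "pot Z \<in> borel_measurable borel" for n
    using square_integrableD[OF z(1)] square_integrableD[OF Z(1)] by (auto intro!: pot_measurable)
  have sB: "L2 (\<lambda>x. k * indicator B x)" for k
    using B by (intro square_integrable_cmult square_integrable_indicator) auto
  have "sqrt (LBINT x. (z n x)\<^sup>2) \<le> C" for n using z(2)[of n] C by (intro real_le_lsqrt) auto
  then have zb: "\<bar>pot (z n) x\<bar> \<le> G * C" for n x
    using pot_bound[OF z(1), of n x] G unfolding G_def[symmetric] by (meson mult_left_mono order_trans)
  have Zb: "\<bar>pot Z x\<bar> \<le> G * sqrt (LBINT x. (Z x)\<^sup>2)" for x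
    using pot_bound[OF Z(1), of x] by (simp add: G_def)
  have db: "\<bar>pot (z n) x - pot Z x\<bar> \<le> K" for n x
    using zb[of n x] Zb[of x] by (simp add: K_def)
  have sZ: "L2 (\<lambda>x. indicator B x * pot Z x)"
  proof (rule square_integrable_mono[OF sB[of "G * sqrt (LBINT x. (Z x)\<^sup>2)"]])
    show "\<bar>indicator B x * pot Z x\<bar> \<le> \<bar>G * sqrt (LBINT x. (Z x)\<^sup>2) * indicator B x\<bar>" for x
      using Zb[of x] by (auto simp: indicator_def)
  qed measurable
  have sd: "L2 (?d n)" for n
  proof (rule square_integrable_mono[OF sB[of K]])
    show "\<bar>?d n x\<bar> \<le> \<bar>K * indicator B x\<bar>" for x
      using db[of n x] by (auto simp: indicator_def)
  qed measurable
  have ptw: "(\<lambda>n. pot (z n) x) \<longlonglongrightarrow> pot Z x" for x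
  proof -
    have eq: "pot v x = (LBINT y. v y * ker x y)" for v by (simp add: pot_def mult.commute)
    show ?thesis unfolding eq using Z(2) ker_row(3)[of x] unfolding weakly_converges_def by blast
  qed
  have d0: "(\<lambda>n. LBINT x. (?d n x)\<^sup>2) \<longlonglongrightarrow> 0"
  proof (rule integral_tendsto_zero[OF _ square_integrable_sq[OF sB[of K]]])
    fix x
    have "(\<lambda>n. (?d n x)\<^sup>2) \<longlonglongrightarrow> (indicator B x * (pot Z x - pot Z x))\<^sup>2"
      by (intro tendsto_intros ptw)
    then show "(\<lambda>n. (?d n x)\<^sup>2) \<longlonglongrightarrow> 0" by simp
    show "\<bar>(?d n x)\<^sup>2\<bar> \<le> (K * indicator B x)\<^sup>2" for n
      using db[of n x] by (auto simp: indicator_def intro: power2_le_iff_abs_le[THEN iffD2] order_trans[OF abs_ge_zero])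
  qed measurable
  have eq: "form (\<lambda>x. indicator B x * u n x) (z n)
    = (LBINT x. u n x * (indicator B x * pot Z x)) + (LBINT x. u n x * (?d n x))" for n
  proof -
    have "form (\<lambda>x. indicator B x * u n x) (z n) = (LBINT x. indicator B x * u n x * pot (z n) x)"
      using u(1) z(1) B by (intro form_pot square_integrable_restrict) auto
    also have "\<dots> = (LBINT x. u n x * (indicator B x * pot Z x) + u n x * (?d n x))"
      by (intro lebesgue_integral_cong) (auto simp: algebra_simps)
    also have "\<dots> = (LBINT x. u n x * (indicator B x * pot Z x)) + (LBINT x. u n x * (?d n x))"
      by (intro Bochner_Integration.integral_add square_integrable_mult u(1) sZ sd)
    finally show ?thesis .
  qed
  have l1: "(\<lambda>n. LBINT x. u n x * (indicator B x * pot Z x)) \<longlonglongrightarrow> (LBINT x. U x * (indicator B x * pot Z x))"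
    using U(2) sZ unfolding weakly_converges_def by blast
  have l2: "(\<lambda>n. LBINT x. u n x * (?d n x)) \<longlonglongrightarrow> 0"
  proof (rule Lim_null_comparison)
    show "(\<lambda>n. C * sqrt (LBINT x. (?d n x)\<^sup>2)) \<longlonglongrightarrow> 0"
      using tendsto_mult_left[OF tendsto_real_sqrt[OF d0], of C] by simp
    show "\<forall>\<^sub>F n in sequentially. norm (LBINT x. u n x * (?d n x))
       \<le> C * sqrt (LBINT x. (?d n x)\<^sup>2)"
    proof (rule always_eventually, rule allI)
      fix n
      have "sqrt (LBINT x. (u n x)\<^sup>2) \<le> C" using u(2)[of n] C by (intro real_le_lsqrt) auto
      then have "sqrt (LBINT x. (u n x)\<^sup>2) * sqrt (LBINT x. (?d n x)\<^sup>2)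
        \<le> C * sqrt (LBINT x. (?d n x)\<^sup>2)" by (intro mult_right_mono) auto
      with Cauchy_Schwarz_integral[OF u(1)[of n] sd[of n]]
      show "norm (LBINT x. u n x * (?d n x))
       \<le> C * sqrt (LBINT x. (?d n x)\<^sup>2)" by simp
    qed
  qed
  have "form (\<lambda>x. indicator B x * U x) Z = (LBINT x. indicator B x * U x * pot Z x)"
    using U(1) Z(1) B by (intro form_pot square_integrable_restrict) auto
  also have "\<dots> = (LBINT x. U x * (indicator B x * pot Z x)) + 0"
    by (simp add: mult_ac)
  finally show ?thesis unfolding eq using tendsto_add[OF l1 l2] by simp
qed

section \<open>The weak limit of a maximizing sequence\<close>

lemma vort_AE_zero:
  assumes "vort w" "imp w = 0"
  shows "AE x in lborel. w x = 0"
proof -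
  note v = vortD[OF assms(1)]
  have "AE x in lborel. snd x * w x = 0"
    using assms(2) integral_nonneg_eq_0_iff_AE[OF v(4)] v(6) unfolding imp_def by simp
  then show ?thesis
  proof eventually_elim
    fix x assume "snd x * w x = 0"
    then show "w x = 0" using v(3)[of x] by (cases "x \<in> upper_half") (auto simp: upper_half_def)
  qed
qed

lemma ball_finite: "emeasure lborel (ball (0 :: real \<times> real) r) < \<infinity>"
  using emeasure_lborel_ball_finite[of 0 r] by simp

lemma indicator_ball_tendsto: "(\<lambda>j. indicator (ball 0 (real j)) x * t) \<longlonglongrightarrow> (t :: real)" for x :: "real \<times> real"
proof -
  obtain j0 :: nat where "norm x < real j0" using reals_Archimedean2 by blast
  then have "eventually (\<lambda>j. indicator (ball 0 (real j)) x * t = t) sequentially"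
    unfolding eventually_sequentially by (intro exI[of _ j0]) (auto simp: indicator_def)
  then show ?thesis by (rule tendsto_eventually)
qed

lemma indicator_ball_incseq: "0 \<le> t \<Longrightarrow> incseq (\<lambda>j. indicator (ball 0 (real j)) x * (t :: real))" for x :: "real \<times> real"
  by (intro incseq_SucI mult_right_mono) (auto simp: indicator_def)

lemma square_integrable_ball_snd: "L2 (\<lambda>x. indicator (ball (0 :: real \<times> real) r) x * snd x)"
proof (rule square_integrable_mono)
  show "L2 (\<lambda>x. r * indicator (ball (0 :: real \<times> real) r) x)"
    using ball_finite by (intro square_integrable_cmult square_integrable_indicator) auto
  show "\<bar>indicator (ball 0 r) x * snd x\<bar> \<le> \<bar>r * indicator (ball (0 :: real \<times> real) r) x\<bar>" for x :: "real \<times> real"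
    using abs_snd_le_norm[of x] by (auto simp: indicator_def)
  show "(\<lambda>x. indicator (ball (0 :: real \<times> real) r) x * snd x) \<in> borel_measurable lborel"
    using snd_borel_measurable by (intro borel_measurable_times borel_measurable_indicator) auto
qed

text \<open>Gathers what is known after translating and passing to a subsequence. The limit of the
  energies is expressed through \<open>kappa\<close>; \<open>nontrivial\<close> keeps a fixed amount
  of mass in a fixed set of finite measure, which excludes F = 0.\<close>

locale maximizing_weak_limit =
  fixes lam \<mu> \<nu> C :: real and u :: "nat \<Rightarrow> real \<times> real \<Rightarrow> real" and F :: "real \<times> real \<Rightarrow> real"
  assumes lam: "lam > 1" and \<mu>: "\<mu> > 0" and C: "C \<ge> 0"
    and u: "\<And>n. vort (u n)" "\<And>n. integrable lborel (u n)" "\<And>n. (LBINT x. u n x) \<le> \<nu>" "\<And>n. (LBINT x. (u n x)\<^sup>2) \<le> C\<^sup>2"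
    and imp_lim: "(\<lambda>n. imp (u n)) \<longlonglongrightarrow> \<mu>" and en_lim: "(\<lambda>n. Elam lam (u n)) \<longlonglongrightarrow> kappa lam * \<mu>\<^sup>2"
    and F: "L2 F" "\<And>x. 0 \<le> F x" "\<And>x. x \<notin> upper_half \<Longrightarrow> F x = 0"
    and weak: "weakly_converges lborel u F"
    and nontrivial: "\<exists>D \<epsilon>. D \<in> sets borel \<and> emeasure lborel D < \<infinity> \<and> \<epsilon> > 0 \<and> (\<forall>n. \<epsilon> \<le> (LBINT x. indicator D x * u n x))"
begin

abbreviation "ind j \<equiv> (indicator (ball 0 (real j)) :: real \<times> real \<Rightarrow> real)"
abbreviation "cind j \<equiv> (indicator (- ball 0 (real j)) :: real \<times> real \<Rightarrow> real)"

definition "I j = (LBINT x. ind j x * (snd x * F x))"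

lemma sqs: "L2 (u n)" using vortD(1)[OF u(1)] .

lemma weakD: "L2 g \<Longrightarrow> (\<lambda>n. LBINT x. u n x * g x) \<longlonglongrightarrow> (LBINT x. F x * g x)"
  using weak by (simp add: weakly_converges_def)

lemma sq_ind: "L2 f \<Longrightarrow> L2 (\<lambda>x. ind j x * f x)"
  by (rule square_integrable_restrict) auto

lemma sq_cind: "L2 f \<Longrightarrow> L2 (\<lambda>x. cind j x * f x)"
  by (rule square_integrable_restrict) auto

lemma snd_F_nonneg: "0 \<le> snd x * F x"
  using F(2)[of x] F(3)[of x] by (cases "x \<in> upper_half") (simp_all add: upper_half_def)

lemma local_imp: "(\<lambda>n. LBINT x. ind j x * (snd x * u n x)) \<longlonglongrightarrow> I j"
proof -
  have eq: "(LBINT x. f x * (ind j x * snd x)) = (LBINT x. ind j x * (snd x * f x))" for f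
    by (intro lebesgue_integral_cong) auto
  show ?thesis using weakD[OF square_integrable_ball_snd[of "real j"]] by (simp only: eq I_def)
qed

lemma local_imp_split:
  assumes "vort w"
  shows "vort (\<lambda>x. cind j x * w x)" "imp (\<lambda>x. cind j x * w x) = imp w - (LBINT x. ind j x * (snd x * w x))"
proof -
  note v = vortD[OF assms]
  have i: "integrable lborel (\<lambda>x. ind j x * (snd x * w x))"
    by (intro integrable_dominated[OF v(4)]) (use v(5) in \<open>auto simp: indicator_def\<close>)
  have eq: "snd x * (cind j x * w x) = snd x * w x - ind j x * (snd x * w x)" for x
    by (auto simp: indicator_def)
  show "vort (\<lambda>x. cind j x * w x)"
    unfolding vort_def eq using v(2,3,4) i sq_cind[OF v(1)] by (auto simp: indicator_def)
  show "imp (\<lambda>x. cind j x * w x) = imp w - (LBINT x. ind j x * (snd x * w x))"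
    unfolding imp_def eq by (rule Bochner_Integration.integral_diff[OF v(4) i])
qed

lemma local_imp_le: "vort w \<Longrightarrow> (LBINT x. ind j x * (snd x * w x)) \<le> imp w"
  using local_imp_split[of w j] imp_nonneg[of "\<lambda>x. cind j x * w x"] by simp

lemma I_le: "I j \<le> \<mu>"
  by (rule LIMSEQ_le[OF local_imp imp_lim]) (use local_imp_le[OF u(1)] in auto)

text \<open>The weight x2 is an L^2 test function only after restriction to a ball. On each ball the
  impulse passes to the limit and stays at most \<mu>; monotone convergence over growing balls then
  gives F a finite impulse, which at this stage may still be below \<mu>.\<close>

lemma vort_F: "vort F" and I_tendsto: "I \<longlonglongrightarrow> imp F" and imp_F_le: "imp F \<le> \<mu>"
proof -
  have i: "integrable lborel (\<lambda>x. ind j x * (snd x * F x))" for j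
    using square_integrable_mult[OF square_integrable_ball_snd[of "real j"] F(1)] by (simp add: mult.assoc)
  note * = integrable_monotone_bounded[OF i indicator_ball_incseq[OF snd_F_nonneg] indicator_ball_tendsto I_le[unfolded I_def]]
  show "vort F" unfolding vort_def using F *(1) by blast
  show "I \<longlonglongrightarrow> imp F" using *(2) unfolding I_def[abs_def] imp_def .
  show "imp F \<le> \<mu>" using *(3) unfolding imp_def .
qed

lemma integrable_F: "integrable lborel F" and mass_F_le: "(LBINT x. F x) \<le> \<nu>"
proof -
  have sq: "L2 (ind j)" for j
    using ball_finite by (intro square_integrable_indicator) auto
  have i: "integrable lborel (\<lambda>x. ind j x * F x)" for j
    using square_integrable_mult[OF sq F(1)] .
  have le: "(LBINT x. ind j x * F x) \<le> \<nu>" for j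
  proof -
    have "(\<lambda>n. LBINT x. u n x * ind j x) \<longlonglongrightarrow> (LBINT x. F x * ind j x)" by (rule weakD[OF sq])
    moreover have "(LBINT x. u n x * ind j x) \<le> \<nu>" for n
    proof -
      have "(LBINT x. u n x * ind j x) \<le> (LBINT x. u n x)"
        using square_integrable_mult[OF sqs sq] u(2) vortD(2)[OF u(1)]
        by (intro integral_mono) (auto simp: indicator_def)
      with u(3)[of n] show ?thesis by linarith
    qed
    ultimately have "(LBINT x. F x * ind j x) \<le> \<nu>" by (intro LIMSEQ_le_const2) auto
    then show ?thesis by (simp add: mult.commute)
  qed
  note * = integrable_monotone_bounded[OF i indicator_ball_incseq[OF F(2)] indicator_ball_tendsto le]
  show "integrable lborel F" "(LBINT x. F x) \<le> \<nu>" by (rule *)+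
qed

text \<open>With zero impulse F would vanish almost everywhere, but the indicator of D is an L^2
  test function and retains the mass \<epsilon> in the limit.\<close>

lemma imp_F_pos: "imp F > 0"
proof (rule ccontr)
  assume "\<not> imp F > 0"
  then have "imp F = 0" using imp_nonneg[OF vort_F] by simp
  then have z: "AE x in lborel. F x = 0" by (rule vort_AE_zero[OF vort_F])
  obtain D \<epsilon> where D: "D \<in> sets borel" "emeasure lborel D < \<infinity>" "\<epsilon> > 0" "\<And>n. \<epsilon> \<le> (LBINT x. indicator D x * u n x)"
    using nontrivial by blast
  have "(\<lambda>n. LBINT x. u n x * indicator D x) \<longlonglongrightarrow> (LBINT x. F x * indicator D x)"
    using D(1,2) by (intro weakD square_integrable_indicator) auto
  moreover have "\<epsilon> \<le> (LBINT x. u n x * indicator D x)" for n using D(4)[of n] by (simp add: mult.commute)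
  ultimately have "\<epsilon> \<le> (LBINT x. F x * indicator D x)" by (intro LIMSEQ_le_const) auto
  also have "\<dots> = 0" by (rule integral_eq_zero_AE) (use z in \<open>auto elim: eventually_mono\<close>)
  finally show False using D(3) by simp
qed

text \<open>The form without the interaction of the outer part with itself. Each remaining term has
  one argument supported in a ball, so \<open>form_local_convergence\<close> applies to it.\<close>

definition "near_energy j w = form (\<lambda>x. ind j x * w x) w + form (\<lambda>x. ind j x * w x) (\<lambda>x. cind j x * w x)" for w

lemma form_split:
  assumes "L2 w"
  shows "form w w = near_energy j w + form (\<lambda>x. cind j x * w x) (\<lambda>x. cind j x * w x)"
proof -
  have w: "w = (\<lambda>x. ind j x * w x + cind j x * w x)" by (auto simp: indicator_def fun_eq_iff)
  note s = sq_ind[OF assms, of j] sq_cind[OF assms, of j]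
  have "form w w = form (\<lambda>x. ind j x * w x) w + form (\<lambda>x. cind j x * w x) w"
    using form_add_left[OF s assms] by (simp add: w[symmetric])
  also have "form (\<lambda>x. cind j x * w x) w = form (\<lambda>x. cind j x * w x) (\<lambda>x. ind j x * w x) + form (\<lambda>x. cind j x * w x) (\<lambda>x. cind j x * w x)"
    using form_add_right[OF s s(2)] by (simp add: w[symmetric])
  also have "form (\<lambda>x. cind j x * w x) (\<lambda>x. ind j x * w x) = form (\<lambda>x. ind j x * w x) (\<lambda>x. cind j x * w x)"
    by (rule form_commute)
  finally show ?thesis by (simp add: near_energy_def)
qed

lemma near_energy_tendsto: "(\<lambda>n. near_energy j (u n)) \<longlonglongrightarrow> near_energy j F"
proof -
  have s: "L2 (\<lambda>x. cind j x * u n x)" for n by (rule sq_cind[OF sqs])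
  have b: "(LBINT x. (cind j x * u n x)\<^sup>2) \<le> C\<^sup>2" for n
  proof -
    have "(LBINT x. (cind j x * u n x)\<^sup>2) \<le> (LBINT x. (u n x)\<^sup>2)"
      by (intro integral_mono square_integrable_sq s sqs) (auto simp: indicator_def)
    with u(4)[of n] show ?thesis by linarith
  qed
  have wc: "weakly_converges lborel (\<lambda>n x. cind j x * u n x) (\<lambda>x. cind j x * F x)"
    unfolding weakly_converges_def
  proof (intro allI impI)
    fix g :: "real \<times> real \<Rightarrow> real" assume "L2 g"
    from weakD[OF sq_cind[OF this, of j]]
    show "(\<lambda>n. LBINT x. cind j x * u n x * g x) \<longlonglongrightarrow> (LBINT x. cind j x * F x * g x)"
      by (simp add: mult_ac)
  qed
  have B: "ball 0 (real j) \<in> sets (borel :: (real \<times> real) measure)" by auto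
  show ?thesis
    unfolding near_energy_def
    by (intro tendsto_add form_local_convergence[OF sqs u(4) sqs u(4) F(1) weak F(1) weak C B ball_finite]
        form_local_convergence[OF sqs u(4) s b F(1) weak sq_cind[OF F(1)] wc C B ball_finite])
qed

lemma near_energy_le: "near_energy j F \<le> form F F"
  using form_split[OF F(1), of j] form_nonneg[of "\<lambda>x. cind j x * F x" "\<lambda>x. cind j x * F x"] F(2) by simp

lemma sq_split:
  assumes "L2 w"
  shows "(LBINT x. (w x)\<^sup>2) = (LBINT x. (ind j x * w x)\<^sup>2) + (LBINT x. (cind j x * w x)\<^sup>2)"
proof -
  have "(LBINT x. (w x)\<^sup>2) = (LBINT x. (ind j x * w x)\<^sup>2 + (cind j x * w x)\<^sup>2)"
    by (intro lebesgue_integral_cong) (auto simp: indicator_def)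
  also have "\<dots> = (LBINT x. (ind j x * w x)\<^sup>2) + (LBINT x. (cind j x * w x)\<^sup>2)"
    by (intro Bochner_Integration.integral_add square_integrable_sq sq_ind sq_cind assms)
  finally show ?thesis .
qed

text \<open>The part of the vorticity outside the ball is estimated by the sharp constant and the part inside by weak
  convergence, for which the interaction energy is continuous and the enstrophy lower semicontinuous.\<close>

lemma energy_splitting: "kappa lam * \<mu>\<^sup>2 \<le> Elam lam F + kappa lam * (\<mu> - imp F)\<^sup>2"
proof -
  let ?q = "\<lambda>j. (LBINT x. (ind j x * F x)\<^sup>2)"
  have step: "kappa lam * \<mu>\<^sup>2 \<le> form F F / 2 - 1 / (2 * lam) * ?q j + kappa lam * (\<mu> - I j)\<^sup>2" for j
  proof -
    let ?a = "\<lambda>n. (LBINT x. u n x * (ind j x * F x))"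
    let ?J = "\<lambda>n. (LBINT x. ind j x * (snd x * u n x))"
    have qF: "(LBINT x. F x * (ind j x * F x)) = ?q j"
      by (intro lebesgue_integral_cong) (auto simp: indicator_def power2_eq_square)
    have le: "Elam lam (u n) \<le> near_energy j (u n) / 2 - 1 / (2 * lam) * (2 * ?a n - ?q j) + kappa lam * (imp (u n) - ?J n)\<^sup>2" for n
    proof -
      \<comment> \<open>This square bounds the inner enstrophy of u from below by an expression
        linear in u, which weak convergence takes to the inner enstrophy of F: lower
        semicontinuity.\<close>
      have "0 \<le> (LBINT x. (ind j x * u n x - ind j x * F x)\<^sup>2)" by simp
      also have "\<dots> = (LBINT x. (ind j x * u n x)\<^sup>2) - 2 * (LBINT x. ind j x * u n x * (ind j x * F x)) + ?q j"
        by (rule integral_sq_diff[OF sq_ind[OF sqs] sq_ind[OF F(1)]])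
      also have "(LBINT x. ind j x * u n x * (ind j x * F x)) = ?a n"
        by (intro lebesgue_integral_cong) (auto simp: indicator_def)
      finally have "1 / (2 * lam) * (2 * ?a n - ?q j) \<le> 1 / (2 * lam) * (LBINT x. (ind j x * u n x)\<^sup>2)"
        using lam by (intro mult_left_mono) auto
      moreover have "Elam lam (u n) = near_energy j (u n) / 2 - 1 / (2 * lam) * (LBINT x. (ind j x * u n x)\<^sup>2) + Elam lam (\<lambda>x. cind j x * u n x)"
        unfolding Elam_def form_split[OF sqs, of n j] sq_split[OF sqs, of n j] by (simp add: algebra_simps add_divide_distrib)
      moreover have "Elam lam (\<lambda>x. cind j x * u n x) \<le> kappa lam * (imp (u n) - ?J n)\<^sup>2"
        using Elam_le_kappa[OF _ local_imp_split(1)[OF u(1)], of lam j n] lam local_imp_split(2)[OF u(1), of j n] by simp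
      ultimately show ?thesis by linarith
    qed
    have "(\<lambda>n. near_energy j (u n) / 2 - 1 / (2 * lam) * (2 * ?a n - ?q j) + kappa lam * (imp (u n) - ?J n)\<^sup>2)
       \<longlonglongrightarrow> near_energy j F / 2 - 1 / (2 * lam) * (2 * ?q j - ?q j) + kappa lam * (\<mu> - I j)\<^sup>2"
      using weakD[OF sq_ind[OF F(1)], of j] unfolding qF
      by (intro tendsto_intros near_energy_tendsto imp_lim local_imp) auto
    from LIMSEQ_le[OF en_lim this] le
    have "kappa lam * \<mu>\<^sup>2 \<le> near_energy j F / 2 - 1 / (2 * lam) * (2 * ?q j - ?q j) + kappa lam * (\<mu> - I j)\<^sup>2" by blast
    with near_energy_le[of j] show ?thesis by simp
  qed
  have q: "?q \<longlonglongrightarrow> (LBINT x. (F x)\<^sup>2)"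
  proof -
    have eq: "(ind j x * F x)\<^sup>2 = ind j x * (F x)\<^sup>2" for j x by (auto simp: indicator_def)
    have i: "integrable lborel (\<lambda>x. ind j x * (F x)\<^sup>2)" for j
      using square_integrable_sq[OF sq_ind[OF F(1)], of j] by (simp only: eq)
    have le: "(LBINT x. ind j x * (F x)\<^sup>2) \<le> (LBINT x. (F x)\<^sup>2)" for j
      by (intro integral_mono i square_integrable_sq F) (auto simp: indicator_def)
    show ?thesis unfolding eq
      by (rule integrable_monotone_bounded(2)[OF i indicator_ball_incseq[OF zero_le_power2] indicator_ball_tendsto le])
  qed
  have "(\<lambda>j. form F F / 2 - 1 / (2 * lam) * ?q j + kappa lam * (\<mu> - I j)\<^sup>2)
     \<longlonglongrightarrow> form F F / 2 - 1 / (2 * lam) * (LBINT x. (F x)\<^sup>2) + kappa lam * (\<mu> - imp F)\<^sup>2"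
    by (intro tendsto_intros q I_tendsto)
  from LIMSEQ_le_const[OF this] step show ?thesis unfolding Elam_def by blast
qed

text \<open>The splitting inequality reduces to m (\<mu> - m) \<le> 0 for the impulse m of F, while
  0 < m \<le> \<mu>. Once nothing remains at infinity, it and the sharp inequality squeeze the
  energy of F.\<close>

lemma imp_F: "imp F = \<mu>" and Elam_F: "Elam lam F = kappa lam * \<mu>\<^sup>2"
proof -
  have k: "kappa lam > 0" by (rule kappa_pos[OF lam])
  have e: "Elam lam F \<le> kappa lam * (imp F)\<^sup>2" using lam by (intro Elam_le_kappa vort_F) auto
  with energy_splitting have "kappa lam * \<mu>\<^sup>2 \<le> kappa lam * ((imp F)\<^sup>2 + (\<mu> - imp F)\<^sup>2)"
    by (simp add: distrib_left)
  then have "\<mu>\<^sup>2 \<le> (imp F)\<^sup>2 + (\<mu> - imp F)\<^sup>2" using k by simp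
  then have "imp F * (\<mu> - imp F) \<le> 0" by (simp add: power2_eq_square algebra_simps)
  then have "\<mu> - imp F \<le> 0" using imp_F_pos by (simp add: mult_le_0_iff)
  then show m: "imp F = \<mu>" using imp_F_le by simp
  show "Elam lam F = kappa lam * \<mu>\<^sup>2" using e energy_splitting m by simp
qed

text \<open>The enstrophy is \<lambda> times the form minus twice \<open>Elam\<close>. The energies
  converge, and the form converges up to its outer part, which \<open>form_small\<close> makes small
  on the complement of a large ball because no impulse escapes. So the limiting norms do not exceed
  that of F, and weak convergence becomes strong.\<close>

lemma strong_L2: "(\<lambda>n. LBINT x. (u n x - F x)\<^sup>2) \<longlonglongrightarrow> 0"
proof (rule order_tendstoI)
  fix e :: real assume "e < 0"
  then show "\<forall>\<^sub>F n in sequentially. e < (LBINT x. (u n x - F x)\<^sup>2)"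
    by (intro always_eventually allI) (rule less_le_trans, auto)
next
  fix e :: real assume e: "e > 0"
  \<comment> \<open>Half of e pays for \<lambda> \<epsilon> C^2, the other half for the impulse
    outside the ball; C^2 + 1 is positive even for C = 0.\<close>
  define \<epsilon> where "\<epsilon> = e / (2 * lam * (C\<^sup>2 + 1))"
  have C1: "C\<^sup>2 + 1 > 0" by (simp add: add_nonneg_pos)
  have \<epsilon>: "\<epsilon> > 0" using e lam C1 by (simp add: \<epsilon>_def)
  have "lam * (\<epsilon> * C\<^sup>2) \<le> lam * (\<epsilon> * (C\<^sup>2 + 1))" using \<epsilon> lam by (intro mult_left_mono) auto
  also have "\<dots> = e / 2" using lam C1 by (simp add: \<epsilon>_def)
  finally have eC: "lam * (\<epsilon> * C\<^sup>2) \<le> e / 2" .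
  obtain K where K: "K \<ge> 0" "\<And>w. vort w \<Longrightarrow> form w w \<le> \<epsilon> * (LBINT x. (w x)\<^sup>2) + K * (imp w)\<^sup>2"
    using form_small[OF \<epsilon>] by blast
  have "(\<lambda>j. lam * (K * (\<mu> - I j)\<^sup>2)) \<longlonglongrightarrow> lam * (K * (\<mu> - imp F)\<^sup>2)"
    by (intro tendsto_intros I_tendsto)
  then have "(\<lambda>j. lam * (K * (\<mu> - I j)\<^sup>2)) \<longlonglongrightarrow> 0" by (simp add: imp_F)
  then have "eventually (\<lambda>j. lam * (K * (\<mu> - I j)\<^sup>2) < e / 2) sequentially" using e by (intro order_tendstoD) auto
  then obtain j where j: "lam * (K * (\<mu> - I j)\<^sup>2) < e / 2" by (auto simp: eventually_sequentially)
  let ?J = "\<lambda>n. (LBINT x. ind j x * (snd x * u n x))"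
  let ?b = "\<lambda>n. lam * (near_energy j (u n) + \<epsilon> * C\<^sup>2 + K * (imp (u n) - ?J n)\<^sup>2 - 2 * Elam lam (u n)) - 2 * (LBINT x. u n x * F x) + (LBINT x. (F x)\<^sup>2)"
  have le: "(LBINT x. (u n x - F x)\<^sup>2) \<le> ?b n" for n
  proof -
    have "(LBINT x. (cind j x * u n x)\<^sup>2) \<le> C\<^sup>2"
      using u(4)[of n] sq_split[OF sqs, of n j] by (smt (verit) integral_nonneg_AE AE_I2 zero_le_power2)
    then have "\<epsilon> * (LBINT x. (cind j x * u n x)\<^sup>2) \<le> \<epsilon> * C\<^sup>2" using \<epsilon> by (intro mult_left_mono) auto
    then have "form (\<lambda>x. cind j x * u n x) (\<lambda>x. cind j x * u n x) \<le> \<epsilon> * C\<^sup>2 + K * (imp (u n) - ?J n)\<^sup>2"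
      using K(2)[OF local_imp_split(1)[OF u(1)], of j n] local_imp_split(2)[OF u(1), of j n] by simp
    then have f: "form (u n) (u n) \<le> near_energy j (u n) + \<epsilon> * C\<^sup>2 + K * (imp (u n) - ?J n)\<^sup>2"
      using form_split[OF sqs, of n j] by linarith
    have "(LBINT x. (u n x)\<^sup>2) = lam * (form (u n) (u n) - 2 * Elam lam (u n))"
      using lam by (simp add: Elam_def field_simps)
    also have "\<dots> \<le> lam * (near_energy j (u n) + \<epsilon> * C\<^sup>2 + K * (imp (u n) - ?J n)\<^sup>2 - 2 * Elam lam (u n))"
      using f lam by (intro mult_left_mono) auto
    finally show ?thesis using integral_sq_diff[OF sqs F(1), of n] by linarith
  qed
  have FF: "(LBINT x. F x * F x) = (LBINT x. (F x)\<^sup>2)" by (simp add: power2_eq_square)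
  have lim: "?b \<longlonglongrightarrow> lam * (near_energy j F + \<epsilon> * C\<^sup>2 + K * (\<mu> - I j)\<^sup>2 - 2 * (kappa lam * \<mu>\<^sup>2)) - 2 * (LBINT x. (F x)\<^sup>2) + (LBINT x. (F x)\<^sup>2)"
    using weakD[OF F(1)] unfolding FF by (intro tendsto_intros near_energy_tendsto imp_lim local_imp en_lim) auto
  have "lam * (near_energy j F + \<epsilon> * C\<^sup>2 + K * (\<mu> - I j)\<^sup>2 - 2 * (kappa lam * \<mu>\<^sup>2))
     \<le> lam * (form F F - 2 * Elam lam F) + lam * (\<epsilon> * C\<^sup>2) + lam * (K * (\<mu> - I j)\<^sup>2)"
    using near_energy_le[of j] lam unfolding Elam_F distrib_left[symmetric] by (intro mult_left_mono) auto
  also have "lam * (form F F - 2 * Elam lam F) = (LBINT x. (F x)\<^sup>2)" using lam by (simp add: Elam_def field_simps)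
  finally have "lam * (near_energy j F + \<epsilon> * C\<^sup>2 + K * (\<mu> - I j)\<^sup>2 - 2 * (kappa lam * \<mu>\<^sup>2)) - 2 * (LBINT x. (F x)\<^sup>2) + (LBINT x. (F x)\<^sup>2) < e"
    using eC j by linarith
  from order_tendstoD(2)[OF lim this]
  show "\<forall>\<^sub>F n in sequentially. (LBINT x. (u n x - F x)\<^sup>2) < e"
    by (rule eventually_mono) (use le in \<open>rule le_less_trans\<close>)
qed

text \<open>Scheffe's argument: |p - q| is p - q plus twice the positive part of q - p. The first
  integral is a difference of impulses. The positive part is at most x2 |u - F| in the ball, where
  x2 is square integrable and L^2 convergence applies, and at most x2 F outside, where F has little
  impulse.\<close>

lemma strong_L1: "(\<lambda>n. LBINT x. \<bar>snd x * u n x - snd x * F x\<bar>) \<longlonglongrightarrow> 0"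
proof (rule order_tendstoI)
  fix e :: real assume "e < 0"
  then show "\<forall>\<^sub>F n in sequentially. e < (LBINT x. \<bar>snd x * u n x - snd x * F x\<bar>)"
    by (intro always_eventually allI) (rule less_le_trans, auto)
next
  fix e :: real assume e: "e > 0"
  note vF = vortD[OF vort_F]
  have "(\<lambda>j. 2 * (\<mu> - I j)) \<longlonglongrightarrow> 2 * (\<mu> - imp F)"
    by (intro tendsto_intros I_tendsto)
  then have "eventually (\<lambda>j. 2 * (\<mu> - I j) < e) sequentially" using e by (intro order_tendstoD) (auto simp: imp_F)
  then obtain j where j: "2 * (\<mu> - I j) < e" by (auto simp: eventually_sequentially)
  let ?s = "sqrt (LBINT x. (ind j x * snd x)\<^sup>2)"
  let ?b = "\<lambda>n. imp (u n) - imp F + 2 * (?s * sqrt (LBINT x. (u n x - F x)\<^sup>2) + (\<mu> - I j))"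
  have le: "(LBINT x. \<bar>snd x * u n x - snd x * F x\<bar>) \<le> ?b n" for n
  proof -
    note v = vortD[OF u(1)[of n]]
    have sd: "L2 (\<lambda>x. \<bar>u n x - F x\<bar>)"
    proof (rule square_integrable_mono[OF square_integrable_diff[OF v(1) vF(1)]])
      show "(\<lambda>x. \<bar>u n x - F x\<bar>) \<in> borel_measurable lborel"
        using v(5) vF(5) by measurable
    qed simp
    have i1: "integrable lborel (\<lambda>x. ind j x * snd x * \<bar>u n x - F x\<bar>)"
      by (rule square_integrable_mult[OF square_integrable_ball_snd sd])
    have i2: "integrable lborel (\<lambda>x. snd x * (cind j x * F x))"
      using vortD(4)[OF local_imp_split(1)[OF vort_F]] .
    have ptw: "\<bar>snd x * u n x - snd x * F x\<bar> \<le> snd x * u n x - snd x * F x + 2 * (ind j x * snd x * \<bar>u n x - F x\<bar> + snd x * (cind j x * F x))" for x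
    proof (cases "x \<in> upper_half")
      case True
      then have s: "snd x > 0" by (simp add: upper_half_def)
      have "\<bar>snd x * u n x - snd x * F x\<bar> = snd x * \<bar>u n x - F x\<bar>"
        using s by (simp add: abs_mult flip: right_diff_distrib)
      also have "\<dots> \<le> snd x * (u n x - F x + 2 * (ind j x * \<bar>u n x - F x\<bar> + cind j x * F x))"
        using s v(2)[of x] F(2)[of x] by (intro mult_left_mono) (auto simp: indicator_def)
      finally show ?thesis by (simp add: algebra_simps)
    qed (simp add: v(3) vF(3))
    have "(LBINT x. \<bar>snd x * u n x - snd x * F x\<bar>)
       \<le> (LBINT x. snd x * u n x - snd x * F x + 2 * (ind j x * snd x * \<bar>u n x - F x\<bar> + snd x * (cind j x * F x)))"
      using v(4) vF(4) i1 i2 ptw by (intro integral_mono) auto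
    also have "\<dots> = imp (u n) - imp F + 2 * ((LBINT x. ind j x * snd x * \<bar>u n x - F x\<bar>) + imp (\<lambda>x. cind j x * F x))"
      using v(4) vF(4) i1 i2 by (simp add: imp_def)
    also have "imp (\<lambda>x. cind j x * F x) = \<mu> - I j"
      using local_imp_split(2)[OF vort_F] by (simp add: imp_F I_def)
    also have "(LBINT x. ind j x * snd x * \<bar>u n x - F x\<bar>) \<le> ?s * sqrt (LBINT x. (u n x - F x)\<^sup>2)"
      using Cauchy_Schwarz_integral[OF square_integrable_ball_snd[of "real j"] sd] by simp
    finally show ?thesis by simp
  qed
  have lim: "?b \<longlonglongrightarrow> \<mu> - imp F + 2 * (?s * sqrt 0 + (\<mu> - I j))"
    by (intro tendsto_intros imp_lim strong_L2)
  have "\<mu> - imp F + 2 * (?s * sqrt 0 + (\<mu> - I j)) < e" using j by (simp add: imp_F)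
  from order_tendstoD(2)[OF lim this]
  show "\<forall>\<^sub>F n in sequentially. (LBINT x. \<bar>snd x * u n x - snd x * F x\<bar>) < e"
    by (rule eventually_mono) (use le in \<open>rule le_less_trans\<close>)
qed

end

section \<open>The variational problem\<close>

text \<open>Eventually the impulse is below \<mu> + 1 and the energy above \<kappa>\<mu>^2/2, so the
  form is at least \<kappa>\<mu>^2 and \<open>nonvanishing\<close> finds boxes of one size with mass
  at least \<epsilon>. Translating them all to the fixed box D keeps this mass visible to the weak
  limit.\<close>

lemma concentration_compactness:
  assumes lam: "lam > 1" and \<mu>: "\<mu> > 0" and \<nu>: "\<nu> > 0" and C: "C \<ge> 0"
    and w: "\<And>n. vort (w n)" "\<And>n. integrable lborel (w n)" "\<And>n. (LBINT x. w n x) \<le> \<nu>" "\<And>n. (LBINT x. (w n x)\<^sup>2) \<le> C\<^sup>2"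
    and imp_lim: "(\<lambda>n. imp (w n)) \<longlonglongrightarrow> \<mu>" and en_lim: "(\<lambda>n. Elam lam (w n)) \<longlonglongrightarrow> kappa lam * \<mu>\<^sup>2"
  obtains r c F where "strict_mono r" "maximizing_weak_limit lam \<mu> \<nu> C (\<lambda>n. shift1 (w (r n)) (c n)) F"
proof -
  have k: "kappa lam * \<mu>\<^sup>2 > 0" using kappa_pos[OF lam] \<mu> by simp
  obtain R \<epsilon> where R: "R > 0" "\<epsilon> > 0"
    "\<And>w. vort w \<Longrightarrow> integrable lborel w \<Longrightarrow> (LBINT x. w x) \<le> \<nu> \<Longrightarrow> (LBINT x. (w x)\<^sup>2) \<le> C\<^sup>2
      \<Longrightarrow> imp w \<le> \<mu> + 1 \<Longrightarrow> kappa lam * \<mu>\<^sup>2 \<le> form w w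
      \<Longrightarrow> \<exists>c. \<epsilon> \<le> (LBINT x. indicator ({c - R..c + R} \<times> {0..R}) x * w x)"
    using nonvanishing[OF k \<nu>, of "\<mu> + 1" C] \<mu> by (smt (verit))
  have "eventually (\<lambda>n. imp (w n) < \<mu> + 1) sequentially" using imp_lim by (rule order_tendstoD) simp
  moreover have "eventually (\<lambda>n. kappa lam * \<mu>\<^sup>2 / 2 < Elam lam (w n)) sequentially"
    using en_lim k by (intro order_tendstoD(1)) auto
  ultimately obtain N where N: "\<And>n. n \<ge> N \<Longrightarrow> imp (w n) < \<mu> + 1 \<and> kappa lam * \<mu>\<^sup>2 / 2 < Elam lam (w n)"
    using eventually_conj unfolding eventually_sequentially by (metis (mono_tags, lifting) le_trans nat_le_linear)
  define D where "D = {- R..R} \<times> {0..R}"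
  have Ds: "D \<in> sets borel" unfolding D_def by (intro borel_closed closed_Times closed_atLeastAtMost)
  have "\<exists>c. \<epsilon> \<le> (LBINT x. indicator D x * shift1 (w (n + N)) c x)" for n
  proof -
    let ?w = "w (n + N)"
    note [measurable] = vortD(5)[OF w(1)[of "n + N"]]
    have "0 \<le> (LBINT x. (?w x)\<^sup>2) / (2 * lam)" using lam by simp
    then have "kappa lam * \<mu>\<^sup>2 \<le> form ?w ?w" using N[of "n + N"] by (simp add: Elam_def)
    then obtain c where c: "\<epsilon> \<le> (LBINT x. indicator ({c - R..c + R} \<times> {0..R}) x * ?w x)"
      using R(3)[OF w, of "n + N"] N[of "n + N"] by auto
    have [measurable]: "{c - R..c + R} \<times> {0..R} \<in> sets borel" by (intro borel_closed closed_Times closed_atLeastAtMost)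
    have "(LBINT x. indicator D x * shift1 ?w c x) = (LBINT x. (\<lambda>x. indicator ({c - R..c + R} \<times> {0..R}) x * ?w x) (x + (c, 0)))"
      unfolding shift1_eq by (intro lebesgue_integral_cong) (auto simp: D_def indicator_def)
    also have "\<dots> = (LBINT x. indicator ({c - R..c + R} \<times> {0..R}) x * ?w x)"
      by (rule integral_lborel_shift) measurable
    finally have "\<epsilon> \<le> (LBINT x. indicator D x * shift1 ?w c x)" using c by (simp only:)
    then show ?thesis by (rule exI)
  qed
  then obtain c where c: "\<And>n. \<epsilon> \<le> (LBINT x. indicator D x * shift1 (w (n + N)) (c n) x)" by metis
  define v where "v n = shift1 (w (n + N)) (c n)" for n
  have v: "vort (v n)" "imp (v n) = imp (w (n + N))" "Elam lam (v n) = Elam lam (w (n + N))" "(LBINT x. (v n x)\<^sup>2) \<le> C\<^sup>2" for n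
    using w(4)[of "n + N"] unfolding v_def by (simp_all add: shift1_invariant[OF w(1)])
  have vi: "integrable lborel (v n)" for n
    unfolding v_def shift1_eq by (rule integrable_lborel_shift[OF w(2)])
  have vm: "(LBINT x. v n x) \<le> \<nu>" for n
    using w(3)[of "n + N"] integral_lborel_shift[OF vortD(5)[OF w(1)[of "n + N"]], of "(c n, 0)"] by (simp add: v_def shift1_eq)
  obtain F0 r where r: "strict_mono r" and F0: "L2 F0" "\<And>x. 0 \<le> F0 x" "weakly_converges lborel (\<lambda>n. v (r n)) F0"
    using weakly_compact_nonneg[of v C] vortD(1,2)[OF v(1)] C v(4) by metis
  \<comment> \<open>The translates vanish off the half-plane, so cutting off F0 there alters no
    limit of pairings and yields a limit that vanishes there at every point.\<close>
  define F where "F x = indicator upper_half x * F0 x" for x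
  have sF: "L2 F"
    unfolding F_def[abs_def] using F0(1) by (rule square_integrable_restrict) simp
  have wF: "weakly_converges lborel (\<lambda>n. v (r n)) F"
    unfolding weakly_converges_def
  proof (intro allI impI)
    fix g :: "real \<times> real \<Rightarrow> real" assume g: "L2 g"
    have "L2 (\<lambda>x. indicator upper_half x * g x)"
      using g by (rule square_integrable_restrict) simp
    then have "(\<lambda>n. LBINT x. v (r n) x * (indicator upper_half x * g x)) \<longlonglongrightarrow> (LBINT x. F0 x * (indicator upper_half x * g x))"
      using F0(3) by (simp add: weakly_converges_def)
    moreover have "v n x * (indicator upper_half x * g x) = v n x * g x" for n x
      using vortD(3)[OF v(1), of x n] by (cases "x \<in> upper_half") auto
    moreover have "F0 x * (indicator upper_half x * g x) = F x * g x" for x by (simp add: F_def)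
    ultimately show "(\<lambda>n. LBINT x. v (r n) x * g x) \<longlonglongrightarrow> (LBINT x. F x * g x)" by simp
  qed
  have mono: "strict_mono (\<lambda>n. r n + N)" using r by (simp add: strict_mono_def)
  have "maximizing_weak_limit lam \<mu> \<nu> C (\<lambda>n. shift1 (w (r n + N)) (c (r n))) F"
    unfolding v_def[symmetric]
  proof
    show "(\<lambda>n. imp (v (r n))) \<longlonglongrightarrow> \<mu>"
      using LIMSEQ_subseq_LIMSEQ[OF imp_lim mono] by (simp add: v(2) o_def)
    show "(\<lambda>n. Elam lam (v (r n))) \<longlonglongrightarrow> kappa lam * \<mu>\<^sup>2"
      using LIMSEQ_subseq_LIMSEQ[OF en_lim mono] by (simp add: v(3) o_def)
    show "\<exists>D \<epsilon>. D \<in> sets borel \<and> emeasure lborel D < \<infinity> \<and> \<epsilon> > 0 \<and> (\<forall>n. \<epsilon> \<le> (LBINT x. indicator D x * v (r n) x))"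
    proof (intro exI[of _ D] exI[of _ \<epsilon>] conjI allI)
      show "emeasure lborel D < \<infinity>"
        unfolding D_def using R(1) by (subst emeasure_Times_lborel) (auto simp flip: ennreal_mult)
      show "\<epsilon> \<le> (LBINT x. indicator D x * v (r n) x)" for n using c by (simp add: v_def)
    qed (use Ds R in auto)
  qed (use lam \<mu> C v vi vm sF wF F0 in \<open>auto simp: F_def\<close>)
  with mono show ?thesis by (rule that)
qed

text \<open>Selects a representative that is nonnegative and supported in the half-plane at every
  point, as \<open>vort\<close> demands; it agrees almost everywhere with the given vorticity in the
  half-plane.\<close>

definition clean :: "(real \<times> real \<Rightarrow> real) \<Rightarrow> real \<times> real \<Rightarrow> real" where
  "clean \<omega> x = max 0 (indicator upper_half x * \<omega> x)"

lemma clean_vort: "vort w \<Longrightarrow> clean w = w"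
  using vortD(2,3)[of w] by (auto simp: clean_def fun_eq_iff indicator_def)

locale vorticity =
  fixes \<omega> :: "real \<times> real \<Rightarrow> real"
  assumes L2: "in_L2 \<omega>" and nonneg: "nonneg_ae \<omega>"
begin

lemma restrict_measurable [measurable]: "(\<lambda>x. indicator upper_half x * \<omega> x) \<in> borel_measurable borel"
  using L2 by (simp add: in_L2_def)

lemma clean_measurable [measurable]: "clean \<omega> \<in> borel_measurable borel"
  unfolding clean_def[abs_def] by measurable

lemma AE_clean: "AE x in lborel. clean \<omega> x = indicator upper_half x * \<omega> x"
  using nonneg unfolding nonneg_ae_def by eventually_elim (auto simp: clean_def indicator_def)

lemma clean_sq: "L2 (clean \<omega>)" and sq_int_clean: "sq_int \<omega> = (LBINT x. (clean \<omega> x)\<^sup>2)"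
proof -
  have i: "integrable lborel (\<lambda>x. indicator upper_half x * (\<omega> x)\<^sup>2)"
    using L2 by (simp add: in_L2_def set_integrable_def)
  have ae: "AE x in lborel. (clean \<omega> x)\<^sup>2 = indicator upper_half x * (\<omega> x)\<^sup>2"
    using AE_clean by eventually_elim (auto simp: indicator_def)
  show "L2 (clean \<omega>)"
    unfolding square_integrable_def using integrable_cong_AE_imp[OF i _ AE_symmetric[OF ae]] by simp
  show "sq_int \<omega> = (LBINT x. (clean \<omega> x)\<^sup>2)"
    unfolding sq_int_def set_lebesgue_integral_def using ae i
    by (intro integral_cong_AE) (auto elim: eventually_mono)
qed

lemma nn_impulse_clean:
  "set_nn_integral lborel upper_half (\<lambda>x. ennreal (snd x * \<omega> x)) = (\<integral>\<^sup>+x. ennreal (snd x * clean \<omega> x) \<partial>lborel)"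
  by (intro nn_integral_cong_AE) (use AE_clean in eventually_elim, auto simp: indicator_def)

lemma nn_mass_clean:
  "set_nn_integral lborel upper_half (\<lambda>x. ennreal (\<omega> x)) = (\<integral>\<^sup>+x. ennreal (clean \<omega> x) \<partial>lborel)"
  by (intro nn_integral_cong_AE) (use AE_clean in eventually_elim, auto simp: indicator_def)

lemma snd_clean_nonneg: "0 \<le> snd x * clean \<omega> x"
  by (auto simp: clean_def indicator_def upper_half_def)

lemma vort_clean:
  assumes "set_nn_integral lborel upper_half (\<lambda>x. ennreal (snd x * \<omega> x)) < \<infinity>"
  shows "vort (clean \<omega>)" "set_nn_integral lborel upper_half (\<lambda>x. ennreal (snd x * \<omega> x)) = ennreal (imp (clean \<omega>))"
proof -
  have i: "integrable lborel (\<lambda>x. snd x * clean \<omega> x)"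
  proof (rule integrableI_nonneg)
    show "(\<integral>\<^sup>+x. ennreal (snd x * clean \<omega> x) \<partial>lborel) < \<infinity>" using assms unfolding nn_impulse_clean .
    have "(\<lambda>x. snd x * clean \<omega> x) \<in> borel_measurable borel" by measurable
    then show "(\<lambda>x. snd x * clean \<omega> x) \<in> borel_measurable lborel" by simp
  qed (simp add: snd_clean_nonneg)
  then show "vort (clean \<omega>)" unfolding vort_def using clean_sq by (auto simp: clean_def)
  show "set_nn_integral lborel upper_half (\<lambda>x. ennreal (snd x * \<omega> x)) = ennreal (imp (clean \<omega>))"
    unfolding nn_impulse_clean imp_def using i snd_clean_nonneg by (intro nn_integral_eq_integral) auto
qed

text \<open>For fixed x the diagonal is a single point, hence a null set, so the clipping in
  \<open>ker\<close> does not affect the integral.\<close>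

lemma Gop_clean: "x \<in> upper_half \<Longrightarrow> Gop \<omega> x = pot (clean \<omega>) x"
  unfolding Gop_def pot_def set_lebesgue_integral_def
proof (rule integral_cong_AE)
  assume x: "x \<in> upper_half"
  show "AE y in lborel. indicator upper_half y *\<^sub>R (GreenPi x y * \<omega> y) = ker x y * clean \<omega> y"
    using AE_clean AE_lborel_singleton[of x]
  proof eventually_elim
    fix y assume "clean \<omega> y = indicator upper_half y * \<omega> y" "y \<noteq> x"
    then show "indicator upper_half y *\<^sub>R (GreenPi x y * \<omega> y) = ker x y * clean \<omega> y"
      using ker_eq_GreenPi[OF x, of y] by (cases "y \<in> upper_half") auto
  qed
  \<comment> \<open>Measurability is known for the vorticity times the indicator of the half-plane,
    so the integrand is regrouped around that product.\<close>
  have "(\<lambda>y. (gam (x - y) - gam (x - reflect y)) * (indicator upper_half y * \<omega> y)) \<in> borel_measurable lborel"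
    by measurable
  then show "(\<lambda>y. indicator upper_half y *\<^sub>R (GreenPi x y * \<omega> y)) \<in> borel_measurable lborel"
    by (simp add: GreenPi_gam mult_ac)
qed measurable

lemma energy_clean: "energy \<omega> = form (clean \<omega>) (clean \<omega>) / 2"
proof -
  note [measurable] = pot_measurable[OF clean_measurable]
  have eq: "indicator upper_half x *\<^sub>R (\<omega> x * Gop \<omega> x) = indicator upper_half x * \<omega> x * pot (clean \<omega>) x" for x
    using Gop_clean[of x] by (auto simp: indicator_def)
  have "energy \<omega> = 1 / 2 * (LBINT x. indicator upper_half x * \<omega> x * pot (clean \<omega>) x)"
    unfolding energy_def set_lebesgue_integral_def eq ..
  also have "(LBINT x. indicator upper_half x * \<omega> x * pot (clean \<omega>) x) = (LBINT x. clean \<omega> x * pot (clean \<omega>) x)"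
  proof (rule integral_cong_AE)
    show "AE x in lborel. indicator upper_half x * \<omega> x * pot (clean \<omega>) x = clean \<omega> x * pot (clean \<omega>) x"
      using AE_clean by eventually_elim simp
  qed measurable
  also have "\<dots> = form (clean \<omega>) (clean \<omega>)" by (rule form_pot(1)[OF clean_sq clean_sq, symmetric])
  finally show ?thesis by simp
qed

lemma energy_lam_clean: "energy_lam lam \<omega> = Elam lam (clean \<omega>)"
  by (simp add: energy_lam_def energy_clean sq_int_clean Elam_def)

text \<open>The almost-everywhere statement is coded as the vanishing of a nonnegative integral,
  which is translation invariant; the half-plane is unchanged by horizontal shifts.\<close>

lemma AE_shift_clean: "AE x in lborel. shift1 (clean \<omega>) c x = indicator upper_half x * shift1 \<omega> c x"
proof -
  let ?f = "\<lambda>x. ennreal \<bar>clean \<omega> x - indicator upper_half x * \<omega> x\<bar>"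
  have m: "?f \<in> borel_measurable borel" by measurable
  have "(\<integral>\<^sup>+x. ?f x \<partial>lborel) = 0"
    using AE_clean by (subst nn_integral_0_iff_AE) (use m in \<open>auto elim: eventually_mono\<close>)
  then have "(\<integral>\<^sup>+x. ?f (x + (c, 0)) \<partial>lborel) = 0" using nn_integral_lborel_shift[OF m, of "(c, 0)"] by simp
  moreover have "(\<lambda>x. ?f (x + (c, 0))) \<in> borel_measurable lborel"
  proof -
    have "(\<lambda>x. x + (c, 0)) \<in> borel \<rightarrow>\<^sub>M (borel :: (real \<times> real) measure)"
      by (intro borel_measurable_continuous_onI continuous_intros)
    from measurable_compose[OF this m] show ?thesis by simp
  qed
  ultimately have "AE x in lborel. ?f (x + (c, 0)) = 0" by (subst (asm) nn_integral_0_iff_AE) auto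
  then show ?thesis
  proof eventually_elim
    fix x :: "real \<times> real" assume "?f (x + (c, 0)) = 0"
    moreover have "indicator upper_half (x + (c, 0)) = (indicator upper_half x :: real)"
      by (auto simp: indicator_def upper_half_def)
    ultimately show "shift1 (clean \<omega>) c x = indicator upper_half x * shift1 \<omega> c x"
      by (simp add: shift1_eq)
  qed
qed

end

lemma vorticity_vort:
  assumes "vort w"
  shows "vorticity w"
proof
  note v = vortD[OF assms]
  have eq: "indicator upper_half x * w x = w x" "indicator upper_half x *\<^sub>R (w x)\<^sup>2 = (w x)\<^sup>2" for x
    using v(3)[of x] by (auto simp: indicator_def)
  show "in_L2 w" unfolding in_L2_def set_integrable_def eq
    using v(5) square_integrable_sq[OF v(1)] by simp
  show "nonneg_ae w" using v(2) by (simp add: nonneg_ae_def)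
qed

lemma admissible_vort:
  assumes "vort w" "imp w = \<mu>" "integrable lborel w" "(LBINT x. w x) \<le> \<nu>"
  shows "w \<in> admissible \<mu> \<nu>" "energy_lam lam w = Elam lam w"
proof -
  interpret vorticity w by (rule vorticity_vort[OF assms(1)])
  note v = vortD[OF assms(1)] and cl = clean_vort[OF assms(1)]
  have "(\<integral>\<^sup>+x. ennreal (snd x * w x) \<partial>lborel) = ennreal \<mu>"
    using v(4,6) assms(2) by (subst nn_integral_eq_integral) (auto simp: imp_def)
  moreover have "(\<integral>\<^sup>+x. ennreal (w x) \<partial>lborel) \<le> ennreal \<nu>"
    using v(2) assms(3,4) by (subst nn_integral_eq_integral) (auto intro: ennreal_leI)
  ultimately show "w \<in> admissible \<mu> \<nu>"
    unfolding admissible_def using L2 nonneg nn_impulse_clean nn_mass_clean by (simp add: cl)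
  show "energy_lam lam w = Elam lam w" using energy_lam_clean by (simp add: cl)
qed

text \<open>The sharp inequality bounds every admissible energy. Conversely, near-optimizers of mass
  at most 4\<lambda>\<mu> are admissible, and their efficiency \<theta> may be taken arbitrarily
  close to 1.\<close>

lemma S_max_eq:
  assumes lam: "lam > 1" and \<mu>: "\<mu> > 0" and \<nu>: "4 * lam * \<mu> \<le> \<nu>"
  shows "S_max \<mu> \<nu> lam = kappa lam * \<mu>\<^sup>2"
proof -
  have \<kappa>: "kappa lam > 0" by (rule kappa_pos[OF lam])
  have le: "energy_lam lam \<omega> \<le> kappa lam * \<mu>\<^sup>2" if "\<omega> \<in> admissible \<mu> \<nu>" for \<omega>
  proof -
    interpret vorticity \<omega> using that by unfold_locales (auto simp: admissible_def)
    have a: "set_nn_integral lborel upper_half (\<lambda>x. ennreal (snd x * \<omega> x)) = ennreal \<mu>"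
      using that by (simp add: admissible_def)
    then have v: "vort (clean \<omega>)" and "ennreal (imp (clean \<omega>)) = ennreal \<mu>" using vort_clean by auto
    then have "imp (clean \<omega>) = \<mu>" using \<mu> imp_nonneg[OF v] by simp
    then show ?thesis using Elam_le_kappa[OF _ v, of lam] lam by (simp add: energy_lam_clean)
  qed
  have ge: "\<theta> * (kappa lam * \<mu>\<^sup>2) \<le> S_max \<mu> \<nu> lam" if \<theta>: "1 / 4 \<le> \<theta>" "\<theta> < 1" for \<theta>
  proof -
    obtain w where w: "vort w" "imp w = \<mu>" "integrable lborel w" "(LBINT x. w x) \<le> 4 * lam * \<mu>"
      "\<theta> * kappa lam * \<mu>\<^sup>2 \<le> Elam lam w"
      using near_optimal_of_small_mass[OF lam \<mu> \<theta>] by blast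
    have "(LBINT x. w x) \<le> \<nu>" using w(4) \<nu> by linarith
    note a = admissible_vort[OF w(1-3) this]
    have "energy_lam lam w \<le> S_max \<mu> \<nu> lam"
      unfolding S_max_def using le by (intro cSUP_upper a(1) bdd_aboveI2)
    then show ?thesis using w(5) a(2) by (simp add: mult.assoc)
  qed
  have "admissible \<mu> \<nu> \<noteq> {}"
  proof -
    obtain w where w: "vort w" "imp w = \<mu>" "integrable lborel w" "(LBINT x. w x) \<le> 4 * lam * \<mu>"
      using near_optimal_of_small_mass[OF lam \<mu>, of "1 / 2"] by auto
    have "(LBINT x. w x) \<le> \<nu>" using w(4) \<nu> by linarith
    from admissible_vort(1)[OF w(1-3) this] show ?thesis by blast
  qed
  then have "S_max \<mu> \<nu> lam \<le> kappa lam * \<mu>\<^sup>2" unfolding S_max_def by (rule cSUP_least) (rule le)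
  moreover have "kappa lam * \<mu>\<^sup>2 \<le> S_max \<mu> \<nu> lam"
  proof (rule field_le_mult_one_interval)
    fix t :: real assume t: "0 < t" "t < 1"
    \<comment> \<open>The near-optimizers are available for \<theta> \<ge> 1/4, so smaller t are
      first raised to 1/4.\<close>
    have "t * (kappa lam * \<mu>\<^sup>2) \<le> max t (1 / 4) * (kappa lam * \<mu>\<^sup>2)"
      using \<kappa> by (intro mult_right_mono) auto
    also have "\<dots> \<le> S_max \<mu> \<nu> lam" using t by (intro ge) auto
    finally show "t * (kappa lam * \<mu>\<^sup>2) \<le> S_max \<mu> \<nu> lam" .
  qed
  ultimately show ?thesis by simp
qed

lemma maximizing_sequence_compact:
  fixes \<omega>s :: "nat \<Rightarrow> real \<times> real \<Rightarrow> real"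
  assumes lam: "lam > 1" and \<mu>: "\<mu> > 0" and \<nu>: "4 * lam * \<mu> \<le> \<nu>"
    and \<omega>s: "\<And>n. nonneg_ae (\<omega>s n)" "\<And>n. in_L1 (\<omega>s n)" "\<And>n. in_L2 (\<omega>s n)" "\<And>n. mass (\<omega>s n) \<le> \<nu>" "\<And>n. sqrt (sq_int (\<omega>s n)) \<le> C"
    and imp_lim: "(\<lambda>n. set_nn_integral lborel upper_half (\<lambda>x. ennreal (snd x * \<omega>s n x))) \<longlonglongrightarrow> ennreal \<mu>"
    and en_lim: "(\<lambda>n. energy_lam lam (\<omega>s n)) \<longlonglongrightarrow> S_max \<mu> \<nu> lam"
  shows "\<exists>\<omega> \<in> maximizers \<mu> \<nu> lam. \<exists>r :: nat \<Rightarrow> nat. \<exists>c :: nat \<Rightarrow> real. strict_mono r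
          \<and> ((\<lambda>k. set_nn_integral lborel upper_half
                 (\<lambda>x. ennreal ((shift1 (\<omega>s (r k)) (c k) x - \<omega> x)\<^sup>2))) \<longlonglongrightarrow> 0)
          \<and> ((\<lambda>k. set_nn_integral lborel upper_half
                 (\<lambda>x. ennreal \<bar>snd x * shift1 (\<omega>s (r k)) (c k) x - snd x * \<omega> x\<bar>)) \<longlonglongrightarrow> 0)"
proof -
  have \<nu>0: "\<nu> > 0" using lam \<mu> \<nu> by (smt (verit) mult_pos_pos)
  have vt: "vorticity (\<omega>s n)" for n using \<omega>s by unfold_locales auto
  have C: "C \<ge> 0"
  proof -
    have "0 \<le> sqrt (sq_int (\<omega>s 0))" unfolding vorticity.sq_int_clean[OF vt] by simp
    with \<omega>s(5)[of 0] show ?thesis by linarith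
  qed
  \<comment> \<open>Finitely many terms may have infinite impulse; they are dropped, since
    \<open>vort\<close> requires a finite one.\<close>
  have "eventually (\<lambda>n. set_nn_integral lborel upper_half (\<lambda>x. ennreal (snd x * \<omega>s n x)) < \<infinity>) sequentially"
    using imp_lim by (rule order_tendstoD) simp
  then obtain N where N: "\<And>n. n \<ge> N \<Longrightarrow> set_nn_integral lborel upper_half (\<lambda>x. ennreal (snd x * \<omega>s n x)) < \<infinity>"
    unfolding eventually_sequentially by blast
  define w where "w n = clean (\<omega>s (n + N))" for n
  have w: "vort (w n)" and wi: "set_nn_integral lborel upper_half (\<lambda>x. ennreal (snd x * \<omega>s (n + N) x)) = ennreal (imp (w n))" for n
    using vorticity.vort_clean[OF vt N] by (simp_all add: w_def)
  have L1: "integrable lborel (w n)" and m: "(LBINT x. w n x) \<le> \<nu>" for n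
  proof -
    have i: "integrable lborel (\<lambda>x. indicator upper_half x * \<omega>s (n + N) x)"
      using \<omega>s(2)[of "n + N"] by (simp add: in_L1_def set_integrable_def)
    have ae: "AE x in lborel. w n x = indicator upper_half x * \<omega>s (n + N) x"
      unfolding w_def by (rule vorticity.AE_clean[OF vt])
    have wm: "w n \<in> borel_measurable lborel" using vortD(5)[OF w] by simp
    show "integrable lborel (w n)" by (rule integrable_cong_AE_imp[OF i wm AE_symmetric[OF ae]])
    have "(LBINT x. w n x) = mass (\<omega>s (n + N))"
      unfolding mass_def set_lebesgue_integral_def real_scaleR_def using ae wm i by (intro integral_cong_AE) auto
    then show "(LBINT x. w n x) \<le> \<nu>" using \<omega>s(4)[of "n + N"] by simp
  qed
  have sq: "(LBINT x. (w n x)\<^sup>2) \<le> C\<^sup>2" for n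
    using \<omega>s(5)[of "n + N"] unfolding vorticity.sq_int_clean[OF vt] w_def by (rule sqrt_le_D)
  have "(\<lambda>n. ennreal (imp (w n))) \<longlonglongrightarrow> ennreal \<mu>"
    unfolding wi[symmetric] by (rule LIMSEQ_ignore_initial_segment[OF imp_lim])
  then have il: "(\<lambda>n. imp (w n)) \<longlonglongrightarrow> \<mu>"
    using \<mu> imp_nonneg[OF w] by (subst (asm) tendsto_ennreal_iff) auto
  have el: "(\<lambda>n. Elam lam (w n)) \<longlonglongrightarrow> kappa lam * \<mu>\<^sup>2"
    using LIMSEQ_ignore_initial_segment[OF en_lim, of N]
    unfolding S_max_eq[OF lam \<mu> \<nu>] vorticity.energy_lam_clean[OF vt] w_def .
  obtain r c F where r: "strict_mono r" and lim: "maximizing_weak_limit lam \<mu> \<nu> C (\<lambda>n. shift1 (w (r n)) (c n)) F"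
    using concentration_compactness[OF lam \<mu> \<nu>0 C w L1 m sq il el] by blast
  interpret maximizing_weak_limit lam \<mu> \<nu> C "\<lambda>n. shift1 (w (r n)) (c n)" F by (rule lim)
  note a = admissible_vort[OF vort_F imp_F integrable_F mass_F_le]
  have "F \<in> maximizers \<mu> \<nu> lam"
    using a(1) a(2)[of lam] Elam_F S_max_eq[OF lam \<mu> \<nu>] by (simp add: maximizers_def)
  moreover have "strict_mono (\<lambda>k. r k + N)" using r by (simp add: strict_mono_def)
  moreover have "(\<lambda>k. set_nn_integral lborel upper_half (\<lambda>x. ennreal ((shift1 (\<omega>s (r k + N)) (c k) x - F x)\<^sup>2))) \<longlonglongrightarrow> 0"
  proof -
    \<comment> \<open>In the half-plane the given functions agree almost everywhere with their
      cleaned versions after the shift, and outside it both the cleaned functions and F vanish; so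
      the set integral becomes one over the plane.\<close>
    have "set_nn_integral lborel upper_half (\<lambda>x. ennreal ((shift1 (\<omega>s (r k + N)) (c k) x - F x)\<^sup>2))
      = ennreal (LBINT x. (shift1 (w (r k)) (c k) x - F x)\<^sup>2)" (is "?l = ?r") for k
    proof -
      have "?l
        = (\<integral>\<^sup>+x. ennreal ((shift1 (w (r k)) (c k) x - F x)\<^sup>2) \<partial>lborel)"
      proof (rule nn_integral_cong_AE)
        show "AE x in lborel. ennreal ((shift1 (\<omega>s (r k + N)) (c k) x - F x)\<^sup>2) * indicator upper_half x
          = ennreal ((shift1 (w (r k)) (c k) x - F x)\<^sup>2)"
          using vorticity.AE_shift_clean[OF vt[of "r k + N"], of "c k"] unfolding w_def[symmetric]
          by eventually_elim (auto simp: indicator_def F(3))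
      qed
      also have "\<dots> = ?r"
        by (intro nn_integral_eq_integral square_integrable_sq square_integrable_diff sqs F) auto
      finally show ?thesis .
    qed
    then show ?thesis using tendsto_ennrealI[OF strong_L2] by simp
  qed
  moreover have "(\<lambda>k. set_nn_integral lborel upper_half (\<lambda>x. ennreal \<bar>snd x * shift1 (\<omega>s (r k + N)) (c k) x - snd x * F x\<bar>)) \<longlonglongrightarrow> 0"
  proof -
    have "set_nn_integral lborel upper_half (\<lambda>x. ennreal \<bar>snd x * shift1 (\<omega>s (r k + N)) (c k) x - snd x * F x\<bar>)
      = ennreal (LBINT x. \<bar>snd x * shift1 (w (r k)) (c k) x - snd x * F x\<bar>)" (is "?l = ?r") for k
    proof -
      have "?l
        = (\<integral>\<^sup>+x. ennreal \<bar>snd x * shift1 (w (r k)) (c k) x - snd x * F x\<bar> \<partial>lborel)"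
      proof (rule nn_integral_cong_AE)
        show "AE x in lborel. ennreal \<bar>snd x * shift1 (\<omega>s (r k + N)) (c k) x - snd x * F x\<bar> * indicator upper_half x
          = ennreal \<bar>snd x * shift1 (w (r k)) (c k) x - snd x * F x\<bar>"
          using vorticity.AE_shift_clean[OF vt[of "r k + N"], of "c k"] unfolding w_def[symmetric]
          by eventually_elim (auto simp: indicator_def F(3))
      qed
      also have "\<dots> = ?r"
        using vortD(4)[OF u(1), of k] vortD(4)[OF vort_F] by (intro nn_integral_eq_integral) auto
      finally show ?thesis .
    qed
    then show ?thesis using tendsto_ennrealI[OF strong_L1] by simp
  qed
  ultimately show ?thesis by (intro bexI[of _ F] exI[of _ "\<lambda>k. r k + N"] exI[of _ c]) auto
qed

theorem theorem5p1:
  fixes lam \<mu> :: real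
  assumes "lam > 1" and "\<mu> > 0"
  shows "\<exists>\<nu>0 > \<mu> * varrho lam. \<forall>\<nu> \<ge> \<nu>0. \<forall>(\<omega>s :: nat \<Rightarrow> real \<times> real \<Rightarrow> real) C.
    ((\<forall>n. nonneg_ae (\<omega>s n) \<and> in_L1 (\<omega>s n) \<and> in_L2 (\<omega>s n) \<and> mass (\<omega>s n) \<le> \<nu>
          \<and> sqrt (sq_int (\<omega>s n)) \<le> C)
     \<and> ((\<lambda>n. set_nn_integral lborel upper_half (\<lambda>x. ennreal (snd x * \<omega>s n x)))
          \<longlonglongrightarrow> ennreal \<mu>)
     \<and> ((\<lambda>n. energy_lam lam (\<omega>s n)) \<longlonglongrightarrow> S_max \<mu> \<nu> lam))
    \<longrightarrow> (\<exists>\<omega> \<in> maximizers \<mu> \<nu> lam. \<exists>r :: nat \<Rightarrow> nat. \<exists>c :: nat \<Rightarrow> real. strict_mono r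
          \<and> ((\<lambda>k. set_nn_integral lborel upper_half
                 (\<lambda>x. ennreal ((shift1 (\<omega>s (r k)) (c k) x - \<omega> x)\<^sup>2))) \<longlonglongrightarrow> 0)
          \<and> ((\<lambda>k. set_nn_integral lborel upper_half
                 (\<lambda>x. ennreal \<bar>snd x * shift1 (\<omega>s (r k)) (c k) x - snd x * \<omega> x\<bar>)) \<longlonglongrightarrow> 0))"
proof (intro exI[of _ "max (\<mu> * varrho lam + 1) (4 * lam * \<mu>)"] conjI allI impI)
  \<comment> \<open>The first entry of the maximum, with its extra 1, secures the strict inequality;
    the second is the mass threshold from which on \<open>S_max\<close> equals
    \<kappa>\<mu>^2.\<close>
  show "\<mu> * varrho lam < max (\<mu> * varrho lam + 1) (4 * lam * \<mu>)" by simp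
qed (rule maximizing_sequence_compact[OF assms], auto)

end
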